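(* Let $G \subset \mathrm{GL}(V)$ be a pseudo-reflection group with rank $r=\dim(V/V^G)$, and suppose $G = G(m,1,n)$ for some $m,n\ge1$ or $G$ is real. Then the $\theta$-degree $r$ component $\mathcal{SH}_G^r$ of $\mathcal{SH}_G$ satisfies $$\mathcal{SH}_G^r = K[\partial_{x_1}, \ldots, \partial_{x_n}]\, (\mathcal{SH}_G^r)^{\det} = \{\partial_g\, \mathrm{d}_{i_1} \cdots \mathrm{d}_{i_r} \Delta_G : g \in K[x_1, \ldots, x_n],\ i_1,\dots,i_r \in \{1,\dots,r\} \}.$$
   Context: Setting. $K \subset \mathbb{C}$ is a subfield closed under complex conjugation, $V = K^n$. A pseudo-reflection group $G \subset \mathrm{GL}(V)$ is a finite group of unitary matrices generated by pseudo-reflections (non-identity transformations of finite order fixing a hyperplane pointwise). $G$ is real if its reflection representation is realizable over $\mathbb{R}$, i.e. after a unitary change of coordinates all its matrices have real entries. $G(m,p,n)$ (with $p\mid m$) is the group of $n\times n$ matrices with exactly one non-zero entry in each row and column, each such entry an $m$th root of unity (assumed to lie in $K$), such that the product of the non-zero entries raised to the power $m/p$ is $1$. $V^G$ is the space of $G$-fixed vectors. Differential forms. $x_1,\dots,x_n$ are the coordinate functions on $V$. $K[x_1,\dots,x_n,\theta_1,\dots,\theta_n]$ is the $K$-algebra with $x_ix_j=x_jx_i$, $x_i\theta_j=\theta_jx_i$, $\theta_i\theta_j=-\theta_j\theta_i$ (so $\theta_i^2=0$), bigraded by $x$-degree and $\theta$-degree. $G$ acts by $K$-algebra automorphisms with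 $\sigma\cdot x_j=\sum_i\overline{\sigma_{ij}}x_i$, $\sigma\cdot\theta_j=\sum_i\overline{\sigma_{ij}}\theta_i$. $\partial_{x_i}$ is the usual ($\theta$-linear) partial derivative; $\partial_{\theta_i}$ is the $x$-linear interior product: for $i_1<\dots<i_k$, $\partial_{\theta_i}\theta_{i_1}\cdots\theta_{i_k}=(-1)^{\ell-1}\theta_{i_1}\cdots\widehat{\theta_{i_\ell}}\cdots\theta_{i_k}$ if $i=i_\ell$, and $0$ otherwise. For $\omega=\sum c_{\alpha,I}x^\alpha\theta_{i_1}\cdots\theta_{i_k}$ put $\partial_\omega=\sum\overline{c_{\alpha,I}}\,\partial_{x_1}^{\alpha_1}\cdots\partial_{x_n}^{\alpha_n}\partial_{\theta_{i_k}}\cdots\partial_{\theta_{i_1}}$. Super harmonics. $\mathcal{J}_G$ is the ideal of $K[x_1,\dots,x_n,\theta_1,\dots,\theta_n]$ generated by the bi-homogeneous $G$-invariant elements of positive total degree, and $\mathcal{SH}_G=\{\eta:\partial_\omega\eta=0\text{ for all }\omega\in\mathcal{J}_G\}$; $\mathcal{SH}_G^k$ is its $\theta$-degree $k$ component. $(\mathcal{SH}_G^k)^{\det}=\{\eta\in\mathcal{SH}_G^k:\sigma\cdot\eta=\det(\sigma)\eta\ \forall\sigma\in G\}$. $K[\partial_{x_1},\dots,\partial_{x_n}]W$ is the span of all $\partial_g\eta$ with $g\in K[x_1,\dots,x_n]$, $\eta\in W$. Vandermondian. $\mathcal{H}_G=\mathcal{SH}_G^0\subset K[x_1,\dots,x_n]$.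 Its top-degree component is one-dimensional; $\Delta_G$ is a spanning element (it satisfies $\sigma\cdot\Delta_G=\det(\sigma)\Delta_G$). Generalized exterior derivatives. Let $f_1,\dots,f_n$ be algebraically independent homogeneous generators of $K[x_1,\dots,x_n]^G$. Viewing $\theta_j$ as left multiplication, there are bi-homogeneous $G$-equivariant operators $\mathrm{d}_1,\dots,\mathrm{d}_n\in K[\partial_{x_1},\dots,\partial_{x_n},\theta_1,\dots,\theta_n]$, each raising $\theta$-degree by $1$, such that $\{\partial_{f_1}^{\alpha_1}\cdots\partial_{f_n}^{\alpha_n}\mathrm{d}_{i_1}\cdots\mathrm{d}_{i_k}:\alpha_i\ge0,\ 1\le i_1<\dots<i_k\le n,\ 0\le k\le n\}$ is a $K$-basis of the $G$-equivariant operators in that algebra (Orlik--Solomon). They are indexed so that $\mathrm{d}_1,\dots,\mathrm{d}_r$ are those strictly lowering $x$-degree. *)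

theory Defs
  imports
    "HOL-Analysis.Analysis"
    "HOL-Algebra.Generated_Groups"
    "HOL-Library.Poly_Mapping"
    "HOL-Library.Function_Algebras"
begin

text \<open>The coordinates of \<open>V = K^n\<close> are indexed by a finite linearly ordered type \<open>'n\<close> with
  \<open>n = CARD('n)\<close>; the order is needed for the signs in the exterior algebra.  All objects live
  over \<open>complex\<close>, and the subfield \<open>K\<close> is a set of scalars cutting out the \<open>K\<close>-rational ones.\<close>

definition conj_subfield :: "complex set \<Rightarrow> bool" where
  "conj_subfield K \<longleftrightarrow> 0 \<in> K \<and> 1 \<in> K \<and>
     (\<forall>a\<in>K. \<forall>b\<in>K. a + b \<in> K \<and> a * b \<in> K) \<and>
     (\<forall>a\<in>K. - a \<in> K \<and> inverse a \<in> K \<and> cnj a \<in> K)"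


section \<open>Linear algebra over a subfield of the complex numbers\<close>

definition K_span :: "complex set \<Rightarrow> (complex \<Rightarrow> 'v \<Rightarrow> 'v) \<Rightarrow> 'v set \<Rightarrow> ('v::comm_monoid_add) set" where
  "K_span K scl S = {\<Sum>v\<in>F. scl (c v) v | F c. finite F \<and> F \<subseteq> S \<and> c ` F \<subseteq> K}"

text \<open>Meant for \<open>K\<close>-subspaces \<open>W\<close>: since \<open>0 \<in> W\<close>, uniqueness includes linear independence.\<close>

definition K_basis :: "complex set \<Rightarrow> (complex \<Rightarrow> 'v \<Rightarrow> 'v) \<Rightarrow> ('i \<Rightarrow> 'v) \<Rightarrow> 'i set \<Rightarrow>
    ('v::comm_monoid_add) set \<Rightarrow> bool" where
  "K_basis K scl b I W \<longleftrightarrow> b ` I \<subseteq> W \<and>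
     (\<forall>w\<in>W. \<exists>!c :: 'i \<Rightarrow>\<^sub>0 complex. Poly_Mapping.keys c \<subseteq> I \<and> range (Poly_Mapping.lookup c) \<subseteq> K \<and>
        w = (\<Sum>i\<in>Poly_Mapping.keys c. scl (Poly_Mapping.lookup c i) (b i)))"

definition K_dim :: "complex set \<Rightarrow> (complex \<Rightarrow> 'v \<Rightarrow> 'v) \<Rightarrow> ('v::comm_monoid_add) set \<Rightarrow> nat" where
  "K_dim K scl W = (THE d. \<exists>b. K_basis K scl b {..<d} W)"

definition K_vecs :: "complex set \<Rightarrow> (complex ^ 'n) set" where
  "K_vecs K = {v. \<forall>i. v $ i \<in> K}"


section \<open>Pseudo-reflection groups\<close>

text \<open>The same type as \<open>complex ^ 'n ^ 'n\<close>; this notation leaves the sort of \<open>'n\<close> open.\<close>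

type_synonym 'n cmat = "((complex, 'n) vec, 'n) vec"

definition adj :: "complex ^ 'n ^ 'n \<Rightarrow> complex ^ 'n ^ 'n" where
  "adj A = (\<chi> i j. cnj (A $ j $ i))"

definition unitary :: "complex ^ 'n ^ 'n \<Rightarrow> bool" where
  "unitary A \<longleftrightarrow> A ** adj A = mat 1 \<and> adj A ** A = mat 1"

text \<open>The inverse of an invertible matrix over \<open>K\<close> automatically has entries in \<open>K\<close>.\<close>

definition GL :: "complex set \<Rightarrow> (complex ^ 'n ^ 'n) monoid" where
  "GL K = \<lparr>carrier = {A. (\<forall>i j. A $ i $ j \<in> K) \<and> invertible A}, mult = (**), one = mat 1\<rparr>"

definition pseudo_reflection :: "complex set \<Rightarrow> complex ^ 'n ^ 'n \<Rightarrow> bool" where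
  "pseudo_reflection K A \<longleftrightarrow> A \<in> carrier (GL K) \<and> A \<noteq> mat 1 \<and>
     (\<exists>k>0. ((**) A ^^ k) (mat 1) = mat 1) \<and>
     (\<exists>a\<in>K_vecs K. a \<noteq> 0 \<and> (\<forall>v\<in>K_vecs K. (\<Sum>i\<in>UNIV. a $ i * v $ i) = 0 \<longrightarrow> A *v v = v))"

definition pseudo_reflection_group :: "complex set \<Rightarrow> (complex ^ 'n ^ 'n) set \<Rightarrow> bool" where
  "pseudo_reflection_group K G \<longleftrightarrow> finite G \<and> (\<forall>A\<in>G. unitary A) \<and>
     (\<exists>S. (\<forall>A\<in>S. pseudo_reflection K A) \<and> G = generate (GL K) S)"

text \<open>The unitary change of coordinates is allowed to be complex, not just \<open>K\<close>-rational.\<close>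

definition real_group :: "(complex ^ 'n ^ 'n) set \<Rightarrow> bool" where
  "real_group G \<longleftrightarrow> (\<exists>U. unitary U \<and> (\<forall>A\<in>G. \<forall>i j. (U ** A ** adj U) $ i $ j \<in> \<real>))"

definition G_mpn :: "nat \<Rightarrow> nat \<Rightarrow> (complex ^ 'n ^ 'n) set" where
  "G_mpn m p = {A. (\<forall>i. \<exists>!j. A $ i $ j \<noteq> 0) \<and> (\<forall>j. \<exists>!i. A $ i $ j \<noteq> 0) \<and>
     (\<forall>i j. A $ i $ j \<noteq> 0 \<longrightarrow> (A $ i $ j) ^ m = 1) \<and>
     (\<Prod>(i, j) | A $ i $ j \<noteq> 0. A $ i $ j) ^ (m div p) = 1}"

definition fixed_space :: "complex set \<Rightarrow> (complex ^ 'n ^ 'n) set \<Rightarrow> (complex ^ 'n) set" where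
  "fixed_space K G = {v \<in> K_vecs K. \<forall>A\<in>G. A *v v = v}"

definition refl_rank :: "complex set \<Rightarrow> (complex ^ 'n ^ 'n) set \<Rightarrow> nat" where
  "refl_rank K G = CARD('n) - K_dim K (*s) (fixed_space K G)"


section \<open>Polynomials\<close>

text \<open>A polynomial is a finitely supported map from exponent vectors to coefficients; the ring
  structure is the one of \<^theory>\<open>HOL-Library.Poly_Mapping\<close>.\<close>

type_synonym 'i mpol = "('i \<Rightarrow>\<^sub>0 nat) \<Rightarrow>\<^sub>0 complex"

definition K_pols :: "complex set \<Rightarrow> 'i mpol set" where
  "K_pols K = {p. range (Poly_Mapping.lookup p) \<subseteq> K}"

definition pconst :: "complex \<Rightarrow> 'i mpol" where
  "pconst c = Poly_Mapping.single 0 c"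

definition pvar :: "'i \<Rightarrow> 'i mpol" where
  "pvar i = Poly_Mapping.single (Poly_Mapping.single i 1) 1"

definition psubst :: "('i \<Rightarrow> 'j mpol) \<Rightarrow> 'i mpol \<Rightarrow> 'j mpol" where
  "psubst h p = (\<Sum>\<alpha>\<in>Poly_Mapping.keys p.
     pconst (Poly_Mapping.lookup p \<alpha>)
       * (\<Prod>i\<in>Poly_Mapping.keys \<alpha>. h i ^ Poly_Mapping.lookup \<alpha> i))"

definition pderiv_x :: "'i \<Rightarrow> 'i mpol \<Rightarrow> 'i mpol" where
  "pderiv_x i p = (\<Sum>\<alpha>\<in>Poly_Mapping.keys p.
     Poly_Mapping.single (\<alpha> - Poly_Mapping.single i 1)
       (of_nat (Poly_Mapping.lookup \<alpha> i) * Poly_Mapping.lookup p \<alpha>))"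

definition mdeg :: "('i \<Rightarrow>\<^sub>0 nat) \<Rightarrow> nat" where
  "mdeg \<alpha> = (\<Sum>i\<in>Poly_Mapping.keys \<alpha>. Poly_Mapping.lookup \<alpha> i)"


section \<open>The algebra of polynomial differential forms\<close>

text \<open>\<open>coef \<omega> I\<close> is the polynomial coefficient of \<open>\<theta>_{i_1} ... \<theta>_{i_k}\<close> in \<open>\<omega>\<close>, where
  \<open>I = {i_1 < ... < i_k}\<close>.\<close>

typedef 'n form = "UNIV :: ('n set \<Rightarrow> 'n mpol) set"
  morphisms coef Form by simp

lemma coef_Form [simp]: "coef (Form f) = f"
  by (simp add: Form_inverse)

lemma form_eqI: "(\<And>I. coef \<omega> I = coef \<eta> I) \<Longrightarrow> \<omega> = \<eta>"
  by (metis coef_inject ext)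

text \<open>\<open>\<theta>_I \<theta>_J = (-1) ^ k \<theta>_{I \<union> J}\<close> for disjoint \<open>I\<close> and \<open>J\<close>, where \<open>k\<close> is the number of
  inversions between \<open>I\<close> and \<open>J\<close>.\<close>

definition theta_sign :: "'n::linorder set \<Rightarrow> 'n set \<Rightarrow> 'a::ring_1" where
  "theta_sign I J = (- 1) ^ card {(i, j). i \<in> I \<and> j \<in> J \<and> j < i}"

lemma theta_sign_empty [simp]: "theta_sign {} J = 1" "theta_sign I {} = 1"
  by (simp_all add: theta_sign_def)

lemma theta_sign_Un_right:
  fixes A B C :: "'n::{finite,linorder} set"
  assumes "B \<inter> C = {}"
  shows "theta_sign A (B \<union> C) = (theta_sign A B * theta_sign A C :: 'a::ring_1)"
proof -
  have "{(i, j). i \<in> A \<and> j \<in> B \<union> C \<and> j < i} =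
      {(i, j). i \<in> A \<and> j \<in> B \<and> j < i} \<union> {(i, j). i \<in> A \<and> j \<in> C \<and> j < i}" by auto
  moreover have "{(i, j). i \<in> A \<and> j \<in> B \<and> j < i} \<inter> {(i, j). i \<in> A \<and> j \<in> C \<and> j < i} = {}"
    using assms by auto
  ultimately show ?thesis by (simp add: theta_sign_def card_Un_disjoint power_add)
qed

lemma theta_sign_Un_left:
  fixes A B C :: "'n::{finite,linorder} set"
  assumes "A \<inter> B = {}"
  shows "theta_sign (A \<union> B) C = (theta_sign A C * theta_sign B C :: 'a::ring_1)"
proof -
  have "{(i, j). i \<in> A \<union> B \<and> j \<in> C \<and> j < i} =
      {(i, j). i \<in> A \<and> j \<in> C \<and> j < i} \<union> {(i, j). i \<in> B \<and> j \<in> C \<and> j < i}" by auto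
  moreover have "{(i, j). i \<in> A \<and> j \<in> C \<and> j < i} \<inter> {(i, j). i \<in> B \<and> j \<in> C \<and> j < i} = {}"
    using assms by auto
  ultimately show ?thesis by (simp add: theta_sign_def card_Un_disjoint power_add)
qed

instantiation form :: ("{finite,linorder}") ring_1
begin

definition zero_form :: "'a form" where "zero_form = Form (\<lambda>_. 0)"

definition one_form :: "'a form" where "one_form = Form (\<lambda>I. if I = {} then 1 else 0)"

definition plus_form :: "'a form \<Rightarrow> 'a form \<Rightarrow> 'a form" where
  "plus_form \<omega> \<eta> = Form (\<lambda>I. coef \<omega> I + coef \<eta> I)"

definition minus_form :: "'a form \<Rightarrow> 'a form \<Rightarrow> 'a form" where
  "minus_form \<omega> \<eta> = Form (\<lambda>I. coef \<omega> I - coef \<eta> I)"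

definition uminus_form :: "'a form \<Rightarrow> 'a form" where
  "uminus_form \<omega> = Form (\<lambda>I. - coef \<omega> I)"

definition times_form :: "'a form \<Rightarrow> 'a form \<Rightarrow> 'a form" where
  "times_form \<omega> \<eta> =
     Form (\<lambda>L. \<Sum>I\<in>Pow L. theta_sign I (L - I) * coef \<omega> I * coef \<eta> (L - I))"

instance
proof
  fix a b c :: "'a form"
  show "a + b + c = a + (b + c)" "a + b = b + a" "0 + a = a" "- a + a = 0" "a - b = a + - b"
    by (auto intro!: form_eqI
        simp: plus_form_def zero_form_def uminus_form_def minus_form_def)
  show "(a + b) * c = a * c + b * c" "a * (b + c) = a * b + a * c"
    by (auto intro!: form_eqI simp: plus_form_def times_form_def algebra_simps sum.distrib)
  show "(0::'a form) \<noteq> 1"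
  proof
    assume "(0::'a form) = 1"
    then have "coef (0::'a form) {} = coef 1 {}" by simp
    then show False by (simp add: zero_form_def one_form_def)
  qed
  show "1 * a = a"
  proof (rule form_eqI)
    fix L
    have "coef (1 * a) L = (\<Sum>I\<in>Pow L. if I = {} then coef a L else 0)"
      unfolding times_form_def one_form_def coef_Form by (rule sum.cong) auto
    then show "coef (1 * a) L = coef a L" by (simp add: sum.delta)
  qed
  show "a * 1 = a"
  proof (rule form_eqI)
    fix L
    have "coef (a * 1) L = (\<Sum>I\<in>Pow L. if I = L then coef a L else 0)"
      unfolding times_form_def one_form_def coef_Form by (rule sum.cong) auto
    then show "coef (a * 1) L = coef a L" by (simp add: sum.delta)
  qed
  show "a * b * c = a * (b * c)"
  proof (rule form_eqI)
    fix L
    let ?s = "theta_sign :: 'a set \<Rightarrow> 'a set \<Rightarrow> 'a mpol"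
    have "coef (a * b * c) L = (\<Sum>I\<in>Pow L. \<Sum>J\<in>Pow I.
        ?s I (L - I) * (?s J (I - J) * coef a J * coef b (I - J)) * coef c (L - I))"
      by (simp add: times_form_def sum_distrib_left sum_distrib_right)
    also have "\<dots> = (\<Sum>(I, J)\<in>Sigma (Pow L) Pow.
        ?s I (L - I) * (?s J (I - J) * coef a J * coef b (I - J)) * coef c (L - I))"
      by (subst sum.Sigma) auto
    also have "\<dots> = (\<Sum>(A, B)\<in>Sigma (Pow L) (\<lambda>A. Pow (L - A)).
        ?s A (L - A) * coef a A * (?s B (L - A - B) * coef b B * coef c (L - A - B)))"
    proof (rule sum.reindex_bij_witness[of _ "\<lambda>(A, B). (A \<union> B, A)" "\<lambda>(I, J). (J, I - J)"],
        goal_cases)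
      case (5 p)
      then obtain I J where p: "p = (I, J)" and J: "J \<subseteq> I" and I: "I \<subseteq> L" by auto
      have "?s I (L - I) = ?s J (L - I) * ?s (I - J) (L - I)"
        using J theta_sign_Un_left[of J "I - J" "L - I"] by (simp add: Un_absorb1)
      moreover have "?s J (L - J) = ?s J (I - J) * ?s J (L - I)"
      proof -
        have "L - J = (I - J) \<union> (L - I)" "(I - J) \<inter> (L - I) = {}" using J I by auto
        then show ?thesis by (simp add: theta_sign_Un_right)
      qed
      moreover have "L - J - (I - J) = L - I" using J by blast
      ultimately show ?case by (simp add: p algebra_simps)
    qed auto
    also have "\<dots> = (\<Sum>A\<in>Pow L. \<Sum>B\<in>Pow (L - A).
        ?s A (L - A) * coef a A * (?s B (L - A - B) * coef b B * coef c (L - A - B)))"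
      by (subst sum.Sigma) auto
    also have "\<dots> = coef (a * (b * c)) L"
      by (simp add: times_form_def sum_distrib_left)
    finally show "coef (a * b * c) L = coef (a * (b * c)) L" .
  qed
qed

end

definition K_forms :: "complex set \<Rightarrow> 'n form set" where
  "K_forms K = {\<omega>. \<forall>I. coef \<omega> I \<in> K_pols K}"

definition of_pol :: "'n mpol \<Rightarrow> 'n form" where
  "of_pol p = Form (\<lambda>I. if I = {} then p else 0)"

definition theta :: "'n set \<Rightarrow> 'n form" where
  "theta I = Form (\<lambda>J. if J = I then 1 else 0)"

definition fscale :: "complex \<Rightarrow> 'n form \<Rightarrow> 'n form" where
  "fscale c \<omega> = Form (\<lambda>I. pconst c * coef \<omega> I)"

definition bihom :: "nat \<Rightarrow> nat \<Rightarrow> 'n form \<Rightarrow> bool" where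
  "bihom a b \<omega> \<longleftrightarrow> (\<forall>I. \<forall>\<alpha>\<in>Poly_Mapping.keys (coef \<omega> I). mdeg \<alpha> = a \<and> card I = b)"

definition theta_hom :: "nat \<Rightarrow> 'n form \<Rightarrow> bool" where
  "theta_hom b \<omega> \<longleftrightarrow> (\<forall>I. coef \<omega> I \<noteq> 0 \<longrightarrow> card I = b)"

definition act :: "'n cmat \<Rightarrow> 'n form \<Rightarrow> ('n::{finite,linorder}) form" where
  "act \<sigma> \<omega> = (\<Sum>I\<in>UNIV.
     of_pol (psubst (\<lambda>j. \<Sum>i\<in>UNIV. pconst (cnj (\<sigma> $ i $ j)) * pvar i) (coef \<omega> I)) *
     prod_list (map (\<lambda>j. \<Sum>i\<in>UNIV. fscale (cnj (\<sigma> $ i $ j)) (theta {i})) (sorted_list_of_set I)))"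


section \<open>Differentiation by forms\<close>

definition dx :: "'n \<Rightarrow> 'n form \<Rightarrow> 'n form" where
  "dx i \<omega> = Form (\<lambda>I. pderiv_x i (coef \<omega> I))"

definition dtheta :: "'n::linorder \<Rightarrow> 'n form \<Rightarrow> 'n form" where
  "dtheta i \<omega> = Form (\<lambda>I. if i \<in> I then 0
     else (- 1) ^ card {j \<in> I. j < i} * coef \<omega> (insert i I))"

definition dx_mon :: "('n \<Rightarrow>\<^sub>0 nat) \<Rightarrow> 'n form \<Rightarrow> ('n::{finite,linorder}) form" where
  "dx_mon \<alpha> = foldr (\<lambda>i. dx i ^^ Poly_Mapping.lookup \<alpha> i) (sorted_list_of_set UNIV)"

text \<open>The operator \<open>\<partial>_{\<theta>_{i_k}} ... \<partial>_{\<theta>_{i_1}}\<close> for \<open>I = {i_1 < ... < i_k}\<close>.\<close>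

definition dtheta_mon :: "'n set \<Rightarrow> 'n form \<Rightarrow> ('n::{finite,linorder}) form" where
  "dtheta_mon I = foldr dtheta (rev (sorted_list_of_set I))"

definition dform :: "'n form \<Rightarrow> 'n form \<Rightarrow> ('n::{finite,linorder}) form" where
  "dform \<omega> \<eta> = (\<Sum>I\<in>UNIV. \<Sum>\<alpha>\<in>Poly_Mapping.keys (coef \<omega> I).
     fscale (cnj (Poly_Mapping.lookup (coef \<omega> I) \<alpha>)) (dx_mon \<alpha> (dtheta_mon I \<eta>)))"


section \<open>Super harmonics\<close>

definition two_sided_ideal :: "complex set \<Rightarrow> ('n::{finite,linorder}) form set \<Rightarrow> bool" where
  "two_sided_ideal K J \<longleftrightarrow> J \<subseteq> K_forms K \<and> 0 \<in> J \<and> (\<forall>a\<in>J. \<forall>b\<in>J. a + b \<in> J) \<and>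
     (\<forall>a\<in>J. \<forall>c\<in>K_forms K. c * a \<in> J \<and> a * c \<in> J)"

definition J_ideal :: "complex set \<Rightarrow> ('n cmat) set \<Rightarrow> ('n::{finite,linorder}) form set" where
  "J_ideal K G = two_sided_ideal K hull
     {\<omega> \<in> K_forms K. (\<exists>a b. bihom a b \<omega> \<and> a + b > 0) \<and> (\<forall>\<sigma>\<in>G. act \<sigma> \<omega> = \<omega>)}"

definition SH :: "complex set \<Rightarrow> ('n cmat) set \<Rightarrow> ('n::{finite,linorder}) form set" where
  "SH K G = {\<eta> \<in> K_forms K. \<forall>\<omega>\<in>J_ideal K G. dform \<omega> \<eta> = 0}"

definition SH_deg :: "complex set \<Rightarrow> ('n cmat) set \<Rightarrow> nat \<Rightarrow>
    ('n::{finite,linorder}) form set" where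
  "SH_deg K G k = {\<eta> \<in> SH K G. theta_hom k \<eta>}"

definition det_part :: "('n cmat) set \<Rightarrow> 'n form set \<Rightarrow>
    ('n::{finite,linorder}) form set" where
  "det_part G W = {\<eta> \<in> W. \<forall>\<sigma>\<in>G. act \<sigma> \<eta> = fscale (det \<sigma>) \<eta>}"

definition diff_span :: "complex set \<Rightarrow> 'n form set \<Rightarrow> ('n::{finite,linorder}) form set" where
  "diff_span K W = K_span K fscale {dform (of_pol g) \<eta> | g \<eta>. g \<in> K_pols K \<and> \<eta> \<in> W}"

definition vandermondian :: "complex set \<Rightarrow> ('n cmat) set \<Rightarrow>
    ('n::{finite,linorder}) form \<Rightarrow> bool" where
  "vandermondian K G \<Delta> \<longleftrightarrow> \<Delta> \<noteq> 0 \<and>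
     (\<exists>D. {\<eta> \<in> SH_deg K G 0. bihom D 0 \<eta>} = {fscale c \<Delta> | c. c \<in> K} \<and>
          (\<forall>D'>D. {\<eta> \<in> SH_deg K G 0. bihom D' 0 \<eta>} = {0}))"


section \<open>Generalized exterior derivatives\<close>

text \<open>Here and below \<open>f 1, ..., f n\<close> and \<open>d 1, ..., d n\<close> are indexed by natural numbers.\<close>

definition basic_invariants :: "complex set \<Rightarrow> ('n cmat) set \<Rightarrow>
    (nat \<Rightarrow> ('n::{finite,linorder}) mpol) \<Rightarrow> bool" where
  "basic_invariants K G f \<longleftrightarrow>
     (let P = {p \<in> K_pols K. \<forall>\<alpha>\<in>Poly_Mapping.keys p. Poly_Mapping.keys \<alpha> \<subseteq> {1..CARD('n)}} in
       (\<forall>i\<in>{1..CARD('n)}. \<exists>a. bihom a 0 (of_pol (f i))) \<and>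
       (\<forall>p\<in>P. psubst f p = 0 \<longrightarrow> p = 0) \<and>
       psubst f ` P = {g \<in> K_pols K. \<forall>\<sigma>\<in>G. act \<sigma> (of_pol g) = of_pol g})"

text \<open>\<open>symbol_op\<close> sends an element of the algebra \<open>K[\<partial>_x, \<theta>]\<close>, written as a form with \<open>x_i\<close> in
  place of \<open>\<partial>_{x_i}\<close>, to the operator it represents.\<close>

definition symbol_op :: "'n form \<Rightarrow> 'n form \<Rightarrow> ('n::{finite,linorder}) form" where
  "symbol_op \<omega> \<eta> = (\<Sum>I\<in>UNIV. \<Sum>\<alpha>\<in>Poly_Mapping.keys (coef \<omega> I).
     fscale (Poly_Mapping.lookup (coef \<omega> I) \<alpha>) (theta I * dx_mon \<alpha> \<eta>))"

definition equivariant_ops :: "complex set \<Rightarrow> ('n cmat) set \<Rightarrow>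
    ('n form \<Rightarrow> ('n::{finite,linorder}) form) set" where
  "equivariant_ops K G = {T \<in> symbol_op ` K_forms K.
     \<forall>\<sigma>\<in>G. \<forall>\<eta>\<in>K_forms K. T (act \<sigma> \<eta>) = act \<sigma> (T \<eta>)}"

text \<open>A bi-homogeneous operator in \<open>K[\<partial>_x, \<theta>]\<close> lowering the \<open>x\<close>-degree by \<open>a\<close> and raising the
  \<open>\<theta>\<close>-degree by \<open>b\<close>.\<close>

definition op_bihom :: "nat \<Rightarrow> nat \<Rightarrow> ('n form \<Rightarrow> ('n::{finite,linorder}) form) \<Rightarrow> bool" where
  "op_bihom a b T \<longleftrightarrow> (\<exists>\<omega>. bihom a b \<omega> \<and> T = symbol_op \<omega>)"

text \<open>The operator \<open>\<partial>_{f_1}^{\<alpha>_1} ... \<partial>_{f_n}^{\<alpha>_n} d_{i_1} ... d_{i_k}\<close> for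
  \<open>I = {i_1 < ... < i_k}\<close>.\<close>

definition basis_op :: "(nat \<Rightarrow> 'n mpol) \<Rightarrow> (nat \<Rightarrow> 'n form \<Rightarrow> 'n form) \<Rightarrow> (nat \<Rightarrow>\<^sub>0 nat) \<times> nat set \<Rightarrow>
    'n form \<Rightarrow> ('n::{finite,linorder}) form" where
  "basis_op f d = (\<lambda>(\<alpha>, I).
     foldr (\<lambda>i. dform (of_pol (f i)) ^^ Poly_Mapping.lookup \<alpha> i) [1..<CARD('n) + 1] \<circ>
     foldr d (sorted_list_of_set I))"

definition generalized_exterior_derivatives :: "complex set \<Rightarrow> ('n cmat) set \<Rightarrow>
    (nat \<Rightarrow> 'n mpol) \<Rightarrow> (nat \<Rightarrow> 'n form \<Rightarrow> ('n::{finite,linorder}) form) \<Rightarrow> bool" where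
  "generalized_exterior_derivatives K G f d \<longleftrightarrow>
     (\<forall>i\<in>{1..CARD('n)}. d i \<in> equivariant_ops K G \<and>
        (\<exists>a. op_bihom a 1 (d i) \<and> (a > 0 \<longleftrightarrow> i \<le> refl_rank K G))) \<and>
     K_basis K (\<lambda>c T \<eta>. fscale c (T \<eta>)) (basis_op f d)
       {(\<alpha>, I). Poly_Mapping.keys \<alpha> \<subseteq> {1..CARD('n)} \<and> I \<subseteq> {1..CARD('n)}}
       (equivariant_ops K G)"

end

theory Submission
  imports Defs
begin

text \<open>Differentiation is equivariant for unitary matrices: \<open>\<sigma> (\<partial>_\<omega> \<eta>) = \<partial>_{\<sigma> \<omega>} (\<sigma> \<eta>)\<close> (\<open>act_dform\<close>).  By this
  and an averaging argument, super harmonics are the forms that are annihilated by all invariant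
  bihomogeneous forms of positive degree (\<open>SH_deg_iff\<close>).  The rank is \<open>r\<close>; put \<open>v = d_1 \<cdots> d_r \<Delta>\<close>.  The
  theorem follows from three facts (\<open>generated\<close>).

  First, products \<open>d_{i_1} \<cdots> d_{i_r} \<Delta>\<close> with all indices at most \<open>r\<close> are super harmonic and transform
  by the character \<open>det\<close>.  For \<open>\<Delta>\<close> itself the character is found reflection by reflection (\<open>act_vandermondian_refl\<close>): if
  \<open>\<Delta> = \<partial>_L Q\<close> with \<open>L\<close> the linear form of the mirror of \<open>s\<close>, then \<open>Q - s Q\<close> is harmonic of a degree
  in which there are no harmonics.  The operators \<open>d_i\<close> preserve super harmonics because the graded
  commutator of \<open>d_i\<close> with differentiation by an invariant is again differentiation by an invariant, of
  positive degree since \<open>d_i\<close> lowers the \<open>x\<close>-degree (\<open>superharm_ext_op\<close>).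

  Second, \<open>v \<noteq> 0\<close>.  If \<open>g\<close> spans \<open>det\<^sup>-\<^sup>1\<close>, then \<open>\<theta>_1 \<cdots> \<theta>_n \<partial>_g\<close> is an equivariant operator, so it is a
  combination of operators \<open>\<partial>_f\<^sup>\<alpha> d_1 \<cdots> d_n\<close>; hence \<open>v = 0\<close> would imply \<open>\<partial>_g \<Delta> = 0\<close>
  (\<open>foldr_d_nonzero\<close>).  For a real group take \<open>g = \<Delta>\<close>, for \<open>G(m,1,n)\<close> with \<open>m \<ge> 2\<close> take
  \<open>g = \<Delta> / (x_1 \<cdots> x_n)\<^sup>m\<^sup>-\<^sup>2\<close>; in both cases \<open>\<partial>_g \<Delta> \<noteq> 0\<close> because the apolar pairing is positive definite.

  Third, every super harmonic form of \<open>\<theta>\<close>-degree \<open>r\<close> is a derivative of \<open>v\<close>.  For a real group, the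
  invariant form \<open>\<Sum>_k y_k dy_k\<close> in real coordinates forces the coefficients to be constant, and the
  super harmonics of \<open>\<theta>\<close>-degree \<open>r\<close> are a line (\<open>real_superharm_line\<close>).  For \<open>G(m,1,n)\<close> with \<open>m \<ge> 2\<close> one has
  \<open>r = n\<close>, the invariant form \<open>\<Sum>_j x_j\<^sup>m\<^sup>-\<^sup>1 dx_j\<close> forces all exponents to be at most \<open>m - 2\<close>, and \<open>v\<close> is a
  multiple of \<open>(x_1 \<cdots> x_n)\<^sup>m\<^sup>-\<^sup>2 \<theta>_1 \<cdots> \<theta>_n\<close> (\<open>monomial_case\<close>).  The group \<open>G(1,1,n)\<close> is real.\<close>

abbreviation lk :: "('a \<Rightarrow>\<^sub>0 'b::zero) \<Rightarrow> 'a \<Rightarrow> 'b" where "lk \<equiv> Poly_Mapping.lookup"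
abbreviation keys :: "('a \<Rightarrow>\<^sub>0 'b::zero) \<Rightarrow> 'a set" where "keys \<equiv> Poly_Mapping.keys"
abbreviation single :: "'a \<Rightarrow> 'b \<Rightarrow> 'a \<Rightarrow>\<^sub>0 'b::zero" where "single \<equiv> Poly_Mapping.single"

section \<open>Polynomials\<close>

lemma sum_keys_superset:
  assumes "finite A" "keys p \<subseteq> A" "\<And>\<alpha>. g \<alpha> 0 = 0"
  shows "(\<Sum>\<alpha>\<in>keys p. g \<alpha> (lk p \<alpha>)) = (\<Sum>\<alpha>\<in>A. g \<alpha> (lk p \<alpha>))"
  by (rule sum.mono_neutral_left) (use assms in \<open>auto simp: in_keys_iff\<close>)

lemma sum_keys_add:
  fixes p q :: "'a \<Rightarrow>\<^sub>0 'b::comm_monoid_add"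
  assumes "\<And>\<alpha>. g \<alpha> 0 = 0" "\<And>\<alpha> a b. g \<alpha> (a + b) = g \<alpha> a + g \<alpha> b"
  shows "(\<Sum>\<alpha>\<in>keys (p + q). g \<alpha> (lk (p + q) \<alpha>)) =
    (\<Sum>\<alpha>\<in>keys p. g \<alpha> (lk p \<alpha>)) + (\<Sum>\<alpha>\<in>keys q. g \<alpha> (lk q \<alpha>))"
proof -
  let ?A = "keys p \<union> keys q"
  have "(\<Sum>\<alpha>\<in>keys (p + q). g \<alpha> (lk (p + q) \<alpha>)) = (\<Sum>\<alpha>\<in>?A. g \<alpha> (lk (p + q) \<alpha>))"
    by (rule sum_keys_superset) (use assms keys_add[of p q] in auto)
  moreover have "(\<Sum>\<alpha>\<in>keys p. g \<alpha> (lk p \<alpha>)) = (\<Sum>\<alpha>\<in>?A. g \<alpha> (lk p \<alpha>))"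
    by (rule sum_keys_superset) (use assms in auto)
  moreover have "(\<Sum>\<alpha>\<in>keys q. g \<alpha> (lk q \<alpha>)) = (\<Sum>\<alpha>\<in>?A. g \<alpha> (lk q \<alpha>))"
    by (rule sum_keys_superset) (use assms in auto)
  ultimately show ?thesis by (simp add: lookup_add assms sum.distrib)
qed

lemma sum_keys_single:
  assumes "g \<alpha> 0 = 0"
  shows "(\<Sum>\<beta>\<in>keys (single \<alpha> c). g \<beta> (lk (single \<alpha> c) \<beta>)) = g \<alpha> c"
  using assms by simp

lemma poly_mapping_expand:
  fixes p :: "'a \<Rightarrow>\<^sub>0 'b::comm_monoid_add"
  shows "p = (\<Sum>\<alpha>\<in>keys p. single \<alpha> (lk p \<alpha>))"
  by (rule poly_mapping_eqI) (simp add: lookup_sum lookup_single when_def in_keys_iff)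

lemma mpol_single_induct [case_names single add]:
  fixes p :: "'a \<Rightarrow>\<^sub>0 'b::comm_monoid_add"
  assumes "\<And>\<alpha> c. P (single \<alpha> c)" "\<And>p q. P p \<Longrightarrow> P q \<Longrightarrow> P (p + q)"
  shows "P p"
proof -
  have "P (\<Sum>\<alpha>\<in>A. single \<alpha> (lk p \<alpha>))" if "finite A" for A
    using that by (induction A) (use assms(1)[of undefined 0] assms in auto)
  then show ?thesis by (metis finite_keys poly_mapping_expand)
qed

lemma pconst_simps [simp]: "pconst 0 = 0" "pconst 1 = 1"
  by (simp_all add: pconst_def)

lemma pconst_add: "pconst (a + b) = pconst a + pconst b"
  by (simp add: pconst_def single_add)

lemma pconst_mult: "pconst (a * b) = pconst a * pconst b"
  by (simp add: pconst_def mult_single)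

lemma pconst_uminus: "pconst (- a) = - pconst a"
  by (simp add: pconst_def single_uminus)

lemma pconst_mult_single: "pconst c * single \<alpha> a = single \<alpha> (c * a)"
  by (simp add: pconst_def mult_single)

lemma lookup_pconst_mult [simp]: "lk (pconst c * p) \<alpha> = c * lk p \<alpha>"
  by (induction p rule: mpol_single_induct)
    (auto simp: pconst_mult_single lookup_single when_def distrib_left lookup_add)

lemma pvar_mult_single: "pvar i * single \<alpha> a = single (single i 1 + \<alpha>) a"
  by (simp add: pvar_def mult_single)

lemma mdeg_eq: "mdeg (\<alpha> :: 'i::finite \<Rightarrow>\<^sub>0 nat) = (\<Sum>i\<in>UNIV. lk \<alpha> i)"
  unfolding mdeg_def by (rule sum.mono_neutral_left) (auto simp: in_keys_iff)

lemma mdeg_add: "mdeg (\<alpha> + \<beta> :: 'i::finite \<Rightarrow>\<^sub>0 nat) = mdeg \<alpha> + mdeg \<beta>"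
  by (simp add: mdeg_eq lookup_add sum.distrib)

lemma mdeg_single [simp]: "mdeg (single (i::'i::finite) k) = k"
  by (simp add: mdeg_def)

lemma mdeg_0 [simp]: "mdeg 0 = 0"
  by (simp add: mdeg_def)

lemma mdeg_eq_0: "mdeg (\<alpha> :: 'i::finite \<Rightarrow>\<^sub>0 nat) = 0 \<longleftrightarrow> \<alpha> = 0"
  by (auto simp: mdeg_eq intro: poly_mapping_eqI)

lemma exponent_split:
  assumes "lk (\<alpha> :: 'i \<Rightarrow>\<^sub>0 nat) i > 0"
  shows "\<alpha> = single i 1 + (\<alpha> - single i 1)"
  by (rule poly_mapping_eqI) (use assms in \<open>auto simp: lookup_add lookup_minus lookup_single when_def\<close>)

lemma exponent_induct [case_names zero step]:
  fixes \<alpha> :: "'i::finite \<Rightarrow>\<^sub>0 nat"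
  assumes "P 0" "\<And>i \<alpha>. P \<alpha> \<Longrightarrow> P (single i 1 + \<alpha>)"
  shows "P \<alpha>"
proof (induction "mdeg \<alpha>" arbitrary: \<alpha>)
  case 0
  then show ?case using assms(1) by (simp add: mdeg_eq_0)
next
  case (Suc n)
  then obtain i where i: "lk \<alpha> i > 0"
    by (metis gr0I mdeg_eq_0 nat.distinct(1) poly_mapping_eqI lookup_zero)
  have e: "\<alpha> = single i 1 + (\<alpha> - single i 1)" by (rule exponent_split[OF i])
  have "mdeg \<alpha> = 1 + mdeg (\<alpha> - single i 1)" using e mdeg_add mdeg_single by metis
  with Suc have "P (\<alpha> - single i 1)" by simp
  then show ?case using assms(2) e by metis
qed

lemma mpol_induct [case_names const add var]:
  fixes p :: "'i::finite mpol"
  assumes "\<And>c. P (pconst c)" "\<And>p q. P p \<Longrightarrow> P q \<Longrightarrow> P (p + q)" "\<And>i p. P p \<Longrightarrow> P (pvar i * p)"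
  shows "P p"
proof (induction p rule: mpol_single_induct)
  case (single \<alpha> c)
  show ?case
  proof (induction \<alpha> rule: exponent_induct)
    case zero
    then show ?case using assms(1)[of c] by (simp add: pconst_def)
  next
    case (step i \<alpha>)
    then show ?case using assms(3)[OF step, of i] by (simp add: pvar_mult_single)
  qed
qed (use assms in auto)

lemma pderiv_add: "pderiv_x i (p + q) = pderiv_x i p + pderiv_x i q"
  unfolding pderiv_x_def
  by (rule sum_keys_add[where g = "\<lambda>\<alpha> c. single (\<alpha> - single i 1) (of_nat (lk \<alpha> i) * c)"])
    (auto simp: single_add distrib_left)

lemma pderiv_single:
  "pderiv_x i (single \<alpha> c) = single (\<alpha> - single i 1) (of_nat (lk \<alpha> i) * c)"
  unfolding pderiv_x_def
  by (rule sum_keys_single[where g = "\<lambda>\<alpha> c. single (\<alpha> - single i 1) (of_nat (lk \<alpha> i) * c)"]) simp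

lemma lookup_pderiv: "lk (pderiv_x i p) \<beta> = of_nat (lk \<beta> i + 1) * lk p (\<beta> + single i 1)"
proof (induction p rule: mpol_single_induct)
  case (single \<alpha> c)
  show ?case
  proof (cases "lk \<alpha> i = 0")
    case True
    then have "\<alpha> \<noteq> \<beta> + single i 1" by (auto simp: lookup_add)
    then show ?thesis using True by (simp add: pderiv_single lookup_single)
  next
    case False
    then have "\<alpha> = single i 1 + (\<alpha> - single i 1)" by (intro exponent_split) simp
    then obtain \<gamma> where g: "\<alpha> = \<gamma> + single i 1" by (metis add.commute)
    show ?thesis by (auto simp: g pderiv_single lookup_single when_def lookup_add)
  qed
qed (simp_all add: pderiv_add lookup_add distrib_left)

lemma pderiv_pconst [simp]: "pderiv_x i (pconst c) = 0"
  by (simp add: pconst_def pderiv_single)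

lemma pderiv_0 [simp]: "pderiv_x i 0 = 0"
  using pderiv_pconst[of i 0] by simp

lemma pderiv_pconst_mult: "pderiv_x i (pconst c * p) = pconst c * pderiv_x i p"
  by (rule poly_mapping_eqI) (simp add: lookup_pderiv)

lemma pderiv_pvar_mult:
  "pderiv_x i (pvar j * p) = (if i = j then p else 0) + pvar j * pderiv_x i p"
proof (induction p rule: mpol_single_induct)
  case (single \<alpha> c)
  show ?case
  proof (cases "i = j")
    case True
    then have "pderiv_x i (pvar j * single \<alpha> c) = single \<alpha> (of_nat (Suc (lk \<alpha> i)) * c)"
      by (simp add: pvar_mult_single pderiv_single lookup_add)
    moreover have "pvar j * pderiv_x i (single \<alpha> c) = single \<alpha> (of_nat (lk \<alpha> i) * c)"
    proof (cases "lk \<alpha> i = 0")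
      case False
      then have "single i 1 + (\<alpha> - single i 1) = \<alpha>" using exponent_split[of \<alpha> i] by simp
      then show ?thesis using True by (simp add: pvar_mult_single pderiv_single)
    qed (simp add: pderiv_single)
    ultimately show ?thesis using True by (simp add: single_add[symmetric] algebra_simps)
  next
    case False
    have "single j 1 + \<alpha> - single i 1 = single j 1 + (\<alpha> - single i 1)" if "lk \<alpha> i \<noteq> 0"
      by (rule poly_mapping_eqI)
        (use that False in \<open>auto simp: lookup_add lookup_minus lookup_single when_def\<close>)
    then show ?thesis using False
      by (cases "lk \<alpha> i = 0") (auto simp: pvar_mult_single pderiv_single lookup_add lookup_single when_def)
  qed
qed (simp_all add: pderiv_add distrib_left)

lemma psubst_add: "psubst h (p + q) = psubst h p + psubst h q"
  unfolding psubst_def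
  by (rule sum_keys_add[where g = "\<lambda>\<alpha> c. pconst c * (\<Prod>i\<in>keys \<alpha>. h i ^ lk \<alpha> i)"])
    (auto simp: pconst_add distrib_right)

lemma psubst_single:
  "psubst h (single \<alpha> c) = pconst c * (\<Prod>i\<in>UNIV. h (i::'i::finite) ^ lk \<alpha> i)"
proof -
  have "psubst h (single \<alpha> c) = pconst c * (\<Prod>i\<in>keys \<alpha>. h i ^ lk \<alpha> i)"
    unfolding psubst_def
    by (rule sum_keys_single[where g = "\<lambda>\<alpha> c. pconst c * (\<Prod>i\<in>keys \<alpha>. h i ^ lk \<alpha> i)"]) simp
  also have "(\<Prod>i\<in>keys \<alpha>. h i ^ lk \<alpha> i) = (\<Prod>i\<in>UNIV. h i ^ lk \<alpha> i)"
    by (rule prod.mono_neutral_left) (auto simp: in_keys_iff)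
  finally show ?thesis .
qed

lemma psubst_pconst [simp]: "psubst h (pconst c) = pconst c"
  by (simp add: pconst_def psubst_def)

lemma psubst_0 [simp]: "psubst h 0 = 0"
  by (simp add: psubst_def)

lemma psubst_pvar_mult: "psubst h (pvar i * p) = h (i::'i::finite) * psubst h p"
proof (induction p rule: mpol_single_induct)
  case (single \<alpha> c)
  have "(\<Prod>j\<in>UNIV. h j ^ lk (single i 1 + \<alpha>) j) =
      (\<Prod>j\<in>UNIV. (if j = i then h i else 1) * h j ^ lk \<alpha> j)"
    by (rule prod.cong) (auto simp: lookup_add lookup_single)
  also have "\<dots> = h i * (\<Prod>j\<in>UNIV. h j ^ lk \<alpha> j)"
    by (simp add: prod.distrib prod.delta)
  finally show ?case by (simp add: pvar_mult_single psubst_single)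
qed (simp_all add: psubst_add distrib_left)

lemma psubst_pconst_mult: "psubst h (pconst c * p) = pconst c * psubst h (p::'i::finite mpol)"
  by (induction p rule: mpol_single_induct)
    (simp_all add: pconst_mult_single psubst_single pconst_mult psubst_add distrib_left)


section \<open>The algebra of forms\<close>

lemma coef_add [simp]: "coef (\<omega> + \<eta>) I = coef \<omega> I + coef \<eta> I"
  and coef_diff [simp]: "coef (\<omega> - \<eta>) I = coef \<omega> I - coef \<eta> I"
  and coef_uminus [simp]: "coef (- \<omega>) I = - coef \<omega> I"
  and coef_0 [simp]: "coef (0::'n::{finite,linorder} form) I = 0"
  by (simp_all add: plus_form_def minus_form_def uminus_form_def zero_form_def)

lemma coef_1: "coef (1::'n::{finite,linorder} form) I = (if I = {} then 1 else 0)"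
  by (simp add: one_form_def)

lemma coef_sum [simp]: "coef (sum f A) I = (\<Sum>a\<in>A. coef (f a :: 'n::{finite,linorder} form) I)"
  by (induction A rule: infinite_finite_induct) auto

lemma coef_fscale [simp]: "coef (fscale c \<omega>) I = pconst c * coef \<omega> I"
  by (simp add: fscale_def)

lemma coef_of_pol: "coef (of_pol p) I = (if I = {} then p else 0)"
  by (simp add: of_pol_def)

lemma coef_theta: "coef (theta J) I = (if I = J then 1 else 0)"
  by (simp add: theta_def)

lemma coef_of_pol_mult [simp]: "coef (of_pol p * \<omega>) L = p * coef (\<omega> :: 'n::{finite,linorder} form) L"
proof -
  have "coef (of_pol p * \<omega>) L = (\<Sum>I\<in>Pow L. if I = {} then p * coef \<omega> L else 0)"
    unfolding times_form_def coef_Form by (rule sum.cong) (auto simp: coef_of_pol)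
  then show ?thesis by (simp add: sum.delta)
qed

lemma coef_mult_of_pol: "coef (\<omega> * of_pol p) L = p * coef (\<omega> :: 'n::{finite,linorder} form) L"
proof -
  have "coef (\<omega> * of_pol p) L = (\<Sum>I\<in>Pow L. if I = L then p * coef \<omega> L else 0)"
    unfolding times_form_def coef_Form
    by (rule sum.cong) (auto simp: coef_of_pol mult.commute)
  then show ?thesis by (simp add: sum.delta)
qed

lemma of_pol_central: "\<omega> * of_pol p = of_pol p * (\<omega> :: 'n::{finite,linorder} form)"
  by (rule form_eqI) (simp add: coef_mult_of_pol)

lemma of_pol_left_commute: "\<eta> * (of_pol p * \<omega>) = of_pol p * (\<eta> * (\<omega> :: 'n::{finite,linorder} form))"
  by (metis mult.assoc of_pol_central)

lemma of_pol_simps [simp]: "of_pol 0 = (0 :: 'n::{finite,linorder} form)"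
    "of_pol 1 = (1 :: 'n::{finite,linorder} form)"
  by (auto intro!: form_eqI simp: coef_of_pol coef_1)

lemma of_pol_add: "of_pol (p + q) = of_pol p + (of_pol q :: 'n::{finite,linorder} form)"
  and of_pol_diff: "of_pol (p - q) = of_pol p - (of_pol q :: 'n::{finite,linorder} form)"
  and of_pol_uminus: "of_pol (- p) = - (of_pol p :: 'n::{finite,linorder} form)"
  and of_pol_mult: "of_pol (p * q) = of_pol p * (of_pol q :: 'n::{finite,linorder} form)"
  by (auto intro!: form_eqI simp: coef_of_pol)

lemma of_pol_sum: "of_pol (sum f A) = (\<Sum>a\<in>A. (of_pol (f a) :: 'n::{finite,linorder} form))"
  by (induction A rule: infinite_finite_induct) (auto simp: of_pol_add)

lemma of_pol_inject: "of_pol p = of_pol q \<longleftrightarrow> p = q"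
  by (metis coef_of_pol)

lemma fscale_eq: "fscale c \<omega> = of_pol (pconst c) * (\<omega> :: 'n::{finite,linorder} form)"
  by (rule form_eqI) simp

lemma fscale_simps [simp]: "fscale 0 \<omega> = (0 :: 'n::{finite,linorder} form)"
    "fscale 1 \<omega> = (\<omega> :: 'n::{finite,linorder} form)" "fscale c 0 = (0 :: 'n::{finite,linorder} form)"
  by (simp_all add: fscale_eq)

lemma fscale_fscale [simp]: "fscale a (fscale b \<omega>) = fscale (a * b) (\<omega> :: 'n::{finite,linorder} form)"
  by (simp add: fscale_eq pconst_mult of_pol_mult mult.assoc)

lemma fscale_add: "fscale a (\<omega> + \<eta>) = fscale a \<omega> + fscale a (\<eta> :: 'n::{finite,linorder} form)"
  and fscale_diff: "fscale a (\<omega> - \<eta>) = fscale a \<omega> - fscale a (\<eta> :: 'n::{finite,linorder} form)"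
  and fscale_uminus: "fscale a (- \<omega>) = - fscale a (\<omega> :: 'n::{finite,linorder} form)"
  and fscale_add_left: "fscale (a + b) \<omega> = fscale a \<omega> + fscale b (\<omega> :: 'n::{finite,linorder} form)"
  and fscale_uminus_left: "fscale (- a) \<omega> = - fscale a (\<omega> :: 'n::{finite,linorder} form)"
  by (simp_all add: fscale_eq distrib_left distrib_right pconst_add of_pol_add right_diff_distrib
      pconst_uminus of_pol_uminus)

lemma fscale_sum: "fscale a (sum f A) = (\<Sum>x\<in>A. fscale a (f x :: 'n::{finite,linorder} form))"
  by (simp add: fscale_eq sum_distrib_left)

lemma fscale_sum_left: "fscale (sum f A) \<omega> = (\<Sum>x\<in>A. fscale (f x) (\<omega> :: 'n::{finite,linorder} form))"
  by (induction A rule: infinite_finite_induct) (auto simp: fscale_add_left)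

lemma mult_fscale_left: "fscale a \<omega> * \<eta> = fscale a (\<omega> * (\<eta> :: 'n::{finite,linorder} form))"
  and mult_fscale_right: "\<omega> * fscale a \<eta> = fscale a (\<omega> * (\<eta> :: 'n::{finite,linorder} form))"
  by (simp_all add: fscale_eq mult.assoc of_pol_left_commute)

lemma fscale_minus_1: "fscale (- 1) \<omega> = - (\<omega> :: 'n::{finite,linorder} form)"
  by (simp add: fscale_uminus_left)

lemma fscale_cancel:
  assumes "fscale c \<omega> = 0" "c \<noteq> 0"
  shows "\<omega> = (0 :: 'n::{finite,linorder} form)"
proof -
  have "fscale (inverse c) (fscale c \<omega>) = \<omega>" using assms(2) by simp
  then show ?thesis using assms(1) by simp
qed

abbreviation X :: "'n \<Rightarrow> 'n form" where "X i \<equiv> of_pol (pvar i)"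
abbreviation Th :: "'n \<Rightarrow> 'n form" where "Th i \<equiv> theta {i}"

lemma coef_Th_mult: "coef (Th i * \<omega>) L =
    (if i \<in> L then (- 1) ^ card {j \<in> L. j < i} * coef (\<omega> :: 'n::{finite,linorder} form) (L - {i}) else 0)"
proof -
  have "coef (Th i * \<omega>) L = (\<Sum>I\<in>Pow L. if I = {i} then theta_sign {i} (L - {i}) * coef \<omega> (L - {i}) else 0)"
    unfolding times_form_def coef_Form by (rule sum.cong) (auto simp: coef_theta)
  moreover have e: "{(x, y). x \<in> {i} \<and> y \<in> L - {i} \<and> y < x} = Pair i ` {j \<in> L. j < i}" by auto
  have "theta_sign {i} (L - {i}) = ((- 1) ^ card {j \<in> L. j < i} :: 'n mpol)"
    unfolding theta_sign_def e by (subst card_image) (auto simp: inj_on_def)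
  ultimately show ?thesis by (simp add: sum.delta)
qed

lemma card_remove_less:
  "card {k \<in> L - {j}. k < i} + (if j \<in> L \<and> j < i then 1 else 0) = card {k \<in> L. k < (i :: 'n::{finite,linorder})}"
proof (cases "j \<in> L \<and> j < i")
  case True
  then have "{k \<in> L. k < i} = insert j {k \<in> L - {j}. k < i}" by auto
  then show ?thesis using True by simp
next
  case False
  then have "{k \<in> L - {j}. k < i} = {k \<in> L. k < i}" by auto
  with False show ?thesis by auto
qed

lemma sign_remove_less:
  assumes "j \<in> L"
  shows "(- 1 :: 'a::comm_ring_1) ^ card {k \<in> L - {j}. k < i} =
    (if j < i then - 1 else 1) * (- 1) ^ card {k \<in> L. k < (i :: 'n::{finite,linorder})}"
proof (cases "j < i")
  case True
  then have "card {k \<in> L. k < i} = Suc (card {k \<in> L - {j}. k < i})"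
    using card_remove_less[of L j i] assms by simp
  then have "(- 1 :: 'a) ^ card {k \<in> L. k < i} = - 1 * (- 1) ^ card {k \<in> L - {j}. k < i}"
    by (simp only: power_Suc)
  then show ?thesis using True by simp
next
  case False
  then have "{k \<in> L - {j}. k < i} = {k \<in> L. k < i}" by auto
  then show ?thesis using False by simp
qed

lemma Th_anticommute: "Th i * (Th j * \<omega>) = - (Th j * (Th i * (\<omega> :: 'n::{finite,linorder} form)))"
proof (rule form_eqI)
  fix L
  show "coef (Th i * (Th j * \<omega>)) L = coef (- (Th j * (Th i * \<omega>))) L"
  proof (cases "i = j")
    case True
    then show ?thesis by (simp add: coef_Th_mult)
  next
    case False
    have e: "L - {j} - {i} = L - {i} - {j}" by auto
    show ?thesis
    proof (cases "i \<in> L \<and> j \<in> L")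
      case True
      then have "i \<in> L - {j}" "j \<in> L - {i}" using False by auto
      then show ?thesis using True False
        by (cases "i < j") (simp_all add: coef_Th_mult e sign_remove_less[of j L i] sign_remove_less[of i L j] del: Diff_iff)
    qed (auto simp: coef_Th_mult)
  qed
qed

lemma theta_empty [simp]: "theta {} = (1 :: 'n::{finite,linorder} form)"
  by (rule form_eqI) (simp add: coef_1 coef_theta)

lemma Th_mult_theta:
  "i \<notin> I \<Longrightarrow> Th i * theta I = (of_pol ((- 1) ^ card {j \<in> I. j < i}) * theta (insert i I) :: 'n::{finite,linorder} form)"
proof (rule form_eqI, goal_cases)
  case (1 L)
  then have "{j. (j = i \<or> j \<in> I) \<and> j < i} = {j \<in> I. j < i}" by auto
  then show ?case using 1 by (auto simp: coef_Th_mult coef_theta)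
qed

lemma form_expand: "\<omega> = (\<Sum>I\<in>UNIV. of_pol (coef \<omega> I) * theta I :: 'n::{finite,linorder} form)"
  by (rule form_eqI) (simp add: coef_theta if_distrib[of "\<lambda>x. _ * x"] sum.delta cong: if_cong)

lemma sorted_list_of_set_insert_min:
  assumes "finite I" "\<And>j. j \<in> I \<Longrightarrow> i < j"
  shows "sorted_list_of_set (insert i I) = i # sorted_list_of_set I"
proof -
  have "i \<notin> I" using assms by auto
  then have "sorted_list_of_set (insert i I) = insort i (sorted_list_of_set I)" using assms by simp
  then show ?thesis using assms by (simp add: insort_is_Cons less_imp_le)
qed

lemma theta_eq_prod_list:
  "theta I = prod_list (map Th (sorted_list_of_set (I :: 'n::{finite,linorder} set)))"
proof -
  have "finite I" by simp
  then show ?thesis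
  proof (induction rule: finite_linorder_min_induct)
    case (insert b A)
    have e: "{j \<in> A. j < b} = {}" "b \<notin> A" using insert.hyps by (auto dest: less_not_sym)
    have "Th b * theta A = theta (insert b A)"
      using Th_mult_theta[OF e(2)] unfolding e(1) by simp
    then show ?case using insert by (simp add: sorted_list_of_set_insert_min del: sorted_list_of_set_insert_remove)
  qed simp
qed

text \<open>Operators are compared on forms by this induction: it suffices to know how they pass the generators
  \<open>x_i\<close> and \<open>\<theta>_i\<close> of the algebra.\<close>

lemma form_induct [case_names const add X Th]:
  fixes \<omega> :: "'n::{finite,linorder} form"
  assumes c: "\<And>c. P (fscale c 1)" and a: "\<And>\<omega> \<eta>. P \<omega> \<Longrightarrow> P \<eta> \<Longrightarrow> P (\<omega> + \<eta>)"
    and X: "\<And>i \<omega>. P \<omega> \<Longrightarrow> P (X i * \<omega>)" and T: "\<And>i \<omega>. P \<omega> \<Longrightarrow> P (Th i * \<omega>)"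
  shows "P \<omega>"
proof -
  have 1: "P (fscale c (prod_list (map Th xs)))" for c and xs :: "'n list"
  proof (induction xs)
    case (Cons i xs)
    then show ?case using T[OF Cons, of i] by (simp add: mult_fscale_right)
  qed (use c in simp)
  have 2: "P (of_pol p * theta I)" for p and I :: "'n set"
  proof (induction p rule: mpol_induct)
    case (const c)
    then show ?case using 1[of c "sorted_list_of_set I"] by (simp add: theta_eq_prod_list[of I] fscale_eq)
  next
    case (add p q)
    then show ?case using a by (simp add: of_pol_add distrib_right)
  next
    case (var i p)
    then show ?case using X[of "of_pol p * theta I" i] by (simp add: of_pol_mult mult.assoc)
  qed
  have "P (\<Sum>I\<in>A. of_pol (coef \<omega> I) * theta I)" if "finite A" for A
    using that by (induction A) (use c[of 0] 2 a in auto)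
  then show ?thesis using form_expand[of \<omega>] by (metis finite)
qed


section \<open>Derivations and their commutation relations\<close>

lemma coef_dx [simp]: "coef (dx i \<omega>) I = pderiv_x i (coef \<omega> I)"
  by (simp add: dx_def)

lemma coef_dtheta: "coef (dtheta i \<omega>) I = (if i \<in> I then 0 else
    (- 1) ^ card {j \<in> I. j < i} * coef \<omega> (insert i I))"
  by (simp add: dtheta_def)

lemma dx_add: "dx i (\<omega> + \<eta>) = dx i \<omega> + dx i (\<eta> :: 'n::{finite,linorder} form)"
  and dx_fscale: "dx i (fscale c \<omega>) = fscale c (dx i (\<omega> :: 'n::{finite,linorder} form))"
  and dx_X: "dx i (X j * \<omega>) = (if i = j then \<omega> else 0) + X j * dx i (\<omega> :: 'n::{finite,linorder} form)"
  and dx_1 [simp]: "dx i 1 = (0 :: 'n::{finite,linorder} form)"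
  by (auto intro!: form_eqI simp: pderiv_add pderiv_pconst_mult pderiv_pvar_mult coef_1
      simp flip: pconst_simps(2))

lemma dx_0 [simp]: "dx i 0 = (0 :: 'n::{finite,linorder} form)"
  using dx_fscale[of i 0 0] by simp

lemma dx_sum: "dx i (sum f A) = (\<Sum>a\<in>A. dx i (f a :: 'n::{finite,linorder} form))"
  by (induction A rule: infinite_finite_induct) (auto simp: dx_add)

lemma dx_Th: "dx i (Th j * \<omega>) = Th j * dx i (\<omega> :: 'n::{finite,linorder} form)"
proof -
  have "((- 1) ^ k :: 'n mpol) = pconst ((- 1) ^ k)" for k
    by (cases "even k") (auto simp: pconst_uminus)
  then show ?thesis by (intro form_eqI) (auto simp: coef_Th_mult pderiv_pconst_mult)
qed

lemma dtheta_add: "dtheta i (\<omega> + \<eta>) = dtheta i \<omega> + dtheta i (\<eta> :: 'n::{finite,linorder} form)"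
  and dtheta_fscale: "dtheta i (fscale c \<omega>) = fscale c (dtheta i (\<omega> :: 'n::{finite,linorder} form))"
  and dtheta_1 [simp]: "dtheta i 1 = (0 :: 'n::{finite,linorder} form)"
  by (auto intro!: form_eqI simp: coef_dtheta distrib_left coef_1 mult.left_commute)

lemma dtheta_of_pol: "dtheta i (of_pol p * \<omega>) = of_pol p * dtheta i (\<omega> :: 'n::{finite,linorder} form)"
  by (auto intro!: form_eqI simp: coef_dtheta mult.left_commute)

lemma dtheta_0 [simp]: "dtheta i 0 = (0 :: 'n::{finite,linorder} form)"
  using dtheta_fscale[of i 0 0] by simp

lemma dtheta_sum: "dtheta i (sum f A) = (\<Sum>a\<in>A. dtheta i (f a :: 'n::{finite,linorder} form))"
  by (induction A rule: infinite_finite_induct) (auto simp: dtheta_add)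

lemma dtheta_Th: "dtheta i (Th j * \<omega>) = (if i = j then \<omega> else 0) - Th j * dtheta i (\<omega> :: 'n::{finite,linorder} form)"
proof (rule form_eqI)
  fix L
  consider "i = j" "i \<in> L" | "i = j" "i \<notin> L" | "i \<noteq> j" "i \<in> L" | "i \<noteq> j" "i \<notin> L" "j \<notin> L"
    | "i \<noteq> j" "i \<notin> L" "j \<in> L" by blast
  then show "coef (dtheta i (Th j * \<omega>)) L = coef ((if i = j then \<omega> else 0) - Th j * dtheta i \<omega>) L"
  proof cases
    case 1
    then have "insert j (L - {j}) = L" "{k \<in> L - {j}. k < j} = {k \<in> L. k < j}" "j \<notin> L - {j}" by auto
    then show ?thesis using 1
      by (simp add: coef_dtheta coef_Th_mult del: insert_Diff_single Diff_iff)
  next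
    case 2
    have "{k \<in> insert j L. k < j} = {k \<in> L. k < j}" "insert j L - {j} = L" "j \<in> insert j L"
      using 2 by auto
    then show ?thesis using 2 by (simp add: coef_dtheta coef_Th_mult del: insert_iff)
  next
    case 5
    have e: "insert i (L - {j}) = insert i L - {j}" using 5 by auto
    have s1: "{k \<in> insert i L. k < j} = (if i < j then insert i {k \<in> L. k < j} else {k \<in> L. k < j})"
      by auto
    have s: "(- 1 :: 'n mpol) ^ card {k \<in> insert i L. k < j} = (if i < j then - 1 else 1) * (- 1) ^ card {k \<in> L. k < j}"
      unfolding s1 using 5 by simp
    have t: "(- 1 :: 'n mpol) ^ card {k \<in> L - {j}. k < i} = (if j < i then - 1 else 1) * (- 1) ^ card {k \<in> L. k < i}"
      by (rule sign_remove_less) (use 5 in simp)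
    show ?thesis using 5 s t
      by (cases "i < j") (simp_all add: coef_dtheta coef_Th_mult e mult.left_commute
          del: insert_iff Diff_iff, auto simp: coef_dtheta)
  qed (auto simp: coef_dtheta coef_Th_mult)
qed

text \<open>By induction on forms, the commutation relations among the derivations follow from their relations
  with the generators.\<close>

lemma dx_commute: "dx i (dx j \<omega>) = dx j (dx i (\<omega> :: 'n::{finite,linorder} form))"
  by (induction \<omega> rule: form_induct) (simp_all add: dx_add dx_fscale dx_X dx_Th)

lemma dx_dtheta: "dx i (dtheta j \<omega>) = dtheta j (dx i (\<omega> :: 'n::{finite,linorder} form))"
  by (induction \<omega> rule: form_induct)
    (simp_all add: dx_add dx_fscale dx_X dx_Th dtheta_add dtheta_fscale dtheta_of_pol dtheta_Th
      diff_conv_add_uminus dx_fscale[of _ "-1", unfolded fscale_minus_1] del: add_uminus_conv_diff)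

lemma dtheta_uminus: "dtheta i (- \<omega>) = - dtheta i (\<omega> :: 'n::{finite,linorder} form)"
  using dtheta_fscale[of i "- 1" \<omega>] by (simp add: fscale_minus_1)

lemma dtheta_diff: "dtheta i (\<omega> - \<eta>) = dtheta i \<omega> - dtheta i (\<eta> :: 'n::{finite,linorder} form)"
  using dtheta_add[of i \<omega> "- \<eta>"] by (simp add: dtheta_uminus)

lemma dtheta_anticommute: "dtheta i (dtheta j \<omega>) = - dtheta j (dtheta i (\<omega> :: 'n::{finite,linorder} form))"
  by (induction \<omega> rule: form_induct)
    (simp_all add: dtheta_add dtheta_fscale dtheta_of_pol dtheta_Th dtheta_diff)

lemma dtheta_dtheta [simp]: "dtheta i (dtheta i \<omega>) = (0 :: 'n::{finite,linorder} form)"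
  by (rule form_eqI) (simp add: coef_dtheta)


section \<open>Differentiation by a form\<close>

lemma dx_pow_commute: "dx j ((dx i ^^ k) \<omega>) = (dx i ^^ k) (dx j (\<omega> :: 'n::{finite,linorder} form))"
  by (induction k) (simp_all add: dx_commute[of j i])

lemma foldr_dx_commute:
  "dx j (foldr (\<lambda>i. dx i ^^ m i) xs \<omega>) = foldr (\<lambda>i. dx i ^^ m i) xs (dx j (\<omega> :: 'n::{finite,linorder} form))"
  by (induction xs) (simp_all add: dx_pow_commute)

lemma foldr_dx_add:
  assumes "distinct xs"
  shows "foldr (\<lambda>i. dx i ^^ (if i = j then Suc (m i) else m i)) xs \<omega> =
    (if j \<in> set xs then foldr (\<lambda>i. dx i ^^ m i) xs (dx j (\<omega> :: 'n::{finite,linorder} form))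
     else foldr (\<lambda>i. dx i ^^ m i) xs \<omega>)"
  using assms by (induction xs) (auto simp: foldr_dx_commute dx_pow_commute)

lemma dx_mon_0 [simp]: "dx_mon 0 = (\<lambda>\<omega> :: 'n::{finite,linorder} form. \<omega>)"
proof -
  have "foldr (\<lambda>i. dx i ^^ lk 0 i) xs = (\<lambda>\<omega> :: 'n form. \<omega>)" for xs
    by (induction xs) (auto simp: fun_eq_iff)
  then show ?thesis by (simp add: dx_mon_def)
qed

lemma dx_mon_step: "dx_mon (single j 1 + \<alpha>) \<omega> = dx_mon \<alpha> (dx j (\<omega> :: 'n::{finite,linorder} form))"
proof -
  have "(\<lambda>i. dx i ^^ lk (single j 1 + \<alpha>) i) =
      (\<lambda>i. dx i ^^ (if i = j then Suc (lk \<alpha> i) else lk \<alpha> i) :: 'n form \<Rightarrow> 'n form)"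
    by (auto simp: lookup_add lookup_single)
  then show ?thesis using foldr_dx_add[of "sorted_list_of_set UNIV" j "lk \<alpha>" \<omega>]
    by (simp add: dx_mon_def)
qed

lemma dtheta_mon_empty [simp]: "dtheta_mon {} \<omega> = (\<omega> :: 'n::{finite,linorder} form)"
  by (simp add: dtheta_mon_def)

lemma foldr_dtheta_insort:
  assumes "sorted xs" "i \<notin> set xs"
  shows "foldr dtheta (rev (insort i xs)) \<omega> =
    fscale ((- 1) ^ length (filter (\<lambda>j. j < i) xs)) (foldr dtheta (rev xs) (dtheta i (\<omega> :: 'n::{finite,linorder} form)))"
  using assms
proof (induction xs arbitrary: \<omega>)
  case (Cons x xs)
  have lin: "foldr dtheta ys (- \<omega>) = - foldr dtheta ys \<omega>" for ys and \<omega> :: "'n form"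
    by (induction ys) (simp_all add: dtheta_uminus)
  show ?case
  proof (cases "i \<le> x")
    case True
    have "\<And>j. j \<in> set xs \<Longrightarrow> \<not> j < i" using Cons.prems True by auto
    then have "filter (\<lambda>j. j < i) (x # xs) = []" using True by (auto simp: filter_empty_conv)
    then show ?thesis using True by simp
  next
    case False
    then have "\<not> i \<le> x" "x < i" by simp_all
    note n = this
    show ?thesis using Cons by (simp add: n dtheta_anticommute[of i x] lin fscale_uminus fscale_uminus_left)
  qed
qed simp

lemma length_filter_less:
  fixes I :: "'n::{finite,linorder} set"
  shows "length (filter (\<lambda>j. j < i) (sorted_list_of_set I)) = card {j \<in> I. j < i}"
proof -
  have "length (filter (\<lambda>j. j < i) (sorted_list_of_set I)) = card (set (filter (\<lambda>j. j < i) (sorted_list_of_set I)))"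
    by (rule distinct_card[symmetric]) simp
  also have "set (filter (\<lambda>j. j < i) (sorted_list_of_set I)) = {j \<in> I. j < i}" by auto
  finally show ?thesis .
qed

lemma dtheta_mon_insert:
  assumes "i \<notin> I"
  shows "dtheta_mon (insert i I) \<omega> =
    fscale ((- 1) ^ card {j \<in> I. j < i}) (dtheta_mon I (dtheta i (\<omega> :: 'n::{finite,linorder} form)))"
proof -
  show ?thesis using foldr_dtheta_insort[of "sorted_list_of_set I" i \<omega>] assms
    by (simp add: dtheta_mon_def length_filter_less)
qed

lemma dtheta_mon_dtheta_in: "i \<in> I \<Longrightarrow> dtheta_mon I (dtheta i \<omega>) = (0 :: 'n::{finite,linorder} form)"
proof -
  assume "i \<in> I"
  then have "dtheta_mon I (dtheta i \<omega>) = dtheta_mon (insert i (I - {i})) (dtheta i \<omega>)"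
    by (simp add: insert_absorb)
  also have "\<dots> = fscale ((- 1) ^ card {j \<in> I - {i}. j < i}) (dtheta_mon (I - {i}) 0)"
    by (subst dtheta_mon_insert) auto
  also have "dtheta_mon (I - {i}) 0 = 0"
  proof -
    have "foldr dtheta xs 0 = (0 :: 'n form)" for xs by (induction xs) auto
    then show ?thesis by (simp add: dtheta_mon_def)
  qed
  finally show ?thesis by simp
qed

lemma dx_mon_fscale: "dx_mon \<alpha> (fscale c \<omega>) = fscale c (dx_mon \<alpha> (\<omega> :: 'n::{finite,linorder} form))"
  by (induction \<alpha> arbitrary: \<omega> rule: exponent_induct) (simp_all add: dx_mon_step[simplified] dx_fscale)

lemma dtheta_mon_fscale: "dtheta_mon I (fscale c \<omega>) = fscale c (dtheta_mon I (\<omega> :: 'n::{finite,linorder} form))"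
proof -
  have "foldr dtheta xs (fscale c \<omega>) = fscale c (foldr dtheta xs \<omega>)" for xs
    by (induction xs) (simp_all add: dtheta_fscale)
  then show ?thesis by (simp add: dtheta_mon_def)
qed

lemma dform_add_left: "dform (\<omega> + \<omega>') \<eta> = dform \<omega> \<eta> + dform \<omega>' (\<eta> :: 'n::{finite,linorder} form)"
proof -
  have "(\<Sum>\<alpha>\<in>keys (coef (\<omega> + \<omega>') I). fscale (cnj (lk (coef (\<omega> + \<omega>') I) \<alpha>)) (dx_mon \<alpha> (dtheta_mon I \<eta>))) =
    (\<Sum>\<alpha>\<in>keys (coef \<omega> I). fscale (cnj (lk (coef \<omega> I) \<alpha>)) (dx_mon \<alpha> (dtheta_mon I \<eta>))) +
    (\<Sum>\<alpha>\<in>keys (coef \<omega>' I). fscale (cnj (lk (coef \<omega>' I) \<alpha>)) (dx_mon \<alpha> (dtheta_mon I \<eta>)))" for I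
    unfolding coef_add
    by (rule sum_keys_add[where g = "\<lambda>\<alpha> c. fscale (cnj c) (dx_mon \<alpha> (dtheta_mon I \<eta>))"])
      (auto simp: fscale_add_left)
  then show ?thesis unfolding dform_def by (simp only: sum.distrib)
qed

lemma dform_monomial:
  "dform (of_pol (single \<alpha> c) * theta I) \<eta> = fscale (cnj c) (dx_mon \<alpha> (dtheta_mon I (\<eta> :: 'n::{finite,linorder} form)))"
proof -
  have e: "coef (of_pol (single \<alpha> c) * theta I :: 'n form) J = (if J = I then single \<alpha> c else 0)" for J
    by (auto simp: coef_theta)
  have "dform (of_pol (single \<alpha> c) * theta I) \<eta> =
      (\<Sum>J\<in>UNIV. if J = I then fscale (cnj c) (dx_mon \<alpha> (dtheta_mon I \<eta>)) else 0)"
    unfolding dform_def e by (rule sum.cong) (auto simp: sum_keys_single[where g = "\<lambda>\<alpha> c. fscale (cnj c) (dx_mon \<alpha> (dtheta_mon I \<eta>))"])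
  then show ?thesis by (simp add: sum.delta)
qed

lemma form_monomial_induct [case_names monomial add]:
  fixes \<omega> :: "'n::{finite,linorder} form"
  assumes m: "\<And>\<alpha> c I. P (of_pol (single \<alpha> c) * theta I)" and a: "\<And>\<omega> \<eta>. P \<omega> \<Longrightarrow> P \<eta> \<Longrightarrow> P (\<omega> + \<eta>)"
  shows "P \<omega>"
proof -
  have 2: "P (of_pol p * theta I)" for p and I :: "'n set"
    by (induction p rule: mpol_single_induct) (use m a in \<open>auto simp: of_pol_add distrib_right\<close>)
  have "P (\<Sum>I\<in>A. of_pol (coef \<omega> I) * theta I)" if "finite A" for A
    using that by (induction A) (use 2 m[of undefined 0 undefined] a in auto)
  then show ?thesis using form_expand[of \<omega>] by (metis finite)
qed

lemma dform_fscale_left: "dform (fscale c \<omega>) \<eta> = fscale (cnj c) (dform \<omega> (\<eta> :: 'n::{finite,linorder} form))"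
proof (induction \<omega> rule: form_monomial_induct)
  case (monomial \<alpha> a I)
  have "fscale c (of_pol (single \<alpha> a) * theta I) = (of_pol (single \<alpha> (c * a)) * theta I :: 'n form)"
    by (simp add: fscale_eq pconst_mult_single flip: of_pol_mult mult.assoc)
  then show ?case by (simp add: dform_monomial)
qed (simp add: dform_add_left fscale_add)

lemma dform_1 [simp]: "dform 1 \<eta> = (\<eta> :: 'n::{finite,linorder} form)"
  using dform_monomial[of 0 1 "{}" \<eta>] by simp

lemma dform_0_left [simp]: "dform 0 \<eta> = (0 :: 'n::{finite,linorder} form)"
  using dform_fscale_left[of 0 0 \<eta>] by simp

lemma dform_uminus_left: "dform (- \<omega>) \<eta> = - dform \<omega> (\<eta> :: 'n::{finite,linorder} form)"
  using dform_fscale_left[of "- 1" \<omega> \<eta>] by (simp add: fscale_minus_1)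

lemma dform_diff_left: "dform (\<omega> - \<omega>') \<eta> = dform \<omega> \<eta> - dform \<omega>' (\<eta> :: 'n::{finite,linorder} form)"
  using dform_add_left[of \<omega> "- \<omega>'" \<eta>] by (simp add: dform_uminus_left)

lemma dform_sum_left: "dform (sum f A) \<eta> = (\<Sum>a\<in>A. dform (f a) (\<eta> :: 'n::{finite,linorder} form))"
  by (induction A rule: infinite_finite_induct) (auto simp: dform_add_left)

lemma dform_X: "dform (X i * \<omega>) \<eta> = dform \<omega> (dx i (\<eta> :: 'n::{finite,linorder} form))"
proof (induction \<omega> rule: form_monomial_induct)
  case (monomial \<alpha> c I)
  have c: "dtheta_mon I (dx i \<eta>) = dx i (dtheta_mon I \<eta>)"
  proof -
    have "foldr dtheta xs (dx i \<eta>) = dx i (foldr dtheta xs \<eta>)" for xs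
      by (induction xs) (simp_all add: dx_dtheta)
    then show ?thesis by (simp add: dtheta_mon_def)
  qed
  have "X i * (of_pol (single \<alpha> c) * theta I) = (of_pol (single (single i 1 + \<alpha>) c) * theta I :: 'n form)"
    by (simp add: pvar_mult_single flip: of_pol_mult mult.assoc)
  then show ?case by (simp only: dform_monomial dx_mon_step c)
qed (simp add: dform_add_left distrib_left)

lemma dform_Th: "dform (Th i * \<omega>) \<eta> = dform \<omega> (dtheta i (\<eta> :: 'n::{finite,linorder} form))"
proof (induction \<omega> rule: form_monomial_induct)
  case (monomial \<alpha> c I)
  show ?case
  proof (cases "i \<in> I")
    case True
    have "Th i * theta I = (0 :: 'n form)"
      by (rule form_eqI) (use True in \<open>auto simp: coef_Th_mult coef_theta\<close>)
    then have "Th i * (of_pol (single \<alpha> c) * theta I) = (0 :: 'n form)"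
      by (simp add: of_pol_left_commute)
    moreover have "dx_mon \<alpha> 0 = (0 :: 'n form)" using dx_mon_fscale[of \<alpha> 0 0] by simp
    ultimately show ?thesis using True by (simp add: dform_monomial dtheta_mon_dtheta_in)
  next
    case False
    let ?s = "(- 1) ^ card {j \<in> I. j < i}"
    have p: "of_pol ((- 1) ^ k) * \<omega> = fscale ((- 1) ^ k) \<omega>" for k and \<omega> :: "'n form"
      by (cases "even k") (auto simp: of_pol_uminus fscale_minus_1)
    have "Th i * (of_pol (single \<alpha> c) * theta I) = (fscale ?s (of_pol (single \<alpha> c) * theta (insert i I)) :: 'n form)"
      using False by (simp add: of_pol_left_commute Th_mult_theta p mult_fscale_right)
    then have "dform (Th i * (of_pol (single \<alpha> c) * theta I)) \<eta> =
        fscale ?s (fscale (cnj c) (dx_mon \<alpha> (dtheta_mon (insert i I) \<eta>)))"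
      by (simp add: dform_fscale_left dform_monomial)
    also have "\<dots> = fscale (cnj c) (dx_mon \<alpha> (dtheta_mon I (dtheta i \<eta>)))"
      using False by (simp add: dtheta_mon_insert dx_mon_fscale mult.left_commute[of _ "cnj c"] mult.commute[of _ "cnj c"])
    finally show ?thesis by (simp add: dform_monomial)
  qed
qed (simp add: dform_add_left distrib_left)

lemma dform_add_right: "dform \<omega> (\<eta> + \<eta>') = dform \<omega> \<eta> + dform \<omega> (\<eta>' :: 'n::{finite,linorder} form)"
  by (induction \<omega> arbitrary: \<eta> \<eta>' rule: form_induct)
    (simp_all add: dform_fscale_left dform_add_left dform_X dform_Th dx_add dtheta_add fscale_add)

lemma dform_fscale_right: "dform \<omega> (fscale c \<eta>) = fscale c (dform \<omega> (\<eta> :: 'n::{finite,linorder} form))"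
  by (induction \<omega> arbitrary: \<eta> rule: form_induct)
    (simp_all add: dform_fscale_left dform_add_left dform_X dform_Th dx_fscale dtheta_fscale fscale_add mult.commute)

lemma dform_0_right [simp]: "dform \<omega> 0 = (0 :: 'n::{finite,linorder} form)"
  using dform_fscale_right[of \<omega> 0 0] by simp

lemma dform_uminus_right: "dform \<omega> (- \<eta>) = - dform \<omega> (\<eta> :: 'n::{finite,linorder} form)"
  using dform_fscale_right[of \<omega> "- 1" \<eta>] by (simp add: fscale_minus_1)

lemma dform_diff_right: "dform \<omega> (\<eta> - \<eta>') = dform \<omega> \<eta> - dform \<omega> (\<eta>' :: 'n::{finite,linorder} form)"
  using dform_add_right[of \<omega> \<eta> "- \<eta>'"] by (simp add: dform_uminus_right)

lemma dform_sum_right: "dform \<omega> (sum f A) = (\<Sum>a\<in>A. dform \<omega> (f a :: 'n::{finite,linorder} form))"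
  by (induction A rule: infinite_finite_induct) (auto simp: dform_add_right)

text \<open>Differentiation turns products into compositions in reverse order, because
  \<open>\<partial>_{\<theta>_{i_k}} \<dots> \<partial>_{\<theta>_{i_1}}\<close> is attached to \<open>\<theta>_{i_1} \<dots> \<theta>_{i_k}\<close>.\<close>

lemma dform_mult: "dform (\<omega> * \<omega>') \<eta> = dform \<omega>' (dform \<omega> (\<eta> :: 'n::{finite,linorder} form))"
  by (induction \<omega> arbitrary: \<eta> rule: form_induct)
    (simp_all add: mult_fscale_left dform_fscale_left dform_fscale_right dform_add_left dform_add_right
      dform_X dform_Th distrib_right mult.assoc)

lemma dform_of_pol_commute: "dform (of_pol p) (dform \<omega> \<eta>) = dform \<omega> (dform (of_pol p) (\<eta> :: 'n::{finite,linorder} form))"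
  by (simp flip: dform_mult add: of_pol_central)

lemma dform_of_pol_Th: "dform (of_pol p) (Th i * \<eta>) = Th i * dform (of_pol p) (\<eta> :: 'n::{finite,linorder} form)"
proof (induction p arbitrary: \<eta> rule: mpol_induct)
  case (const c)
  then show ?case by (simp add: dform_fscale_left mult_fscale_right flip: fscale_eq[of c 1, simplified])
qed (simp_all add: of_pol_add of_pol_mult dform_add_left distrib_left dform_X dx_Th)

text \<open>The main involution of the exterior algebra, which keeps track of signs without a homogeneity
  assumption.\<close>

definition grade_inv :: "'n::{finite,linorder} form \<Rightarrow> 'n form" where
  "grade_inv \<omega> = Form (\<lambda>I. (- 1) ^ card I * coef \<omega> I)"

lemma coef_grade_inv [simp]: "coef (grade_inv \<omega>) I = (- 1) ^ card I * coef \<omega> I"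
  by (simp add: grade_inv_def)

lemma grade_inv_simps:
  fixes \<omega> \<eta> :: "'n::{finite,linorder} form"
  shows "grade_inv (\<omega> + \<eta>) = grade_inv \<omega> + grade_inv \<eta>"
  "grade_inv (fscale c (1 :: 'n form)) = fscale c 1"
  "grade_inv (of_pol p * \<omega>) = of_pol p * grade_inv \<omega>"
  "grade_inv (Th i * \<omega>) = - (Th i * grade_inv \<omega>)"
proof -
  show "grade_inv (Th i * \<omega>) = - (Th i * grade_inv \<omega>)"
  proof (rule form_eqI)
    fix L
    have "card L = Suc (card (L - {i}))" if "i \<in> L" by (rule card.remove) (use that in auto)
    then have "(- 1 :: 'n mpol) ^ card L = - ((- 1) ^ card (L - {i}))" if "i \<in> L"
      using that by (metis power_Suc mult_minus1)
    then show "coef (grade_inv (Th i * \<omega>)) L = coef (- (Th i * grade_inv \<omega>)) L"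
      by (auto simp: coef_Th_mult mult.left_commute simp del: card_Diff_insert)
  qed
qed (auto intro!: form_eqI simp: distrib_left mult.left_commute coef_1)

text \<open>By induction on \<open>\<omega>\<close>, the graded commutator of \<open>\<partial>_\<omega>\<close> with multiplication by \<open>\<theta>_j\<close> is again a
  differentiation; its form is the contraction of \<open>\<omega>\<close>.\<close>

lemma dform_Th_mult:
  "dform \<omega> (Th j * \<eta>) = Th j * dform (grade_inv \<omega>) \<eta> + dform (dtheta j \<omega>) (\<eta> :: 'n::{finite,linorder} form)"
proof (induction \<omega> arbitrary: \<eta> rule: form_induct)
  case (Th i \<omega>)
  show ?case
    by (simp add: dform_Th dtheta_Th grade_inv_simps dform_diff_right Th dform_diff_left dform_uminus_left)
qed (simp_all add: dform_fscale_left mult_fscale_right grade_inv_simps dtheta_fscale dform_add_left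
    distrib_left dtheta_add dtheta_of_pol dform_X dx_Th)

section \<open>Operators with constant coefficients\<close>

text \<open>Differentiation by a form conjugates the coefficients of the form, whereas the operator with a given
  symbol does not; \<open>pcnj\<close> translates between the two conventions.\<close>

definition pcnj :: "'i mpol \<Rightarrow> 'i mpol" where
  "pcnj p = (\<Sum>\<alpha>\<in>keys p. single \<alpha> (cnj (lk p \<alpha>)))"

lemma pcnj_add: "pcnj (p + q) = pcnj p + pcnj q"
  unfolding pcnj_def by (rule sum_keys_add[where g = "\<lambda>\<alpha> c. single \<alpha> (cnj c)"]) (auto simp: single_add)

lemma pcnj_single: "pcnj (single \<alpha> c) = single \<alpha> (cnj c)"
  unfolding pcnj_def by (rule sum_keys_single[where g = "\<lambda>\<alpha> c. single \<alpha> (cnj c)"]) simp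

lemma lookup_pcnj [simp]: "lk (pcnj p) \<alpha> = cnj (lk p \<alpha>)"
  by (induction p rule: mpol_single_induct) (auto simp: pcnj_add pcnj_single lookup_single when_def lookup_add)

lemma keys_pcnj [simp]: "keys (pcnj p) = keys p"
  by (auto simp: in_keys_iff)

lemma pcnj_0 [simp]: "pcnj 0 = 0"
  by (simp add: pcnj_def)

lemma pcnj_pcnj [simp]: "pcnj (pcnj p) = p"
  by (rule poly_mapping_eqI) simp

lemma dform_of_pol: "dform (of_pol p) \<eta> = (\<Sum>\<alpha>\<in>keys p. fscale (cnj (lk p \<alpha>)) (dx_mon \<alpha> (\<eta> :: 'n::{finite,linorder} form)))"
proof (induction p rule: mpol_single_induct)
  case (single \<alpha> c)
  then show ?case using dform_monomial[of \<alpha> c "{}" \<eta>]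
    by (auto simp: sum_keys_single[where g = "\<lambda>\<alpha> c. fscale (cnj c) (dx_mon \<alpha> \<eta>)"])
next
  case (add p q)
  then show ?case
    by (subst sum_keys_add[where g = "\<lambda>\<alpha> c. fscale (cnj c) (dx_mon \<alpha> \<eta>)"])
      (auto simp: fscale_add_left of_pol_add dform_add_left)
qed

lemma symbol_op_eq: "symbol_op \<omega> \<eta> = (\<Sum>I\<in>UNIV. theta I * dform (of_pol (pcnj (coef \<omega> I))) (\<eta> :: 'n::{finite,linorder} form))"
  unfolding symbol_op_def dform_of_pol by (simp add: sum_distrib_left mult_fscale_right)


section \<open>The action of matrices on forms\<close>

definition Xc :: "('n \<Rightarrow> complex) \<Rightarrow> 'n::{finite,linorder} form" where
  "Xc c = (\<Sum>i\<in>UNIV. fscale (c i) (X i))"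

definition Thc :: "('n \<Rightarrow> complex) \<Rightarrow> 'n::{finite,linorder} form" where
  "Thc c = (\<Sum>i\<in>UNIV. fscale (c i) (Th i))"

lemma Xc_mult: "Xc c * \<omega> = (\<Sum>i\<in>UNIV. fscale (c i) (X i * \<omega>))"
  and Thc_mult: "Thc c * \<omega> = (\<Sum>i\<in>UNIV. fscale (c i) (Th i * \<omega>))"
  by (simp_all add: Xc_def Thc_def sum_distrib_right mult_fscale_left)

lemma Xc_of_pol: "Xc c = of_pol (\<Sum>i\<in>UNIV. pconst (c i) * pvar i)"
  by (simp add: Xc_def of_pol_sum of_pol_mult fscale_eq)

lemma eq_neg_self_imp_0: "\<omega> = - \<omega> \<Longrightarrow> \<omega> = (0 :: 'n::{finite,linorder} form)"
proof -
  assume "\<omega> = - \<omega>"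
  then have "\<omega> + \<omega> = 0" by (metis add.right_inverse)
  then have "fscale 2 \<omega> = 0" using fscale_add_left[of 1 1 \<omega>] by simp
  then show ?thesis by (rule fscale_cancel) simp
qed

lemma Thc_anticommute: "Thc c * (Thc d * \<omega>) = - (Thc d * (Thc c * \<omega>))"
proof -
  have e: "Thc c * (Thc d * \<omega>) = (\<Sum>i\<in>UNIV. \<Sum>j\<in>UNIV. fscale (c i * d j) (Th i * (Th j * \<omega>)))" for c d
    by (subst sum.swap) (simp add: Thc_mult sum_distrib_left mult_fscale_right fscale_sum mult.commute)
  have "Thc c * (Thc d * \<omega>) = (\<Sum>i\<in>UNIV. \<Sum>j\<in>UNIV. - fscale (d j * c i) (Th j * (Th i * \<omega>)))"
    unfolding e by (subst Th_anticommute) (simp add: fscale_uminus mult.commute)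
  also have "\<dots> = - (\<Sum>j\<in>UNIV. \<Sum>i\<in>UNIV. fscale (d j * c i) (Th j * (Th i * \<omega>)))"
    by (subst sum.swap) (simp add: sum_negf)
  finally show ?thesis by (simp only: e)
qed

lemma Thc_square [simp]: "Thc c * (Thc c * \<omega>) = 0"
  by (rule eq_neg_self_imp_0) (rule Thc_anticommute)

lemma dx_Xc: "dx i (Xc c * \<omega>) = fscale (c i) \<omega> + Xc c * dx i \<omega>"
proof -
  have "dx i (Xc c * \<omega>) = (\<Sum>j\<in>UNIV. (if j = i then fscale (c i) \<omega> else 0) + fscale (c j) (X j * dx i \<omega>))"
    unfolding Xc_mult dx_sum by (rule sum.cong) (auto simp: dx_fscale dx_X fscale_add)
  then show ?thesis by (simp add: sum.distrib sum.delta Xc_mult)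
qed

lemma dx_Thc: "dx i (Thc c * \<omega>) = Thc c * dx i \<omega>"
  by (simp add: Thc_mult dx_sum dx_fscale dx_Th)

lemma dtheta_Xc: "dtheta i (Xc c * \<omega>) = Xc c * dtheta i \<omega>"
  by (simp add: Xc_of_pol dtheta_of_pol)

lemma dtheta_Thc: "dtheta i (Thc c * \<omega>) = fscale (c i) \<omega> - Thc c * dtheta i \<omega>"
proof -
  have "dtheta i (Thc c * \<omega>) = (\<Sum>j\<in>UNIV. (if j = i then fscale (c i) \<omega> else 0) - fscale (c j) (Th j * dtheta i \<omega>))"
    unfolding Thc_mult dtheta_sum by (rule sum.cong) (auto simp: dtheta_fscale dtheta_Th fscale_diff fscale_uminus)
  then show ?thesis by (simp add: sum_subtractf sum.delta Thc_mult)
qed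

lemma dform_Xc: "dform (Xc c * \<omega>) \<eta> = dform \<omega> (\<Sum>i\<in>UNIV. fscale (cnj (c i)) (dx i \<eta>))"
  and dform_Thc: "dform (Thc c * \<omega>) \<eta> = dform \<omega> (\<Sum>i\<in>UNIV. fscale (cnj (c i)) (dtheta i \<eta>))"
  by (simp_all add: Xc_mult Thc_mult dform_sum_left dform_sum_right dform_fscale_left dform_fscale_right
      dform_X dform_Th)

abbreviation act_var :: "'n::finite cmat \<Rightarrow> 'n \<Rightarrow> 'n mpol" where
  "act_var \<sigma> j \<equiv> \<Sum>i\<in>UNIV. pconst (cnj (\<sigma> $ i $ j)) * pvar i"

abbreviation act_Th :: "'n cmat \<Rightarrow> 'n \<Rightarrow> 'n::{finite,linorder} form" where
  "act_Th \<sigma> j \<equiv> Thc (\<lambda>i. cnj (\<sigma> $ i $ j))"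

lemma psubst_mult: "psubst h (p * q) = psubst h p * psubst h (q :: 'i::finite mpol)"
  by (induction p rule: mpol_induct)
    (simp_all add: psubst_pconst_mult distrib_right psubst_add psubst_pvar_mult mult.assoc)

lemma psubst_1 [simp]: "psubst h 1 = 1"
  using psubst_pconst[of h 1] by simp

lemma act_def': "act \<sigma> \<omega> = (\<Sum>I\<in>UNIV. of_pol (psubst (act_var \<sigma>) (coef \<omega> I)) *
    prod_list (map (act_Th \<sigma>) (sorted_list_of_set I)))"
  by (simp add: act_def Thc_def)

lemma act_add: "act \<sigma> (\<omega> + \<eta>) = act \<sigma> \<omega> + act \<sigma> \<eta>"
  by (simp add: act_def' psubst_add of_pol_add distrib_right sum.distrib)

lemma act_of_pol_mult: "act \<sigma> (of_pol p * \<omega>) = of_pol (psubst (act_var \<sigma>) p) * act \<sigma> \<omega>"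
  by (simp add: act_def' psubst_mult of_pol_mult sum_distrib_left mult.assoc)

lemma act_fscale: "act \<sigma> (fscale c \<omega>) = fscale c (act \<sigma> \<omega>)"
  by (simp add: fscale_eq act_of_pol_mult)

lemma act_theta: "act \<sigma> (theta I) = prod_list (map (act_Th \<sigma>) (sorted_list_of_set I))"
proof -
  have "act \<sigma> (theta I) = (\<Sum>J\<in>UNIV. if J = I then prod_list (map (act_Th \<sigma>) (sorted_list_of_set I)) else 0)"
    unfolding act_def' by (rule sum.cong) (auto simp: coef_theta)
  then show ?thesis by (simp add: sum.delta)
qed

lemma act_1 [simp]: "act \<sigma> 1 = 1"
  using act_theta[of \<sigma> "{}"] by simp

lemma act_0 [simp]: "act \<sigma> 0 = 0"
  using act_fscale[of \<sigma> 0 0] by simp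

lemma act_of_pol: "act \<sigma> (of_pol p) = of_pol (psubst (act_var \<sigma>) p)"
  using act_of_pol_mult[of \<sigma> p 1] by simp

lemma act_uminus: "act \<sigma> (- \<omega>) = - act \<sigma> \<omega>"
  using act_fscale[of \<sigma> "- 1" \<omega>] by (simp add: fscale_minus_1)

lemma act_diff: "act \<sigma> (\<omega> - \<eta>) = act \<sigma> \<omega> - act \<sigma> \<eta>"
  using act_add[of \<sigma> \<omega> "- \<eta>"] by (simp add: act_uminus)

lemma act_sum: "act \<sigma> (sum f A) = (\<Sum>a\<in>A. act \<sigma> (f a))"
  by (induction A rule: infinite_finite_induct) (auto simp: act_add)

lemma Thc_mult_insort:
  assumes "sorted xs"
  shows "Thc (t i) * prod_list (map (\<lambda>j. Thc (t j)) xs) =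
    fscale ((- 1) ^ length (filter (\<lambda>j. j < i) xs)) (prod_list (map (\<lambda>j. Thc (t j)) (insort i xs)))"
  using assms
proof (induction xs)
  case (Cons x xs)
  show ?case
  proof (cases "i \<le> x")
    case True
    have "\<And>j. j \<in> set xs \<Longrightarrow> \<not> j < i" using Cons.prems True by auto
    then have "filter (\<lambda>j. j < i) (x # xs) = []" using True by (auto simp: filter_empty_conv)
    then show ?thesis using True by simp
  next
    case False
    then have "\<not> i \<le> x" "x < i" by simp_all
    note n = this
    show ?thesis using Cons
      by (simp add: n Thc_anticommute[of "t i" "t x"] mult_fscale_right fscale_uminus_left)
  qed
qed simp

lemma Thc_mult_member:
  "i \<in> set xs \<Longrightarrow> Thc (t i) * prod_list (map (\<lambda>j. Thc (t j)) xs) = 0"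
  by (induction xs) (auto simp: Thc_anticommute[of "t i"])

lemma neg_one_power_of_pol: "of_pol ((- 1) ^ k) * \<omega> = fscale ((- 1) ^ k) (\<omega> :: 'n::{finite,linorder} form)"
  by (cases "even k") (auto simp: of_pol_uminus fscale_minus_1)

lemma act_Th_mult: "act \<sigma> (Th i * \<omega>) = act_Th \<sigma> i * act \<sigma> \<omega>"
proof (induction \<omega> rule: form_monomial_induct)
  case (monomial \<alpha> c I)
  have "act \<sigma> (Th i * theta I) = act_Th \<sigma> i * act \<sigma> (theta I)"
  proof (cases "i \<in> I")
    case True
    have "Th i * theta I = (0 :: 'a form)"
      by (rule form_eqI) (use True in \<open>auto simp: coef_Th_mult coef_theta\<close>)
    moreover have "act_Th \<sigma> i * act \<sigma> (theta I) = 0"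
      unfolding act_theta by (rule Thc_mult_member) (use True in simp)
    ultimately show ?thesis by simp
  next
    case False
    let ?k = "card {j \<in> I. j < i}"
    have "act_Th \<sigma> i * act \<sigma> (theta I) = fscale ((- 1) ^ ?k) (act \<sigma> (theta (insert i I)))"
      unfolding act_theta
      using Thc_mult_insort[of "sorted_list_of_set I" "\<lambda>j i. cnj (\<sigma> $ i $ j)" i] False
      by (simp add: length_filter_less)
    then show ?thesis using False by (simp add: Th_mult_theta neg_one_power_of_pol act_fscale)
  qed
  then show ?case by (simp add: act_of_pol_mult of_pol_left_commute)
qed (simp add: act_add distrib_left)

lemma psubst_pvar [simp]: "psubst h (pvar i) = h (i::'i::finite)"
  using psubst_pvar_mult[of h i 1] psubst_pconst[of h 1] by simp

lemma act_X_mult: "act \<sigma> (X i * \<omega>) = Xc (\<lambda>k. cnj (\<sigma> $ k $ i)) * act \<sigma> \<omega>"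
  by (simp add: act_of_pol_mult Xc_of_pol)

lemma act_Th_single: "act \<sigma> (Th i) = act_Th \<sigma> i"
  using act_Th_mult[of \<sigma> i 1] by simp

lemma act_X_single: "act \<sigma> (X i) = Xc (\<lambda>k. cnj (\<sigma> $ k $ i))"
  using act_X_mult[of \<sigma> i 1] by simp

lemma act_mult: "act \<sigma> (\<omega> * \<eta>) = act \<sigma> \<omega> * act \<sigma> \<eta>"
  by (induction \<omega> rule: form_induct)
    (simp_all add: mult_fscale_left act_fscale act_add distrib_right act_X_mult act_Th_mult mult.assoc)

lemma act_Xc: "act \<sigma> (Xc c) = Xc (\<lambda>k. \<Sum>i\<in>UNIV. cnj (\<sigma> $ k $ i) * c i)"
proof -
  have "act \<sigma> (Xc c) = (\<Sum>i\<in>UNIV. \<Sum>k\<in>UNIV. fscale (c i * cnj (\<sigma> $ k $ i)) (X k))"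
    using act_X_mult[of \<sigma> _ 1] by (simp add: Xc_def[of c] act_sum act_fscale) (simp add: Xc_def fscale_sum)
  also have "\<dots> = Xc (\<lambda>k. \<Sum>i\<in>UNIV. cnj (\<sigma> $ k $ i) * c i)"
    by (subst sum.swap) (simp add: Xc_def fscale_sum_left mult.commute)
  finally show ?thesis .
qed

lemma act_Thc: "act \<sigma> (Thc c) = Thc (\<lambda>k. \<Sum>i\<in>UNIV. cnj (\<sigma> $ k $ i) * c i)"
proof -
  have "act \<sigma> (Thc c) = (\<Sum>i\<in>UNIV. \<Sum>k\<in>UNIV. fscale (c i * cnj (\<sigma> $ k $ i)) (Th k))"
    by (simp add: Thc_def[of c] act_sum act_fscale act_Th_single) (simp add: Thc_def fscale_sum)
  also have "\<dots> = Thc (\<lambda>k. \<Sum>i\<in>UNIV. cnj (\<sigma> $ k $ i) * c i)"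
    by (subst sum.swap) (simp add: Thc_def fscale_sum_left mult.commute)
  finally show ?thesis .
qed

lemma act_compose: "act (A ** B) \<omega> = act A (act B \<omega>)"
  by (induction \<omega> rule: form_induct)
    (simp_all add: act_fscale act_add act_X_single act_Th_single act_mult act_Xc act_Thc
      matrix_matrix_mult_def)

lemma Xc_unit: "Xc (\<lambda>k. if k = i then 1 else 0) = X i"
  and Thc_unit: "Thc (\<lambda>k. if k = i then 1 else 0) = Th i"
  by (simp_all add: Xc_def Thc_def if_distrib[of "\<lambda>c. fscale c _"] sum.delta cong: if_cong)

lemma act_id: "act (mat 1) \<omega> = \<omega>"
  by (induction \<omega> rule: form_induct)
    (simp_all add: act_fscale act_add act_X_mult act_Th_mult mat_def if_distrib[of cnj] Xc_unit Thc_unit cong: if_cong)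

lemma unitary_columns:
  assumes "unitary \<sigma>"
  shows "(\<Sum>i\<in>UNIV. \<sigma> $ i $ j * cnj (\<sigma> $ i $ k)) = (if j = k then 1 else 0)"
proof -
  have "(adj \<sigma> ** \<sigma>) $ k $ j = (mat 1 :: _ cmat) $ k $ j" using assms by (simp add: unitary_def)
  then show ?thesis by (auto simp: matrix_matrix_mult_def adj_def mat_def mult.commute)
qed

lemma unitary_rows:
  assumes "unitary \<sigma>"
  shows "(\<Sum>i\<in>UNIV. \<sigma> $ j $ i * cnj (\<sigma> $ k $ i)) = (if j = k then 1 else 0)"
proof -
  have "(\<sigma> ** adj \<sigma>) $ j $ k = (mat 1 :: _ cmat) $ j $ k" using assms by (simp add: unitary_def)
  then show ?thesis by (auto simp: matrix_matrix_mult_def adj_def mat_def)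
qed

lemma act_dx:
  assumes "unitary \<sigma>"
  shows "act \<sigma> (dx j \<eta>) = (\<Sum>i\<in>UNIV. fscale (\<sigma> $ i $ j) (dx i (act \<sigma> \<eta>)))"
proof (induction \<eta> rule: form_induct)
  case (X k \<eta>)
  let ?c = "\<lambda>i. cnj (\<sigma> $ i $ k)"
  have "(\<Sum>i\<in>UNIV. fscale (\<sigma> $ i $ j) (dx i (act \<sigma> (X k * \<eta>)))) =
      (\<Sum>i\<in>UNIV. fscale (\<sigma> $ i $ j * ?c i) (act \<sigma> \<eta>)) +
      Xc ?c * (\<Sum>i\<in>UNIV. fscale (\<sigma> $ i $ j) (dx i (act \<sigma> \<eta>)))"
    by (simp add: act_X_mult dx_Xc fscale_add sum.distrib sum_distrib_left mult_fscale_right)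
  also have "(\<Sum>i\<in>UNIV. fscale (\<sigma> $ i $ j * ?c i) (act \<sigma> \<eta>)) = (if j = k then act \<sigma> \<eta> else 0)"
    unfolding fscale_sum_left[symmetric] unitary_columns[OF assms] by simp
  finally show ?case by (simp add: dx_X act_add X[symmetric] act_X_mult if_distrib[of "act \<sigma>"])
next
  case (Th k \<eta>)
  show ?case by (simp add: dx_Th act_Th_mult Th dx_Thc sum_distrib_left mult_fscale_right)
qed (simp_all add: dx_fscale act_fscale act_add dx_add fscale_add sum.distrib)

lemma act_dtheta:
  assumes "unitary \<sigma>"
  shows "act \<sigma> (dtheta j \<eta>) = (\<Sum>i\<in>UNIV. fscale (\<sigma> $ i $ j) (dtheta i (act \<sigma> \<eta>)))"
proof (induction \<eta> rule: form_induct)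
  case (Th k \<eta>)
  let ?c = "\<lambda>i. cnj (\<sigma> $ i $ k)"
  have "(\<Sum>i\<in>UNIV. fscale (\<sigma> $ i $ j) (dtheta i (act \<sigma> (Th k * \<eta>)))) =
      (\<Sum>i\<in>UNIV. fscale (\<sigma> $ i $ j * ?c i) (act \<sigma> \<eta>)) -
      Thc ?c * (\<Sum>i\<in>UNIV. fscale (\<sigma> $ i $ j) (dtheta i (act \<sigma> \<eta>)))"
    by (simp add: act_Th_mult dtheta_Thc fscale_diff sum_subtractf sum_distrib_left mult_fscale_right)
  also have "(\<Sum>i\<in>UNIV. fscale (\<sigma> $ i $ j * ?c i) (act \<sigma> \<eta>)) = (if j = k then act \<sigma> \<eta> else 0)"
    unfolding fscale_sum_left[symmetric] unitary_columns[OF assms] by simp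
  finally show ?case by (simp add: dtheta_Th act_diff Th[symmetric] act_Th_mult if_distrib[of "act \<sigma>"] act_uminus)
next
  case (X k \<eta>)
  show ?case by (simp add: dtheta_of_pol act_X_mult X dtheta_Xc sum_distrib_left mult_fscale_right)
qed (simp_all add: dtheta_fscale act_fscale act_add dtheta_add fscale_add sum.distrib)

text \<open>Unitarity enters here: it makes \<open>\<partial>_{x_j}\<close> and the contractions transform like the conjugate of the
  coordinates.\<close>

lemma act_dform:
  assumes "unitary \<sigma>"
  shows "act \<sigma> (dform \<omega> \<eta>) = dform (act \<sigma> \<omega>) (act \<sigma> \<eta>)"
  by (induction \<omega> arbitrary: \<eta> rule: form_induct)
    (simp_all add: act_fscale act_add dform_fscale_left dform_add_left dform_X dform_Th act_X_mult act_Th_mult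
      dform_Xc dform_Thc act_dx[OF assms] act_dtheta[OF assms])


section \<open>The invariant hermitian form\<close>

text \<open>The monomials \<open>x^\<alpha> \<theta>_I\<close> are orthogonal for this pairing, with square length \<open>\<alpha>!\<close>, so it is positive
  definite.  Multiplication is adjoint to differentiation, and the unitary group acts by isometries.\<close>

definition pair :: "'n::{finite,linorder} form \<Rightarrow> 'n form \<Rightarrow> complex" where
  "pair \<omega> \<eta> = lk (coef (dform \<omega> \<eta>) {}) 0"

definition mfact :: "('n::finite \<Rightarrow>\<^sub>0 nat) \<Rightarrow> nat" where
  "mfact \<alpha> = (\<Prod>i\<in>UNIV. fact (lk \<alpha> i))"

lemma mfact_step: "mfact (single i 1 + \<alpha>) = Suc (lk \<alpha> i) * mfact \<alpha>"
proof -
  have "mfact (single i 1 + \<alpha>) = (\<Prod>j\<in>UNIV. (if j = i then Suc (lk \<alpha> i) else 1) * fact (lk \<alpha> j))"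
    unfolding mfact_def by (rule prod.cong) (auto simp: lookup_add lookup_single)
  then show ?thesis by (simp add: prod.distrib prod.delta mfact_def)
qed

lemma mfact_nonzero [simp]: "mfact \<alpha> \<noteq> 0"
  by (simp add: mfact_def)

lemma mfact_0 [simp]: "mfact 0 = 1"
  by (simp add: mfact_def)

lemma dx_mon_const_coeff:
  "lk (coef (dx_mon \<alpha> \<eta>) I) 0 = of_nat (mfact \<alpha>) * lk (coef (\<eta> :: 'n::{finite,linorder} form) I) \<alpha>"
proof (induction \<alpha> arbitrary: \<eta> rule: exponent_induct)
  case (step i \<alpha>)
  then show ?case by (simp only: dx_mon_step mfact_step coef_dx lookup_pderiv) (simp add: algebra_simps)
qed simp

lemma dtheta_mon_const_coeff: "coef (dtheta_mon I \<eta>) {} = coef (\<eta> :: 'n::{finite,linorder} form) I"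
proof -
  have "finite I" by simp
  then show ?thesis
  proof (induction arbitrary: \<eta> rule: finite_linorder_min_induct)
    case (insert b A)
    have e: "{j \<in> A. j < b} = {}" "b \<notin> A" using insert.hyps by (auto dest: less_not_sym)
    then show ?case using dtheta_mon_insert[OF e(2)] insert.IH unfolding e(1) by (simp add: coef_dtheta e(1))
  qed simp
qed

lemma pair_eq: "pair \<omega> \<eta> = (\<Sum>I\<in>UNIV. \<Sum>\<alpha>\<in>keys (coef \<omega> I).
    cnj (lk (coef \<omega> I) \<alpha>) * (of_nat (mfact \<alpha>) * lk (coef \<eta> I) \<alpha>))"
  unfolding pair_def dform_def
  by (simp add: lookup_sum dx_mon_const_coeff dtheta_mon_const_coeff)

lemma pair_self_eq_0:
  assumes "pair \<omega> \<omega> = 0"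
  shows "\<omega> = 0"
proof -
  have t: "cnj z * (of_nat m * z) = of_real (of_nat m * (cmod z)\<^sup>2)" for z m
    unfolding of_real_mult complex_norm_square by simp
  define S where "S = (\<Sum>I\<in>UNIV. \<Sum>\<alpha>\<in>keys (coef \<omega> I).
      of_nat (mfact \<alpha>) * (cmod (lk (coef \<omega> I) \<alpha>))\<^sup>2)"
  have "pair \<omega> \<omega> = of_real S" by (simp only: S_def pair_eq t of_real_sum)
  then have "S = 0" using assms by simp
  then have "\<forall>I. (\<Sum>\<alpha>\<in>keys (coef \<omega> I). of_nat (mfact \<alpha>) * (cmod (lk (coef \<omega> I) \<alpha>))\<^sup>2) = 0"
    unfolding S_def by (subst (asm) sum_nonneg_eq_0_iff) (auto intro!: sum_nonneg)
  then have "\<forall>I. \<forall>\<alpha>\<in>keys (coef \<omega> I). of_nat (mfact \<alpha>) * (cmod (lk (coef \<omega> I) \<alpha>))\<^sup>2 = 0"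
    by (subst (asm) sum_nonneg_eq_0_iff) auto
  then have "coef \<omega> I = 0" for I
    by (intro poly_mapping_eqI) (auto simp: in_keys_iff)
  then show ?thesis by (intro form_eqI) simp
qed

text \<open>The operator applied to the form itself has the square length of the form as its constant
  coefficient.\<close>

lemma dform_eq_0_imp: "(\<And>\<eta>. dform \<omega> \<eta> = 0) \<Longrightarrow> \<omega> = 0"
  by (rule pair_self_eq_0) (simp add: pair_def)

lemma act_const_coeff: "lk (coef (act \<sigma> \<omega>) {}) 0 = lk (coef \<omega> {}) 0"
proof (induction \<omega> rule: form_induct)
  case (X i \<omega>)
  have "lk (pvar i * p) 0 = 0" for i :: 'a and p :: "'a mpol"
    by (induction p rule: mpol_single_induct)
      (auto simp: pvar_mult_single lookup_single when_def distrib_left lookup_add dest: arg_cong[of _ _ "\<lambda>m. lk m i"])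
  then show ?case by (simp add: act_X_mult Xc_mult lookup_sum)
qed (simp_all add: act_fscale act_add lookup_add act_Th_mult Thc_mult coef_Th_mult)

lemma pair_act:
  assumes "unitary \<sigma>"
  shows "pair (act \<sigma> \<omega>) (act \<sigma> \<eta>) = pair \<omega> \<eta>"
  by (simp add: pair_def act_const_coeff flip: act_dform[OF assms])


section \<open>Homogeneity\<close>

lemma bihom_0 [simp]: "bihom a b (0 :: 'n::{finite,linorder} form)"
  by (simp add: bihom_def)

lemma bihomD:
  assumes "bihom a b \<omega>" "\<alpha> \<in> keys (coef \<omega> I)"
  shows "mdeg \<alpha> = a" "card I = b"
  using assms unfolding bihom_def by blast+

lemma keys_nonempty: "p \<noteq> 0 \<Longrightarrow> \<exists>\<alpha>. \<alpha> \<in> keys p"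
  by (metis in_keys_iff lookup_zero poly_mapping_eqI)

lemma bihom_card: "bihom a b \<omega> \<Longrightarrow> coef \<omega> I \<noteq> 0 \<Longrightarrow> card I = b"
  using bihomD(2) keys_nonempty by metis

lemma bihom_add: "bihom a b \<omega> \<Longrightarrow> bihom a b \<eta> \<Longrightarrow> bihom a b (\<omega> + \<eta> :: 'n::{finite,linorder} form)"
  unfolding bihom_def using keys_add by fastforce

lemma bihom_of_pol_mult:
  assumes "bihom a 0 (of_pol p :: 'n::{finite,linorder} form)" "bihom a' b \<omega>"
  shows "bihom (a + a') b (of_pol p * \<omega>)"
  unfolding bihom_def
proof (intro allI ballI)
  fix I \<alpha> assume "\<alpha> \<in> keys (coef (of_pol p * \<omega>) I)"
  then obtain \<beta> \<gamma> where "\<alpha> = \<beta> + \<gamma>" "\<beta> \<in> keys p" "\<gamma> \<in> keys (coef \<omega> I)"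
    using keys_mult[of p "coef \<omega> I"] by auto
  moreover have "mdeg \<beta> = a" if "\<beta> \<in> keys p" for \<beta>
    using assms(1) that unfolding bihom_def by (metis coef_of_pol)
  ultimately show "mdeg \<alpha> = a + a' \<and> card I = b"
    using assms(2) by (auto simp: bihom_def mdeg_add)
qed

lemma bihom_pconst: "bihom 0 0 (of_pol (pconst c) :: 'n::{finite,linorder} form)"
  by (auto simp: bihom_def coef_of_pol pconst_def split: if_splits)

lemma bihom_fscale: "bihom a b \<omega> \<Longrightarrow> bihom a b (fscale c \<omega> :: 'n::{finite,linorder} form)"
  using bihom_of_pol_mult[OF bihom_pconst, of a b \<omega> c] by (simp add: fscale_eq)

lemma bihom_uminus: "bihom a b \<omega> \<Longrightarrow> bihom a b (- \<omega> :: 'n::{finite,linorder} form)"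
  using bihom_fscale[of a b \<omega> "- 1"] by (simp add: fscale_minus_1)

lemma bihom_diff: "bihom a b \<omega> \<Longrightarrow> bihom a b \<eta> \<Longrightarrow> bihom a b (\<omega> - \<eta> :: 'n::{finite,linorder} form)"
  using bihom_add[of a b \<omega> "- \<eta>"] by (simp add: bihom_uminus)

lemma bihom_sum: "(\<And>x. x \<in> A \<Longrightarrow> bihom a b (f x)) \<Longrightarrow> bihom a b (sum f A :: 'n::{finite,linorder} form)"
  by (induction A rule: infinite_finite_induct) (auto intro: bihom_add)

lemma bihom_1: "bihom 0 0 (1 :: 'n::{finite,linorder} form)"
  using bihom_pconst[of 1] by simp

lemma bihom_X: "bihom 1 0 (X i :: 'n::{finite,linorder} form)"
  by (auto simp: bihom_def coef_of_pol pvar_def split: if_splits)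

lemma bihom_Xc: "bihom 1 0 (Xc c)"
  unfolding Xc_def by (intro bihom_sum bihom_fscale bihom_X)

lemma bihom_Xc_mult: "bihom a b \<omega> \<Longrightarrow> bihom (Suc a) b (Xc c * \<omega>)"
  using bihom_of_pol_mult[of 1 _ a b \<omega>] bihom_Xc[of c] by (simp add: Xc_of_pol)

lemma bihom_Th_mult:
  assumes "bihom a b \<omega>" shows "bihom a (Suc b) (Th i * \<omega> :: 'n::{finite,linorder} form)"
  unfolding bihom_def
proof (intro allI ballI)
  fix I \<alpha> assume *: "\<alpha> \<in> keys (coef (Th i * \<omega>) I)"
  then have i: "i \<in> I" by (auto simp: coef_Th_mult split: if_splits)
  obtain k where "coef (Th i * \<omega>) I = (- 1) ^ k * coef \<omega> (I - {i})" using i by (auto simp: coef_Th_mult)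
  then have "\<alpha> \<in> keys (coef \<omega> (I - {i}))" using * by (cases "even k") (auto simp: in_keys_iff)
  moreover have "card I = Suc (card (I - {i}))" by (rule card.remove) (use i in auto)
  ultimately show "mdeg \<alpha> = a \<and> card I = Suc b" using assms unfolding bihom_def by simp
qed

lemma bihom_Thc_mult: "bihom a b \<omega> \<Longrightarrow> bihom a (Suc b) (Thc c * \<omega>)"
  unfolding Thc_mult by (intro bihom_sum bihom_fscale bihom_Th_mult)

lemma bihom_Thc: "bihom 0 1 (Thc c)"
  using bihom_Thc_mult[OF bihom_1, of c] by simp

lemma bihom_dx: "bihom (Suc a) b \<omega> \<Longrightarrow> bihom a b (dx i \<omega> :: 'n::{finite,linorder} form)"
  unfolding bihom_def[of a]
proof (intro allI ballI)
  fix I \<alpha> assume h: "bihom (Suc a) b \<omega>" and "\<alpha> \<in> keys (coef (dx i \<omega>) I)"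
  then have "\<alpha> + single i 1 \<in> keys (coef \<omega> I)" by (simp add: in_keys_iff lookup_pderiv)
  from bihomD[OF h this] show "mdeg \<alpha> = a \<and> card I = b" by (simp add: mdeg_add)
qed

lemma dx_bihom_0: "bihom 0 b \<omega> \<Longrightarrow> dx i \<omega> = (0 :: 'n::{finite,linorder} form)"
proof (intro form_eqI poly_mapping_eqI)
  fix I \<alpha> assume "bihom 0 b \<omega>"
  moreover have "mdeg (\<alpha> + single i 1) \<noteq> 0" by (simp add: mdeg_add)
  ultimately have "lk (coef \<omega> I) (\<alpha> + single i 1) = 0"
    unfolding bihom_def by (metis in_keys_iff)
  then show "lk (coef (dx i \<omega>) I) \<alpha> = lk (coef 0 I) \<alpha>" by (simp add: lookup_pderiv)
qed

lemma bihom_dtheta: "bihom a (Suc b) \<omega> \<Longrightarrow> bihom a b (dtheta i \<omega> :: 'n::{finite,linorder} form)"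
  unfolding bihom_def
proof (intro allI ballI)
  fix I \<alpha> assume h: "\<forall>I. \<forall>\<alpha>\<in>keys (coef \<omega> I). mdeg \<alpha> = a \<and> card I = Suc b" and *: "\<alpha> \<in> keys (coef (dtheta i \<omega>) I)"
  then have i: "i \<notin> I" by (auto simp: coef_dtheta split: if_splits)
  obtain k where "coef (dtheta i \<omega>) I = (- 1) ^ k * coef \<omega> (insert i I)" using i by (auto simp: coef_dtheta)
  then have "\<alpha> \<in> keys (coef \<omega> (insert i I))" using * by (cases "even k") (auto simp: in_keys_iff)
  then have "mdeg \<alpha> = a \<and> card (insert i I) = Suc b" using h by blast
  then show "mdeg \<alpha> = a \<and> card I = b" using i by simp
qed

lemma dtheta_bihom_0: "bihom a 0 \<omega> \<Longrightarrow> dtheta i \<omega> = (0 :: 'n::{finite,linorder} form)"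
proof (rule form_eqI)
  fix I assume "bihom a 0 \<omega>"
  then have "coef \<omega> (insert i I) = 0" unfolding bihom_def
    by (metis card_eq_0_iff finite insert_not_empty in_keys_iff lookup_zero poly_mapping_eqI)
  then show "coef (dtheta i \<omega>) I = coef 0 I" by (simp add: coef_dtheta)
qed

lemma bihom_grade_inv: "bihom a b \<omega> \<Longrightarrow> grade_inv \<omega> = fscale ((- 1) ^ b) (\<omega> :: 'n::{finite,linorder} form)"
proof (rule form_eqI)
  fix I assume h: "bihom a b \<omega>"
  have e: "((- 1) ^ k :: 'n mpol) = pconst ((- 1) ^ k)" for k
    by (cases "even k") (auto simp: pconst_uminus)
  show "coef (grade_inv \<omega>) I = coef (fscale ((- 1) ^ b) \<omega>) I"
  proof (cases "coef \<omega> I = 0")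
    case False
    then have "card I = b" using bihom_card[OF h] by simp
    then show ?thesis by (simp add: e)
  qed simp
qed

text \<open>Properties that depend on the coefficients, such as rationality and bidegree, are not covered by
  induction over all forms; they are transferred from the monomials that occur in a form.\<close>

lemma form_expand_monomials:
  "\<omega> = (\<Sum>I\<in>UNIV. \<Sum>\<alpha>\<in>keys (coef \<omega> I). fscale (lk (coef \<omega> I) \<alpha>) (of_pol (single \<alpha> 1) * theta I) :: 'n::{finite,linorder} form)"
proof -
  have "(\<Sum>\<alpha>\<in>keys (coef \<omega> I). fscale (lk (coef \<omega> I) \<alpha>) (of_pol (single \<alpha> 1) * theta I)) = of_pol (coef \<omega> I) * theta I" for I
  proof -
    have "(\<Sum>\<alpha>\<in>keys (coef \<omega> I). fscale (lk (coef \<omega> I) \<alpha>) (of_pol (single \<alpha> 1) * theta I)) =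
        of_pol (\<Sum>\<alpha>\<in>keys (coef \<omega> I). single \<alpha> (lk (coef \<omega> I) \<alpha>)) * theta I"
      by (simp add: of_pol_sum sum_distrib_right fscale_eq pconst_mult_single flip: mult.assoc of_pol_mult)
    then show ?thesis by (simp flip: poly_mapping_expand)
  qed
  then show ?thesis using form_expand[of \<omega>] by simp
qed

lemma form_closure:
  fixes \<omega> :: "'n::{finite,linorder} form"
  assumes "\<And>I \<alpha>. \<alpha> \<in> keys (coef \<omega> I) \<Longrightarrow> P (fscale (lk (coef \<omega> I) \<alpha>) (of_pol (single \<alpha> 1) * theta I))"
    and 0: "P 0" and a: "\<And>\<omega> \<eta>. P \<omega> \<Longrightarrow> P \<eta> \<Longrightarrow> P (\<omega> + \<eta>)"
  shows "P \<omega>"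
proof -
  have s: "P (sum f A)" if "\<And>x. x \<in> A \<Longrightarrow> P (f x)" for f and A :: "'x set"
    using that by (induction A rule: infinite_finite_induct) (use 0 a in auto)
  have s': "P (sum f A)" if "\<And>x. x \<in> A \<Longrightarrow> P (f x)" for f and A :: "'y set"
    using that by (induction A rule: infinite_finite_induct) (use 0 a in auto)
  show ?thesis by (subst form_expand_monomials) (intro s s' assms(1))
qed

text \<open>The parameters of \<open>P\<close> are the \<open>x\<close>-degree and the \<open>\<theta>\<close>-degree.\<close>

lemma monomial_induct [case_names one Th X]:
  fixes I :: "'n::{finite,linorder} set"
  assumes 1: "P 0 0 (1 :: 'n form)"
    and T: "\<And>b i \<omega>. P 0 b \<omega> \<Longrightarrow> P 0 (Suc b) (Th i * \<omega>)"
    and X: "\<And>a b i \<omega>. P a b \<omega> \<Longrightarrow> P (Suc a) b (X i * \<omega>)"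
  shows "P (mdeg \<alpha>) (card I) (of_pol (single \<alpha> 1) * theta I)"
proof (induction \<alpha> rule: exponent_induct)
  case zero
  have "P 0 (length xs) (prod_list (map Th xs))" for xs :: "'n list"
    by (induction xs) (use 1 T in auto)
  from this[of "sorted_list_of_set I"] show ?case by (simp add: theta_eq_prod_list[of I])
next
  case (step i \<alpha>)
  have "of_pol (single (single i 1 + \<alpha>) 1) * theta I = X i * (of_pol (single \<alpha> 1) * theta I)"
    by (simp add: pvar_mult_single flip: of_pol_mult mult.assoc)
  then show ?case using X[OF step, of i] by (simp only: mdeg_add mdeg_single plus_1_eq_Suc)
qed

lemma bihom_monomial: "bihom (mdeg \<alpha>) (card I) (of_pol (single \<alpha> c) * theta I :: 'n::{finite,linorder} form)"
  by (auto simp: bihom_def coef_theta split: if_splits)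

lemma bihom_act:
  assumes "bihom a b \<omega>"
  shows "bihom a b (act \<sigma> \<omega>)"
proof (rule form_closure[of \<omega>])
  fix I \<alpha> assume "\<alpha> \<in> keys (coef \<omega> I)"
  then have "a = mdeg \<alpha>" "b = card I" using assms by (auto simp: bihom_def)
  moreover have "bihom (mdeg \<alpha>) (card I) (act \<sigma> (of_pol (single \<alpha> 1) * theta I))"
    by (induction rule: monomial_induct)
      (simp_all add: bihom_1 act_Th_mult bihom_Thc_mult act_X_mult bihom_Xc_mult)
  ultimately show "bihom a b (act \<sigma> (fscale (lk (coef \<omega> I) \<alpha>) (of_pol (single \<alpha> 1) * theta I)))"
    by (simp add: act_fscale bihom_fscale)
qed (simp_all add: act_add bihom_add)

lemma bihom_theta_hom: "bihom a b \<omega> \<Longrightarrow> theta_hom b (\<omega> :: 'n::{finite,linorder} form)"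
  unfolding bihom_def theta_hom_def by (metis in_keys_iff lookup_zero poly_mapping_eqI)

lemma theta_hom_0 [simp]: "theta_hom b (0 :: 'n::{finite,linorder} form)"
  by (simp add: theta_hom_def)

lemma theta_hom_add: "theta_hom b \<omega> \<Longrightarrow> theta_hom b \<eta> \<Longrightarrow> theta_hom b (\<omega> + \<eta> :: 'n::{finite,linorder} form)"
  unfolding theta_hom_def by (metis add.right_neutral coef_add)

lemma theta_hom_of_pol_mult: "theta_hom b \<omega> \<Longrightarrow> theta_hom b (of_pol p * \<omega> :: 'n::{finite,linorder} form)"
  unfolding theta_hom_def by auto

lemma theta_hom_fscale: "theta_hom b \<omega> \<Longrightarrow> theta_hom b (fscale c \<omega> :: 'n::{finite,linorder} form)"
  by (simp add: fscale_eq theta_hom_of_pol_mult)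

lemma theta_hom_sum: "(\<And>x. x \<in> A \<Longrightarrow> theta_hom b (f x)) \<Longrightarrow> theta_hom b (sum f A :: 'n::{finite,linorder} form)"
  by (induction A rule: infinite_finite_induct) (auto intro: theta_hom_add)

lemma theta_hom_Th_mult:
  assumes "theta_hom b \<omega>" shows "theta_hom (Suc b) (Th i * \<omega> :: 'n::{finite,linorder} form)"
  unfolding theta_hom_def
proof (intro allI impI)
  fix I assume *: "coef (Th i * \<omega>) I \<noteq> 0"
  then have i: "i \<in> I" "coef \<omega> (I - {i}) \<noteq> 0" by (auto simp: coef_Th_mult split: if_splits)
  moreover have "card I = Suc (card (I - {i}))" by (rule card.remove) (use i in auto)
  ultimately show "card I = Suc b" using assms unfolding theta_hom_def by simp
qed

lemma theta_hom_Thc_mult: "theta_hom b \<omega> \<Longrightarrow> theta_hom (Suc b) (Thc c * \<omega>)"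
  unfolding Thc_mult by (intro theta_hom_sum theta_hom_fscale theta_hom_Th_mult)

lemma theta_hom_dx: "theta_hom b \<omega> \<Longrightarrow> theta_hom b (dx i \<omega> :: 'n::{finite,linorder} form)"
  unfolding theta_hom_def by (metis coef_dx pderiv_0)

lemma theta_hom_dform_of_pol:
  "theta_hom b \<omega> \<Longrightarrow> theta_hom b (dform (of_pol p) (\<omega> :: 'n::{finite,linorder} form))"
proof (induction p arbitrary: \<omega> rule: mpol_induct)
  case (const c)
  then show ?case using dform_fscale_left[of c 1 \<omega>] by (simp add: fscale_eq[of c 1] theta_hom_fscale)
qed (simp_all add: of_pol_add of_pol_mult dform_add_left dform_X theta_hom_add theta_hom_dx)

lemma theta_hom_too_large:
  assumes "theta_hom b \<omega>" "b > CARD('n)"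
  shows "\<omega> = (0 :: 'n::{finite,linorder} form)"
proof (rule form_eqI)
  fix I :: "'n set"
  have "card I \<le> CARD('n)" by (rule card_mono) auto
  then show "coef \<omega> I = coef 0 I" using assms by (auto simp: theta_hom_def)
qed

lemma theta_hom_top:
  assumes "theta_hom CARD('n) \<omega>"
  shows "\<omega> = (of_pol (coef \<omega> UNIV) * theta UNIV :: 'n::{finite,linorder} form)"
proof (rule form_eqI)
  fix I :: "'n set"
  have "card I = CARD('n) \<Longrightarrow> I = UNIV" by (metis card_subset_eq finite subset_UNIV)
  then show "coef \<omega> I = coef (of_pol (coef \<omega> UNIV) * theta UNIV) I"
    using assms by (auto simp: theta_hom_def coef_theta)
qed

lemma theta_hom_bot: "theta_hom 0 \<omega> \<Longrightarrow> \<omega> = (of_pol (coef \<omega> {}) :: 'n::{finite,linorder} form)"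
  by (rule form_eqI) (metis card_eq_0_iff coef_of_pol finite theta_hom_def)

lemma dtheta_of_pol_1 [simp]: "dtheta i (of_pol p) = (0 :: 'n::{finite,linorder} form)"
  using dtheta_of_pol[of i p 1] by simp

text \<open>For functions, only the invariants of \<open>\<theta>\<close>-degree 0 restrict super harmonicity.\<close>

lemma dform_of_pol_eq_0:
  assumes "bihom a (Suc b) \<omega>"
  shows "dform \<omega> (of_pol p) = (0 :: 'n::{finite,linorder} form)"
proof (rule form_closure[of \<omega>])
  fix I \<alpha> assume "\<alpha> \<in> keys (coef \<omega> I)"
  then have "I \<noteq> {}" using bihomD(2)[OF assms] by force
  then obtain i where "i \<in> I" by blast
  then have e: "I = insert i (I - {i})" by auto
  have "dtheta_mon I (of_pol p) = (0 :: 'n form)"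
    by (subst e, subst dtheta_mon_insert) (auto simp: dtheta_mon_fscale[of _ 0 0, simplified])
  then show "dform (fscale (lk (coef \<omega> I) \<alpha>) (of_pol (single \<alpha> 1) * theta I)) (of_pol p) = 0"
    by (simp add: dform_fscale_left dform_monomial dx_mon_fscale[of _ 0 0, simplified])
qed (simp_all add: dform_add_left)


section \<open>Rationality over a subfield\<close>

locale conj_closed_subfield =
  fixes K :: "complex set"
  assumes K: "conj_subfield K"
begin

lemma K_closed:
  "0 \<in> K" "1 \<in> K" "a \<in> K \<Longrightarrow> b \<in> K \<Longrightarrow> a + b \<in> K" "a \<in> K \<Longrightarrow> b \<in> K \<Longrightarrow> a * b \<in> K" "a \<in> K \<Longrightarrow> - a \<in> K"
  "a \<in> K \<Longrightarrow> inverse a \<in> K" "a \<in> K \<Longrightarrow> cnj a \<in> K"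
  using K by (auto simp: conj_subfield_def)

lemma K_diff: "a \<in> K \<Longrightarrow> b \<in> K \<Longrightarrow> a - b \<in> K"
  using K_closed(3)[of a "- b"] K_closed(5)[of b] by simp

lemma K_divide: "a \<in> K \<Longrightarrow> b \<in> K \<Longrightarrow> a / b \<in> K"
  using K_closed(4)[of a "inverse b"] K_closed(6)[of b] by (simp add: divide_inverse)

lemma K_sum: "(\<And>x. x \<in> A \<Longrightarrow> f x \<in> K) \<Longrightarrow> sum f A \<in> K"
  by (induction A rule: infinite_finite_induct) (auto intro: K_closed)

lemma K_of_nat: "of_nat k \<in> K"
  by (induction k) (auto intro: K_closed)

lemma K_pols_iff: "p \<in> K_pols K \<longleftrightarrow> (\<forall>\<alpha>. lk p \<alpha> \<in> K)"
  by (auto simp: K_pols_def)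

lemma K_pols_add: "p \<in> K_pols K \<Longrightarrow> q \<in> K_pols K \<Longrightarrow> p + q \<in> K_pols K"
  by (auto simp: K_pols_iff lookup_add intro: K_closed)

lemma K_pols_single: "c \<in> K \<Longrightarrow> single \<alpha> c \<in> K_pols K"
  by (auto simp: K_pols_iff lookup_single when_def intro: K_closed)

lemma K_pols_pconst: "c \<in> K \<Longrightarrow> pconst c \<in> K_pols K"
  by (simp add: pconst_def K_pols_single)

lemma K_pols_0: "0 \<in> K_pols K" and K_pols_1: "1 \<in> K_pols K"
  by (auto simp: K_pols_iff lookup_one when_def intro: K_closed)

lemma K_pols_sum: "(\<And>x. x \<in> A \<Longrightarrow> f x \<in> K_pols K) \<Longrightarrow> sum f A \<in> K_pols K"
  by (induction A rule: infinite_finite_induct)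
    (auto intro: K_pols_add K_pols_0)

lemma K_pols_mult:
  assumes "p \<in> K_pols K" "q \<in> K_pols K"
  shows "p * q \<in> K_pols K"
proof -
  have "p * q = (\<Sum>\<alpha>\<in>keys p. \<Sum>\<beta>\<in>keys q. single (\<alpha> + \<beta>) (lk p \<alpha> * lk q \<beta>))"
    by (subst poly_mapping_expand[of p], subst poly_mapping_expand[of q])
      (simp only: sum_product mult_single)
  then show ?thesis using assms
    by (auto simp: K_pols_iff[of p] K_pols_iff[of q] intro!: K_pols_sum K_pols_single K_closed)
qed

lemma K_pols_pvar: "pvar i \<in> K_pols K"
  by (simp add: pvar_def K_pols_single K_closed)

lemma K_pols_pcnj: "p \<in> K_pols K \<Longrightarrow> pcnj p \<in> K_pols K"
  by (simp add: K_pols_iff K_closed)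

lemma K_pols_neg_one_power: "(- 1) ^ k \<in> K_pols K"
  by (cases "even k") (auto simp: K_pols_1 K_pols_iff lookup_one when_def K_closed)

lemma K_forms_iff: "\<omega> \<in> K_forms K \<longleftrightarrow> (\<forall>I. coef \<omega> I \<in> K_pols K)"
  by (simp add: K_forms_def)

lemma K_forms_add: "\<omega> \<in> K_forms K \<Longrightarrow> \<eta> \<in> K_forms K \<Longrightarrow> \<omega> + \<eta> \<in> K_forms (K :: complex set)"
  for \<omega> \<eta> :: "'n::{finite,linorder} form"
  by (simp add: K_forms_iff K_pols_add)

lemma K_forms_of_pol: "p \<in> K_pols K \<Longrightarrow> of_pol p \<in> K_forms K"
  by (simp add: K_forms_iff coef_of_pol K_pols_0)

lemma K_forms_theta: "theta I \<in> K_forms K"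
  by (simp add: K_forms_iff coef_theta K_pols_0 K_pols_1)

lemma K_forms_mult: "\<omega> \<in> K_forms K \<Longrightarrow> \<eta> \<in> K_forms K \<Longrightarrow> \<omega> * \<eta> \<in> K_forms K"
  for \<omega> \<eta> :: "'n::{finite,linorder} form"
  by (auto simp: K_forms_iff times_form_def theta_sign_def
      intro!: K_pols_sum K_pols_mult K_pols_neg_one_power)

lemma K_forms_fscale: "c \<in> K \<Longrightarrow> \<omega> \<in> K_forms K \<Longrightarrow> fscale c \<omega> \<in> K_forms K"
  for \<omega> :: "'n::{finite,linorder} form"
  by (simp add: fscale_eq K_forms_mult K_forms_of_pol K_pols_pconst)

lemma K_forms_0: "0 \<in> K_forms K" and K_forms_1: "1 \<in> K_forms K"
  by (simp_all add: K_forms_iff coef_1 K_pols_0 K_pols_1)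

lemma K_forms_sum: "(\<And>x. x \<in> A \<Longrightarrow> f x \<in> K_forms K) \<Longrightarrow> sum f A \<in> K_forms K"
  for f :: "'a \<Rightarrow> 'n::{finite,linorder} form"
  by (induction A rule: infinite_finite_induct) (auto intro: K_forms_add K_forms_0)

lemma K_forms_diff: "\<omega> \<in> K_forms K \<Longrightarrow> \<eta> \<in> K_forms K \<Longrightarrow> \<omega> - \<eta> \<in> K_forms K"
  for \<omega> \<eta> :: "'n::{finite,linorder} form"
  using K_forms_add[of \<omega> "fscale (- 1) \<eta>"] K_forms_fscale[of "- 1" \<eta>] K_closed
  by (simp add: fscale_minus_1)

lemma K_forms_dx: "\<omega> \<in> K_forms K \<Longrightarrow> dx i \<omega> \<in> K_forms K"
  by (auto simp: K_forms_iff K_pols_iff lookup_pderiv K_of_nat intro!: K_closed)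

lemma K_forms_dtheta: "\<omega> \<in> K_forms K \<Longrightarrow> dtheta i \<omega> \<in> K_forms K"
  by (auto simp: K_forms_iff coef_dtheta K_pols_0 intro!: K_pols_mult K_pols_neg_one_power)

lemma K_forms_dform:
  fixes \<omega> \<eta> :: "'n::{finite,linorder} form"
  assumes "\<omega> \<in> K_forms K" "\<eta> \<in> K_forms K"
  shows "dform \<omega> \<eta> \<in> K_forms K"
proof (rule form_closure[of \<omega>])
  fix I :: "'n set" and \<alpha>
  have "\<forall>\<eta>\<in>K_forms K. dform (of_pol (single \<alpha> 1) * theta I) \<eta> \<in> K_forms K"
    by (induction rule: monomial_induct) (auto simp: dform_Th dform_X K_forms_dx K_forms_dtheta)
  then show "dform (fscale (lk (coef \<omega> I) \<alpha>) (of_pol (single \<alpha> 1) * theta I)) \<eta> \<in> K_forms K"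
    using assms by (auto simp: dform_fscale_left K_forms_iff[of \<omega>] K_pols_iff intro!: K_forms_fscale K_closed)
qed (auto simp: dform_add_left K_forms_0 intro: K_forms_add)

lemma K_forms_symbol_op:
  "\<omega> \<in> K_forms K \<Longrightarrow> \<eta> \<in> K_forms K \<Longrightarrow> symbol_op \<omega> \<eta> \<in> K_forms K"
  unfolding symbol_op_eq
  by (intro K_forms_sum K_forms_mult K_forms_theta K_forms_dform K_forms_of_pol K_pols_pcnj)
    (simp_all add: K_forms_iff)

lemma K_forms_Xc: "(\<And>i. c i \<in> K) \<Longrightarrow> Xc c \<in> K_forms K"
  and K_forms_Thc: "(\<And>i. c i \<in> K) \<Longrightarrow> Thc c \<in> K_forms K"
  unfolding Xc_def Thc_def
  by (intro K_forms_sum K_forms_fscale K_forms_of_pol K_pols_pvar K_forms_theta; simp)+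

lemma K_forms_act:
  assumes "\<And>i j. \<sigma> $ i $ j \<in> K" "\<omega> \<in> K_forms K"
  shows "act \<sigma> \<omega> \<in> K_forms K"
proof (rule form_closure[of \<omega>])
  fix I \<alpha>
  have "act \<sigma> (of_pol (single \<alpha> 1) * theta I) \<in> K_forms K"
    by (induction rule: monomial_induct)
      (auto simp: K_forms_1 act_Th_mult act_X_mult intro!: K_forms_mult K_forms_Xc K_forms_Thc K_closed assms)
  then show "act \<sigma> (fscale (lk (coef \<omega> I) \<alpha>) (of_pol (single \<alpha> 1) * theta I)) \<in> K_forms K"
    using assms by (auto simp: act_fscale K_forms_iff[of \<omega>] K_pols_iff intro!: K_forms_fscale)
qed (auto simp: act_add K_forms_0 intro: K_forms_add)

end


section \<open>Pseudo-reflection groups\<close>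

lemma unitary_inverse: "unitary A \<Longrightarrow> A ** adj A = mat 1" "unitary A \<Longrightarrow> adj A ** A = mat 1"
  by (simp_all add: unitary_def)

lemma act_adj:
  assumes "unitary \<sigma>"
  shows "act \<sigma> (act (adj \<sigma>) \<omega>) = \<omega>" "act (adj \<sigma>) (act \<sigma> \<omega>) = \<omega>"
  by (simp_all add: act_id unitary_inverse[OF assms] flip: act_compose)

lemma (in conj_closed_subfield) GL_inv:
  assumes "h \<in> carrier (GL K)" "unitary h"
  shows "inv\<^bsub>GL K\<^esub> h = adj h"
proof -
  have "invertible (adj h)" unfolding invertible_def using unitary_inverse[OF assms(2)] by blast
  then have "adj h \<in> carrier (GL K)"
    using assms K by (auto simp: GL_def adj_def conj_subfield_def)
  moreover have "y = adj h" if "h ** y = mat 1" for y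
  proof -
    have "y = (adj h ** h) ** y" by (simp add: unitary_inverse(2)[OF assms(2)])
    also have "\<dots> = adj h ** (h ** y)" by (simp only: matrix_mul_assoc)
    finally show ?thesis by (simp add: that)
  qed
  ultimately show ?thesis unfolding m_inv_def
  proof (intro the_equality)
    fix y assume "y \<in> carrier (GL K) \<and> h \<otimes>\<^bsub>GL K\<^esub> y = \<one>\<^bsub>GL K\<^esub> \<and> y \<otimes>\<^bsub>GL K\<^esub> h = \<one>\<^bsub>GL K\<^esub>"
    then have "h ** y = mat 1" by (simp add: GL_def)
    then show "y = adj h" by fact
  qed (simp add: GL_def unitary_inverse[OF assms(2)])
qed

locale refl_group = conj_closed_subfield K for K +
  fixes G :: "'n::{finite,linorder} cmat set"
  assumes G: "pseudo_reflection_group K G"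
begin

lemma finite_G: "finite G" and G_unitary: "A \<in> G \<Longrightarrow> unitary A"
  using G by (auto simp: pseudo_reflection_group_def)

lemma G_induct [consumes 1, case_names one refl inv mult]:
  assumes "A \<in> G" "P (mat 1)" "\<And>s. pseudo_reflection K s \<Longrightarrow> s \<in> G \<Longrightarrow> P s"
    "\<And>s. s \<in> G \<Longrightarrow> P s \<Longrightarrow> P (adj s)"
    "\<And>A B. A \<in> G \<Longrightarrow> B \<in> G \<Longrightarrow> P A \<Longrightarrow> P B \<Longrightarrow> P (A ** B)"
  shows "P A"
proof -
  obtain S where S: "\<forall>A\<in>S. pseudo_reflection K A" "G = generate (GL K) S"
    using G by (auto simp: pseudo_reflection_group_def)
  have "S \<subseteq> G" using S(2) by (auto intro: generate.incl)
  have "A \<in> generate (GL K) S" using assms(1) S(2) by simp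
  then show ?thesis
  proof (induction rule: generate.induct)
    case one
    then show ?case using assms(2) by (simp add: GL_def)
  next
    case (incl h)
    then show ?case using assms(3) S \<open>S \<subseteq> G\<close> by blast
  next
    case (inv h)
    then have "h \<in> G" "pseudo_reflection K h" using S \<open>S \<subseteq> G\<close> by auto
    then have "h \<in> carrier (GL K)" by (simp add: pseudo_reflection_def)
    then have "inv\<^bsub>GL K\<^esub> h = adj h" using GL_inv G_unitary \<open>h \<in> G\<close> by blast
    then show ?case using assms(3,4) \<open>h \<in> G\<close> \<open>pseudo_reflection K h\<close> by metis
  next
    case (eng h1 h2)
    then show ?case using assms(5) S(2) by (simp add: GL_def)
  qed
qed

lemma one_in_G: "mat 1 \<in> G" and G_mult: "A \<in> G \<Longrightarrow> B \<in> G \<Longrightarrow> A ** B \<in> G"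
proof -
  obtain S where S: "G = generate (GL K) S" using G by (auto simp: pseudo_reflection_group_def)
  show "mat 1 \<in> G" using generate.one[of "GL K" S] by (simp add: S GL_def)
  show "A \<in> G \<Longrightarrow> B \<in> G \<Longrightarrow> A ** B \<in> G" using generate.eng[of A "GL K" S B] by (simp add: S GL_def)
qed

lemma G_entries:
  assumes "A \<in> G" shows "A $ i $ j \<in> K"
proof -
  have "\<forall>i j. A $ i $ j \<in> K" using assms
  proof (induction rule: G_induct)
    case one
    then show ?case using K_closed by (auto simp: mat_def)
  next
    case (refl s)
    then show ?case by (auto simp: pseudo_reflection_def GL_def)
  next
    case (inv s)
    then show ?case using K_closed by (auto simp: adj_def)
  next
    case (mult A B)
    then show ?case by (auto simp: matrix_matrix_mult_def intro!: K_sum K_closed)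
  qed
  then show ?thesis by simp
qed

lemma G_sum_translate:
  assumes "\<tau> \<in> G"
  shows "(\<Sum>\<sigma>\<in>G. g (\<tau> ** \<sigma>)) = (\<Sum>\<sigma>\<in>G. g \<sigma>)"
proof -
  have inj: "inj_on ((**) \<tau>) G"
    by (rule inj_on_inverseI[of _ "(**) (adj \<tau>)"])
      (simp add: matrix_mul_assoc unitary_inverse[OF G_unitary[OF assms]])
  have "(**) \<tau> ` G = G"
    by (rule endo_inj_surj[OF finite_G _ inj]) (use G_mult[OF assms] in auto)
  then show ?thesis using sum.reindex[OF inj, of g] by simp
qed

lemma det_adj_mult: "unitary s \<Longrightarrow> det (adj s) * det s = 1"
  using unitary_inverse(2)[of s] by (metis det_I det_mul)

end


section \<open>Super harmonics as common kernel of the invariant operators\<close>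

text \<open>All invariant forms with complex coefficients are admitted here.  This makes it possible to use
  invariants that are only known to exist over the complex numbers, such as the quadratic form of a
  real group.\<close>

definition superharm :: "'n::{finite,linorder} cmat set \<Rightarrow> 'n form \<Rightarrow> bool" where
  "superharm G \<eta> \<longleftrightarrow> (\<forall>\<omega> a b. bihom a b \<omega> \<and> a + b > 0 \<and> (\<forall>\<sigma>\<in>G. act \<sigma> \<omega> = \<omega>) \<longrightarrow> dform \<omega> \<eta> = 0)"

lemma superharmD:
  "superharm G \<eta> \<Longrightarrow> bihom a b \<omega> \<Longrightarrow> a + b > 0 \<Longrightarrow> (\<And>\<sigma>. \<sigma> \<in> G \<Longrightarrow> act \<sigma> \<omega> = \<omega>) \<Longrightarrow> dform \<omega> \<eta> = 0"
  unfolding superharm_def by blast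

lemma sum_const_form: "(\<Sum>x\<in>A. \<omega>) = fscale (of_nat (card A)) (\<omega> :: 'n::{finite,linorder} form)"
  by (induction A rule: infinite_finite_induct) (auto simp: fscale_add_left distrib_right)

text \<open>Homogeneous forms commute with everything up to a change of the other factor, so left and
  right ideals generated by homogeneous forms agree.\<close>

lemma Th_mult_grade: "Th i * \<omega> = grade_inv \<omega> * (Th i :: 'n::{finite,linorder} form)"
proof (induction \<omega> rule: form_induct)
  case (Th j \<omega>)
  have "Th i * (Th j * \<omega>) = - (Th j * (Th i * \<omega>))" by (rule Th_anticommute)
  then show ?case by (simp add: grade_inv_simps Th mult.assoc)
qed (simp_all add: grade_inv_simps mult_fscale_left mult_fscale_right distrib_left distrib_right
    of_pol_left_commute mult.assoc)

lemma bihom_swap: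
  assumes "bihom a b \<omega>"
  shows "\<exists>c'. c * \<omega> = \<omega> * (c' :: 'n::{finite,linorder} form)"
proof (induction c rule: form_induct)
  case (const z)
  then show ?case by (metis mult_fscale_left mult_fscale_right mult_1 mult_1_right)
next
  case (add c d)
  then show ?case by (metis distrib_left distrib_right)
next
  case (X i c)
  then show ?case by (metis mult.assoc of_pol_left_commute)
next
  case (Th i c)
  then obtain c' where "c * \<omega> = \<omega> * c'" by blast
  then have "Th i * c * \<omega> = \<omega> * fscale ((- 1) ^ b) (Th i * c')"
    using Th_mult_grade[of i \<omega>] bihom_grade_inv[OF assms]
    by (metis mult.assoc mult_fscale_left mult_fscale_right)
  then show ?case by blast
qed

context refl_group
begin

text \<open>Averaging over \<open>G\<close> writes an invariant form as a complex combination of averaged monomials, and these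
  belong to the ideal over \<open>K\<close>.\<close>

lemma superharm_if_SH:
  assumes "\<eta> \<in> SH K G"
  shows "superharm G \<eta>"
  unfolding superharm_def
proof (intro allI impI)
  fix \<omega> :: "'n form" and a b assume \<omega>: "bihom a b \<omega> \<and> a + b > 0 \<and> (\<forall>\<sigma>\<in>G. act \<sigma> \<omega> = \<omega>)"
  have "dform (\<Sum>\<sigma>\<in>G. act \<sigma> \<omega>) \<eta> = 0"
  proof (rule form_closure[of \<omega>])
    fix I :: "'n set" and \<alpha> assume "\<alpha> \<in> keys (coef \<omega> I)"
    then have ab: "a = mdeg \<alpha>" "b = card I" using bihomD[of a b \<omega> \<alpha> I] \<omega> by auto
    let ?m = "of_pol (single \<alpha> 1) * theta I :: 'n form"
    let ?g = "\<Sum>\<sigma>\<in>G. act \<sigma> ?m"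
    have "?g \<in> K_forms K"
      by (intro K_forms_sum K_forms_act G_entries K_forms_mult K_forms_of_pol
          K_pols_single K_closed(2) K_forms_theta)
    moreover have "bihom a b ?g" unfolding ab by (intro bihom_sum bihom_act bihom_monomial)
    moreover have "act \<tau> ?g = ?g" if "\<tau> \<in> G" for \<tau>
      using G_sum_translate[OF that, of "\<lambda>\<sigma>. act \<sigma> ?m"] by (simp add: act_sum act_compose)
    ultimately have "?g \<in> J_ideal K G" unfolding J_ideal_def
      using \<omega> by (intro hull_inc) auto
    then have "dform ?g \<eta> = 0" using assms by (simp add: SH_def)
    then show "dform (\<Sum>\<sigma>\<in>G. act \<sigma> (fscale (lk (coef \<omega> I) \<alpha>) ?m)) \<eta> = 0"
      by (simp add: act_fscale dform_fscale_left flip: fscale_sum)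
  qed (simp_all add: act_add sum.distrib dform_add_left)
  moreover have "(\<Sum>\<sigma>\<in>G. act \<sigma> \<omega>) = fscale (of_nat (card G)) \<omega>"
  proof -
    have "(\<Sum>\<sigma>\<in>G. act \<sigma> \<omega>) = (\<Sum>\<sigma>\<in>G. \<omega>)" by (rule sum.cong) (use \<omega> in auto)
    then show ?thesis by (simp only: sum_const_form)
  qed
  moreover have "card G \<noteq> 0" using finite_G one_in_G by auto
  ultimately show "dform \<omega> \<eta> = 0" by (auto simp: dform_fscale_left intro: fscale_cancel)
qed

text \<open>The forms all of whose multiples annihilate \<open>\<eta>\<close> make up a two-sided ideal; by the previous lemma it
  contains the generators.\<close>

lemma SH_if_superharm:
  assumes "\<eta> \<in> K_forms K" "superharm G \<eta>"
  shows "\<eta> \<in> SH K G"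
proof -
  let ?J = "{\<omega> \<in> K_forms K. \<forall>c c'. dform (c * \<omega> * c') \<eta> = 0}"
  have "two_sided_ideal K ?J" unfolding two_sided_ideal_def
    by (auto simp: K_forms_0 K_forms_add K_forms_mult distrib_left distrib_right
        dform_add_left) (metis mult.assoc)+
  moreover have "{\<omega> \<in> K_forms K. (\<exists>a b. bihom a b \<omega> \<and> a + b > 0) \<and> (\<forall>\<sigma>\<in>G. act \<sigma> \<omega> = \<omega>)} \<subseteq> ?J"
  proof
    fix \<omega> :: "'n form"
    assume "\<omega> \<in> {\<omega> \<in> K_forms K. (\<exists>a b. bihom a b \<omega> \<and> a + b > 0) \<and> (\<forall>\<sigma>\<in>G. act \<sigma> \<omega> = \<omega>)}"
    then obtain a b where *: "bihom a b \<omega>" "a + b > 0" "\<forall>\<sigma>\<in>G. act \<sigma> \<omega> = \<omega>" "\<omega> \<in> K_forms K" by blast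
    have "dform \<omega> \<eta> = 0" using superharmD[OF assms(2) *(1,2)] *(3) by blast
    have "dform (c * \<omega> * c') \<eta> = 0" for c c'
    proof -
      obtain c'' where "c * \<omega> = \<omega> * c''" using bihom_swap[OF *(1)] by blast
      then show ?thesis using \<open>dform \<omega> \<eta> = 0\<close> by (simp add: dform_mult)
    qed
    then show "\<omega> \<in> ?J" using *(4) by blast
  qed
  ultimately have "J_ideal K G \<subseteq> ?J" unfolding J_ideal_def by (intro hull_minimal)
  then have "dform \<omega> \<eta> = 0" if "\<omega> \<in> J_ideal K G" for \<omega>
    using that by (metis (mono_tags, lifting) mem_Collect_eq mult_1 mult_1_right subsetD)
  then show ?thesis using assms by (simp add: SH_def)
qed

lemma SH_deg_iff: "\<eta> \<in> SH_deg K G k \<longleftrightarrow> \<eta> \<in> K_forms K \<and> superharm G \<eta> \<and> theta_hom k \<eta>"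
  using superharm_if_SH SH_if_superharm by (auto simp: SH_deg_def) (simp add: SH_def)

end

lemma superharm_dform_of_pol: "superharm G \<eta> \<Longrightarrow> superharm G (dform (of_pol p) \<eta>)"
  unfolding superharm_def by (simp flip: dform_of_pol_commute)

lemma superharm_add: "superharm G \<eta> \<Longrightarrow> superharm G \<eta>' \<Longrightarrow> superharm G (\<eta> + \<eta>')"
  unfolding superharm_def by (simp add: dform_add_right)

lemma superharm_fscale: "superharm G \<eta> \<Longrightarrow> superharm G (fscale c \<eta>)"
  unfolding superharm_def by (simp add: dform_fscale_right)

lemma superharm_0: "superharm G 0"
  unfolding superharm_def by simp


section \<open>Generalized exterior derivatives preserve super harmonics\<close>

text \<open>The normal form \<open>\<Sum>_j \<theta>_j \<partial>_{q_j}\<close> of an operator that raises the \<open>\<theta>\<close>-degree by one and lowers the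
  \<open>x\<close>-degree by \<open>a\<close>.\<close>

definition ext_op :: "nat \<Rightarrow> ('n::{finite,linorder} form \<Rightarrow> 'n form) \<Rightarrow> bool" where
  "ext_op a T \<longleftrightarrow> (\<exists>q. (\<forall>j. bihom a 0 (of_pol (q j) :: 'n form)) \<and>
     (\<forall>\<eta>. T \<eta> = (\<Sum>j\<in>UNIV. Th j * dform (of_pol (q j)) \<eta>)))"

lemma ext_op_if_op_bihom:
  assumes "op_bihom a 1 T"
  shows "ext_op a T"
proof -
  obtain \<tau> where \<tau>: "bihom a 1 \<tau>" "T = symbol_op \<tau>" using assms by (auto simp: op_bihom_def)
  let ?q = "\<lambda>j. pcnj (coef \<tau> {j})"
  have "bihom a 0 (of_pol (?q j) :: 'a form)" for j
    using bihomD(1)[OF \<tau>(1)] by (auto simp: bihom_def coef_of_pol)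
  moreover have "T \<eta> = (\<Sum>j\<in>UNIV. Th j * dform (of_pol (?q j)) \<eta>)" for \<eta>
  proof -
    have "T \<eta> = (\<Sum>I\<in>range (\<lambda>j. {j}). theta I * dform (of_pol (pcnj (coef \<tau> I))) \<eta>)"
      unfolding \<tau>(2) symbol_op_eq
    proof (rule sum.mono_neutral_right)
      show "\<forall>I\<in>UNIV - range (\<lambda>j. {j}). theta I * dform (of_pol (pcnj (coef \<tau> I))) \<eta> = 0"
      proof
        fix I assume "I \<in> UNIV - range (\<lambda>j::'a. {j})"
        then have "card I \<noteq> 1" by (auto simp: card_1_singleton_iff)
        then have "coef \<tau> I = 0" using bihom_card[OF \<tau>(1)] by blast
        then show "theta I * dform (of_pol (pcnj (coef \<tau> I))) \<eta> = 0" by simp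
      qed
    qed auto
    also have "\<dots> = (\<Sum>j\<in>UNIV. Th j * dform (of_pol (?q j)) \<eta>)"
      by (subst sum.reindex) (auto simp: inj_on_def)
    finally show ?thesis .
  qed
  ultimately show ?thesis unfolding ext_op_def by (intro exI[of _ ?q]) blast
qed

lemma ext_op_linear:
  assumes "ext_op a T"
  shows "T (\<omega> + \<eta>) = T \<omega> + T \<eta>" "T (fscale c \<eta>) = fscale c (T \<eta>)"
  using assms unfolding ext_op_def
  by (auto simp: dform_add_right distrib_left sum.distrib dform_fscale_right mult_fscale_right fscale_sum)

lemma ext_op_0:
  assumes "ext_op a T" shows "T 0 = 0"
  using ext_op_linear(2)[OF assms, of 0 0] by simp

lemma ext_op_theta_hom:
  assumes "ext_op a T" "theta_hom b \<eta>"
  shows "theta_hom (Suc b) (T \<eta>)"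
  using assms unfolding ext_op_def
  by (auto intro!: theta_hom_sum theta_hom_Th_mult theta_hom_dform_of_pol)

lemma ext_op_anticommute:
  assumes "ext_op a T" "ext_op a' T'"
  shows "T (T' \<eta>) = - T' (T \<eta>)"
proof -
  obtain q q' where T: "\<And>\<eta>. T \<eta> = (\<Sum>j\<in>UNIV. Th j * dform (of_pol (q j)) \<eta>)"
    and T': "\<And>\<eta>. T' \<eta> = (\<Sum>j\<in>UNIV. Th j * dform (of_pol (q' j)) \<eta>)"
    using assms unfolding ext_op_def by blast
  have "T (T' \<eta>) = (\<Sum>j\<in>UNIV. \<Sum>k\<in>UNIV. Th j * (Th k * dform (of_pol (q j)) (dform (of_pol (q' k)) \<eta>)))"
    by (simp add: T T' dform_sum_right sum_distrib_left dform_of_pol_Th)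
  also have "\<dots> = (\<Sum>j\<in>UNIV. \<Sum>k\<in>UNIV. - (Th k * (Th j * dform (of_pol (q' k)) (dform (of_pol (q j)) \<eta>))))"
    by (intro sum.cong refl) (metis Th_anticommute dform_of_pol_commute)
  also have "\<dots> = - (\<Sum>k\<in>UNIV. \<Sum>j\<in>UNIV. Th k * (Th j * dform (of_pol (q' k)) (dform (of_pol (q j)) \<eta>)))"
    by (subst sum.swap) (simp add: sum_negf)
  also have "\<dots> = - T' (T \<eta>)"
    by (simp add: T T' dform_sum_right sum_distrib_left dform_of_pol_Th)
  finally show ?thesis .
qed

text \<open>For an invariant \<open>\<omega>\<close>, the graded commutator of \<open>\<partial>_\<omega>\<close> and \<open>T\<close> is differentiation by a form \<open>\<omega>'\<close> that is
  invariant because both operators are equivariant.  Its \<open>x\<close>-degree is at least \<open>a > 0\<close>, so \<open>\<omega>'\<close> annihilates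
  super harmonics as well.\<close>

lemma superharm_ext_op:
  assumes T: "ext_op a T" "a > 0" and \<eta>: "superharm G \<eta>" and U: "\<And>\<sigma>. \<sigma> \<in> G \<Longrightarrow> unitary \<sigma>"
    and eq: "\<And>\<sigma> \<xi>. \<sigma> \<in> G \<Longrightarrow> T (act \<sigma> \<xi>) = act \<sigma> (T \<xi>)"
  shows "superharm G (T \<eta>)"
  unfolding superharm_def
proof (intro allI impI)
  fix \<omega> :: "'a form" and k b assume \<omega>: "bihom k b \<omega> \<and> k + b > 0 \<and> (\<forall>\<sigma>\<in>G. act \<sigma> \<omega> = \<omega>)"
  obtain q where q: "\<And>j. bihom a 0 (of_pol (q j) :: 'a form)"
    and Tq: "\<And>\<eta>. T \<eta> = (\<Sum>j\<in>UNIV. Th j * dform (of_pol (q j)) \<eta>)"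
    using T(1) unfolding ext_op_def by blast
  define \<omega>' where "\<omega>' = (\<Sum>j\<in>UNIV. of_pol (q j) * dtheta j \<omega>)"
  have gi: "grade_inv \<omega> = fscale ((- 1) ^ b) \<omega>" using bihom_grade_inv \<omega> by blast
  have comm: "dform \<omega> (T \<xi>) = T (dform (grade_inv \<omega>) \<xi>) + dform \<omega>' \<xi>" for \<xi>
    by (simp add: Tq \<omega>'_def dform_sum_left dform_sum_right dform_Th_mult sum.distrib dform_mult
        dform_of_pol_commute)
  \<comment> \<open>A form is determined by its operator, so invariance can be checked on operators.\<close>
  have inv: "act \<sigma> \<omega>' = \<omega>'" if \<sigma>: "\<sigma> \<in> G" for \<sigma>
  proof -
    have "dform (act \<sigma> \<omega>' - \<omega>') \<xi> = 0" for \<xi>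
    proof -
      define \<zeta> where "\<zeta> = act (adj \<sigma>) \<xi>"
      have \<xi>: "\<xi> = act \<sigma> \<zeta>" by (simp add: \<zeta>_def act_adj U \<sigma>)
      have a1: "act \<sigma> \<omega> = \<omega>" "act \<sigma> (grade_inv \<omega>) = grade_inv \<omega>"
        using \<omega> \<sigma> by (simp_all add: gi act_fscale)
      have "dform (act \<sigma> \<omega>') \<xi> = act \<sigma> (dform \<omega>' \<zeta>)"
        by (simp add: \<xi> act_dform[OF U[OF \<sigma>]])
      also have "dform \<omega>' \<zeta> = dform \<omega> (T \<zeta>) - T (dform (grade_inv \<omega>) \<zeta>)" by (simp add: comm)
      also have "act \<sigma> \<dots> = dform \<omega> (T \<xi>) - T (dform (grade_inv \<omega>) \<xi>)"
        by (simp add: act_diff \<xi> act_dform[OF U[OF \<sigma>]] a1 eq[OF \<sigma>] flip: eq[OF \<sigma>, of "dform _ _"])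
      also have "\<dots> = dform \<omega>' \<xi>" by (simp add: comm)
      finally show ?thesis by (simp add: dform_diff_left)
    qed
    then have "act \<sigma> \<omega>' - \<omega>' = 0" by (rule dform_eq_0_imp)
    then show ?thesis by simp
  qed
  have "dform \<omega>' \<eta> = 0"
  proof (cases b)
    case 0
    then have "dtheta j \<omega> = 0" for j using \<omega> dtheta_bihom_0 by blast
    then show ?thesis by (simp add: \<omega>'_def)
  next
    case (Suc b')
    then have "bihom (a + k) b' \<omega>'" unfolding \<omega>'_def
      using \<omega> by (intro bihom_sum bihom_of_pol_mult q bihom_dtheta) auto
    then show ?thesis using superharmD[OF \<eta>] T(2) inv by simp
  qed
  moreover have "dform (grade_inv \<omega>) \<eta> = 0"
  proof -
    have "dform \<omega> \<eta> = 0" using superharmD[OF \<eta>] \<omega> by blast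
    then show ?thesis by (simp add: gi dform_fscale_left)
  qed
  ultimately show "dform \<omega> (T \<eta>) = 0" by (simp add: comm ext_op_0[OF T(1)])
qed


section \<open>Reflections and the Vandermondian\<close>

text \<open>With \<open>a\<close> a linear form that defines the mirror, \<open>s - 1\<close> factors through \<open>a\<close>.\<close>

lemma (in conj_closed_subfield) pseudo_reflection_rank_one:
  assumes s: "pseudo_reflection K (s :: 'n::finite cmat)"
  obtains a b where "\<And>i. a i \<in> K" "\<And>i. b i \<in> K" "\<And>i j. s $ i $ j = (if i = j then 1 else 0) + b i * a j"
    "\<exists>k. b k \<noteq> 0"
proof -
  obtain a where a: "a \<in> K_vecs K" "a \<noteq> 0"
    and fix_a: "\<And>v. v \<in> K_vecs K \<Longrightarrow> (\<Sum>i\<in>UNIV. a $ i * v $ i) = 0 \<Longrightarrow> s *v v = v"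
    using s unfolding pseudo_reflection_def by blast
  have aK: "a $ i \<in> K" for i using a by (simp add: K_vecs_def)
  obtain k where k: "a $ k \<noteq> 0" using a(2) by (metis vec_eq_iff zero_index)
  have sK: "s $ i $ j \<in> K" for i j using s by (auto simp: pseudo_reflection_def GL_def)
  define b where "b i = (s $ i $ k - (if i = k then 1 else 0)) / a $ k" for i
  have bK: "b i \<in> K" for i unfolding b_def
    by (intro K_divide K_diff sK aK) (simp add: K_closed)
  have e: "s $ i $ j = (if i = j then 1 else 0) + b i * a $ j" for i j
  proof -
    define v :: "complex ^ 'n" where "v = (\<chi> m. (if m = j then 1 else 0) - a $ j / a $ k * (if m = k then 1 else 0))"
    have "v \<in> K_vecs K" unfolding v_def K_vecs_def
      by (auto intro!: K_diff K_divide K_closed aK)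
    moreover have "(\<Sum>i\<in>UNIV. a $ i * v $ i) = a $ j - a $ j / a $ k * a $ k"
      by (simp add: v_def right_diff_distrib sum_subtractf sum.delta mult.left_commute[of _ "a $ j / a $ k"]
          if_distrib[of "\<lambda>x. _ * x"] cong: if_cong)
    then have "(\<Sum>i\<in>UNIV. a $ i * v $ i) = 0" using k by simp
    ultimately have 1: "(s *v v) $ i = v $ i" using fix_a by simp
    have 2: "(s *v v) $ i = s $ i $ j - a $ j / a $ k * s $ i $ k"
      by (simp add: v_def matrix_vector_mult_def right_diff_distrib sum_subtractf sum.delta
          if_distrib[of "\<lambda>x. _ * x"] cong: if_cong)
    have 3: "v $ i = (if i = j then 1 else 0) - a $ j / a $ k * (if i = k then 1 else 0)"
      by (simp add: v_def)
    have 4: "b i * a $ j = a $ j / a $ k * s $ i $ k - a $ j / a $ k * (if i = k then 1 else 0)"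
      by (simp add: b_def diff_divide_distrib algebra_simps)
    have lin: "x = d + y" if "w = z" "w = x - t" "z = d - u" "y = t - u" for x y z w t u d :: complex
    proof -
      have "x = w + t" using that(2) by simp
      also have "\<dots> = d + (t - u)" using that(1,3) by simp
      finally show ?thesis using that(4) by simp
    qed
    show ?thesis by (rule lin[OF 1 2 3 4])
  qed
  have "\<exists>k. b k \<noteq> 0"
  proof (rule ccontr)
    assume "\<not> ?thesis"
    then have "s = mat 1" by (simp add: vec_eq_iff e mat_def)
    then show False using s by (simp add: pseudo_reflection_def)
  qed
  then show ?thesis using that[of "\<lambda>i. a $ i" b] aK bK e by blast
qed

text \<open>After the change of basis that replaces \<open>e_k\<close> by \<open>b\<close>, only row \<open>k\<close> of \<open>1 + b a\<^sup>T\<close> differs from the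
  identity.\<close>

lemma det_rank_one:
  fixes s :: "'n::finite cmat"
  assumes e: "\<And>i j. s $ i $ j = (if i = j then 1 else 0) + b i * a j" and k: "b k \<noteq> 0"
  shows "det s = 1 + (\<Sum>i\<in>UNIV. a i * b i)"
proof -
  let ?t = "1 + (\<Sum>i\<in>UNIV. a i * b i)"
  define P :: "'n cmat" where "P = (\<chi> i j. if j = k then b i else if i = j then 1 else 0)"
  define T :: "'n cmat" where "T = (\<chi> i j. if i = k then (if j = k then ?t else a j) else if i = j then 1 else 0)"
  have c: "det (\<chi> i j. if j = k then x i else if i = j then 1 else 0) = x k" for x :: "'n \<Rightarrow> complex"
  proof -
    have "(\<chi> i j. if j = k then (mat 1 *v (\<chi> i. x i)) $ i else (mat 1 :: 'n cmat) $ i $ j) =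
        (\<chi> i j. if j = k then x i else if i = j then 1 else 0)"
      by (simp only: matrix_vector_mul_lid) (auto simp: vec_eq_iff mat_def)
    then show ?thesis using cramer_lemma[of k "mat 1 :: 'n cmat" "\<chi> i. x i"] by simp
  qed
  have dP: "det P = b k" unfolding P_def by (rule c)
  have "transpose T = (\<chi> i j. if j = k then (if i = k then ?t else a i) else if i = j then 1 else 0)"
    by (auto simp: transpose_def T_def vec_eq_iff)
  then have dT: "det T = ?t" using c[of "\<lambda>i. if i = k then ?t else a i"] by (metis det_transpose)
  have "s ** P = P ** T"
  proof -
    have "(\<Sum>m\<in>UNIV. s $ i $ m * P $ m $ j) = (\<Sum>m\<in>UNIV. P $ i $ m * T $ m $ j)" for i j
    proof (cases "j = k")
      case True
      have "(\<Sum>m\<in>UNIV. P $ i $ m * T $ m $ j) = (\<Sum>m\<in>UNIV. if m = k then b i * ?t else 0)"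
        by (rule sum.cong) (auto simp: P_def T_def True)
      then have 1: "(\<Sum>m\<in>UNIV. P $ i $ m * T $ m $ j) = b i * ?t" by (simp add: sum.delta)
      have "(\<Sum>m\<in>UNIV. s $ i $ m * P $ m $ j) = (\<Sum>m\<in>UNIV. (if m = i then b i else 0) + b i * (a m * b m))"
        by (rule sum.cong) (auto simp: P_def e True algebra_simps)
      then show ?thesis unfolding 1 by (simp add: sum.distrib sum.delta sum_distrib_left algebra_simps)
    next
      case False
      have "(\<Sum>m\<in>UNIV. P $ i $ m * T $ m $ j) =
          (\<Sum>m\<in>UNIV. (if m = k then b i * a j else 0) + (if m = j then (if i = j then 1 else 0) else 0))"
        by (rule sum.cong) (use False in \<open>auto simp: P_def T_def\<close>)
      moreover have "(\<Sum>m\<in>UNIV. s $ i $ m * P $ m $ j) = (\<Sum>m\<in>UNIV. if m = j then s $ i $ j else 0)"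
        by (rule sum.cong) (use False in \<open>auto simp: P_def\<close>)
      ultimately show ?thesis by (simp add: sum.distrib sum.delta e)
    qed
    then show ?thesis by (simp add: matrix_matrix_mult_def vec_eq_iff)
  qed
  then have "det s * det P = det P * det T" by (metis det_mul)
  then show ?thesis using k by (simp add: dP dT)
qed

context refl_group
begin

text \<open>The linear form \<open>L = \<Sum>_i cnj (b_i) x_i\<close>, where \<open>b\<close> spans the image of \<open>s - 1\<close>, defines the mirror,
  because \<open>s\<close> is unitary.  Thus \<open>s\<close> moves coordinates by multiples of \<open>L\<close>.\<close>

lemma reflection_facts:
  assumes "pseudo_reflection K s" "s \<in> G"
  obtains a b where "\<And>i. b i \<in> K" "\<exists>k. b k \<noteq> 0"
    "\<And>j. act s (X j) = X j + fscale (a j) (Xc (\<lambda>i. cnj (b i)))"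
    "\<And>j. act s (Th j) = Th j + fscale (a j) (Thc (\<lambda>i. cnj (b i)))"
    "act s (Xc (\<lambda>i. cnj (b i))) = fscale (cnj (det s)) (Xc (\<lambda>i. cnj (b i)))"
    "act s (Thc (\<lambda>i. cnj (b i))) = fscale (cnj (det s)) (Thc (\<lambda>i. cnj (b i)))"
proof -
  obtain a b where ab: "\<And>i. a i \<in> K" "\<And>i. b i \<in> K" "\<And>i j. s $ i $ j = (if i = j then 1 else 0) + b i * a j"
    "\<exists>k. b k \<noteq> 0" using pseudo_reflection_rank_one[OF assms(1)] by blast
  obtain k where "b k \<noteq> 0" using ab(4) by blast
  then have d: "det s = 1 + (\<Sum>i\<in>UNIV. a i * b i)" by (rule det_rank_one[OF ab(3)])
  have v: "(\<lambda>k. cnj (s $ k $ j)) = (\<lambda>k. (if k = j then 1 else 0) + cnj (a j) * cnj (b k))" for j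
    by (auto simp: ab(3))
  have lin: "Xc (\<lambda>k. f k + c * g k) = Xc f + fscale c (Xc g)"
    "Thc (\<lambda>k. f k + c * g k) = Thc f + fscale c (Thc g)" for f g :: "'n \<Rightarrow> complex" and c
    by (simp_all add: Xc_def Thc_def fscale_add_left sum.distrib fscale_sum)
  have lin': "Xc (\<lambda>k. c * g k) = fscale c (Xc g)"
    "Thc (\<lambda>k. c * g k) = fscale c (Thc g)" for g :: "'n \<Rightarrow> complex" and c
    by (simp_all add: Xc_def Thc_def fscale_sum)
  have "(\<Sum>i\<in>UNIV. cnj (s $ k $ i) * cnj (b i)) = cnj (det s) * cnj (b k)" for k
  proof -
    have "(\<Sum>i\<in>UNIV. cnj (s $ k $ i) * cnj (b i)) =
        (\<Sum>i\<in>UNIV. (if i = k then cnj (b k) else 0) + cnj (b k) * cnj (a i * b i))"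
      by (rule sum.cong) (auto simp: ab(3) algebra_simps)
    then show ?thesis by (simp add: d sum.distrib sum.delta sum_distrib_left algebra_simps)
  qed
  then have "act s (Xc (\<lambda>i. cnj (b i))) = fscale (cnj (det s)) (Xc (\<lambda>i. cnj (b i)))"
    "act s (Thc (\<lambda>i. cnj (b i))) = fscale (cnj (det s)) (Thc (\<lambda>i. cnj (b i)))"
    by (simp_all add: act_Xc act_Thc lin')
  moreover have "act s (X j) = X j + fscale (cnj (a j)) (Xc (\<lambda>i. cnj (b i)))"
    "act s (Th j) = Th j + fscale (cnj (a j)) (Thc (\<lambda>i. cnj (b i)))" for j
    unfolding act_X_single act_Th_single v lin by (simp_all add: Xc_unit Thc_unit)
  ultimately show ?thesis using that[of b "\<lambda>j. cnj (a j)"] ab by blast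
qed

lemma det_nonzero: "s \<in> G \<Longrightarrow> det s \<noteq> 0"
  using det_adj_mult[OF G_unitary, of s] by auto

text \<open>\<open>\<theta>_1 \<cdots> \<theta>_n\<close> spans the character \<open>det\<^sup>-\<^sup>1\<close>.  For a pseudo-reflection this holds because
  \<open>\<theta>_1 \<cdots> \<theta>_n\<close> is a multiple of the eigenvector \<open>\<theta>_L\<close>, and the cofactor changes by a multiple of
  \<open>\<theta>_L\<close> only.\<close>

lemma act_theta_UNIV_refl:
  assumes "pseudo_reflection K s" "s \<in> G"
  shows "act s (theta UNIV) = fscale (cnj (det s)) (theta UNIV)"
proof -
  obtain a b where b: "\<exists>k. b k \<noteq> 0"
    and aT: "\<And>j. act s (Th j) = Th j + fscale (a j) (Thc (\<lambda>i. cnj (b i)))"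
    and aL: "act s (Thc (\<lambda>i. cnj (b i))) = fscale (cnj (det s)) (Thc (\<lambda>i. cnj (b i)))"
    using reflection_facts[OF assms] by metis
  let ?L = "Thc (\<lambda>i. cnj (b i)) :: 'n form"
  obtain k where k: "b k \<noteq> 0" using b by blast
  have div: "\<exists>R. act s (prod_list (map Th xs)) = prod_list (map Th xs) + ?L * R" for xs :: "'n list"
  proof (induction xs)
    case Nil
    then show ?case by (intro exI[of _ 0]) simp
  next
    case (Cons i xs)
    let ?W = "prod_list (map Th xs) :: 'n form"
    obtain R where R: "act s ?W = ?W + ?L * R" using Cons by blast
    have "Th i * (?L * R) = - (?L * (Th i * R))"
      using Thc_anticommute[of "\<lambda>k. if k = i then 1 else 0" "\<lambda>i. cnj (b i)" R] by (simp add: Thc_unit)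
    then have "act s (Th i * ?W) = Th i * ?W + ?L * (fscale (a i) ?W - Th i * R)"
      by (simp add: act_mult aT R distrib_left distrib_right right_diff_distrib mult_fscale_left mult_fscale_right)
    then show ?case by auto
  qed
  define Y :: "'n form" where "Y = theta (UNIV - {k})"
  obtain R where R: "act s Y = Y + ?L * R"
    using div[of "sorted_list_of_set (UNIV - {k})"] by (auto simp: Y_def theta_eq_prod_list[of "UNIV - {k}"])
  have T0: "Th i * Y = 0" if "i \<noteq> k" for i
    by (rule form_eqI) (use that in \<open>auto simp: Y_def coef_Th_mult coef_theta\<close>)
  obtain e :: nat where e: "Th k * Y = fscale ((- 1) ^ e) (theta UNIV)"
    using Th_mult_theta[of k "UNIV - {k}"] by (auto simp: Y_def neg_one_power_of_pol insert_UNIV)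
  have "?L * Y = (\<Sum>i\<in>UNIV. if i = k then fscale (cnj (b k)) (Th k * Y) else 0)"
    unfolding Thc_mult by (rule sum.cong) (auto simp: T0)
  then have LY: "?L * Y = fscale (cnj (b k) * (- 1) ^ e) (theta UNIV)" by (simp add: sum.delta e)
  let ?\<kappa> = "cnj (b k) * (- 1) ^ e"
  have "fscale ?\<kappa> (act s (theta UNIV)) = act s (?L * Y)" by (simp add: LY act_fscale)
  also have "\<dots> = fscale (cnj (det s)) (?L * Y)"
    by (simp add: act_mult aL R mult_fscale_left distrib_left)
  finally have "fscale ?\<kappa> (act s (theta UNIV) - fscale (cnj (det s)) (theta UNIV)) = 0"
    by (simp add: LY fscale_diff mult.commute)
  then have "act s (theta UNIV) - fscale (cnj (det s)) (theta UNIV) = 0"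
    by (rule fscale_cancel) (use k in simp)
  then show ?thesis by simp
qed

lemma semi_invariant_extend:
  assumes s: "\<And>s. pseudo_reflection K s \<Longrightarrow> s \<in> G \<Longrightarrow> act s \<omega> = fscale (ch (det s)) \<omega>"
    and ch: "ch 1 = 1" "\<And>x y. ch (x * y) = ch x * ch y" and \<sigma>: "\<sigma> \<in> G"
  shows "act \<sigma> \<omega> = fscale (ch (det \<sigma>)) \<omega>"
  using \<sigma>
proof (induction rule: G_induct)
  case one
  then show ?case by (simp add: act_id ch)
next
  case (refl s)
  then show ?case by (rule s)
next
  case (inv s)
  have "act (adj s) (act s \<omega>) = \<omega>" by (rule act_adj(2)[OF G_unitary[OF inv(1)]])
  then have e: "fscale (ch (det s)) (act (adj s) \<omega>) = \<omega>" by (simp add: inv(2) act_fscale)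
  have "ch (det (adj s)) * ch (det s) = 1" using det_adj_mult[OF G_unitary[OF inv(1)]] ch by metis
  then have "act (adj s) \<omega> = fscale (ch (det (adj s))) (fscale (ch (det s)) (act (adj s) \<omega>))" by simp
  then show ?case by (simp only: e)
next
  case (mult A B)
  then show ?case by (simp add: act_compose act_fscale det_mul ch mult.commute)
qed

lemma act_theta_UNIV: "\<sigma> \<in> G \<Longrightarrow> act \<sigma> (theta UNIV) = fscale (cnj (det \<sigma>)) (theta UNIV)"
  by (rule semi_invariant_extend[where ch = cnj]) (auto intro: act_theta_UNIV_refl)

text \<open>With \<open>L = \<Sum>_i cnj (b_i) x_i\<close> and \<open>c = \<Sum>_i b_i cnj (b_i)\<close> one has \<open>\<partial>_L (L^{m+1} \<omega>) = (m+1) c L^m \<omega> + L^{m+1} \<partial>_L \<omega>\<close>.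
  The last term has an antiderivative by induction, since \<open>\<partial>_L \<omega>\<close> has lower degree; the factor \<open>L^m\<close> in the
  statement is what the induction needs.\<close>

lemma antiderivative:
  fixes \<omega> :: "'n form"
  assumes b: "\<And>i. b i \<in> K" "\<exists>k. b k \<noteq> 0" and \<omega>: "\<omega> \<in> K_forms K" "bihom e 0 \<omega>"
  shows "\<exists>Q\<in>K_forms K. bihom (Suc (m + e)) 0 Q \<and>
    dform (Xc (\<lambda>i. cnj (b i))) Q = Xc (\<lambda>i. cnj (b i)) ^ m * \<omega>"
proof -
  let ?L = "Xc (\<lambda>i. cnj (b i)) :: 'n form"
  define c where "c = (\<Sum>i\<in>UNIV. b i * cnj (b i))"
  have cK: "c \<in> K" unfolding c_def by (intro K_sum K_closed b)
  have "c = of_real (\<Sum>i\<in>UNIV. (cmod (b i))\<^sup>2)" unfolding c_def of_real_sum complex_norm_square ..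
  moreover have "(\<Sum>i\<in>UNIV. (cmod (b i))\<^sup>2) \<noteq> 0"
    using b(2) by (subst sum_nonneg_eq_0_iff) auto
  ultimately have c0: "c \<noteq> 0" using of_real_eq_0_iff by metis
  have D: "dform ?L \<eta> = (\<Sum>i\<in>UNIV. fscale (b i) (dx i \<eta>))" for \<eta>
    using dform_Xc[of "\<lambda>i. cnj (b i)" 1 \<eta>] by simp
  have D1: "dform ?L (?L * \<eta>) = fscale c \<eta> + ?L * dform ?L \<eta>" for \<eta>
    by (simp add: D dx_Xc fscale_add sum.distrib c_def fscale_sum_left sum_distrib_left mult_fscale_right)
  have Dm: "dform ?L (?L ^ Suc m * \<eta>) = fscale (of_nat (Suc m) * c) (?L ^ m * \<eta>) + ?L ^ Suc m * dform ?L \<eta>" for m \<eta>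
  proof (induction m)
    case (Suc m)
    have "dform ?L (?L ^ Suc (Suc m) * \<eta>) = fscale c (?L ^ Suc m * \<eta>) + ?L * dform ?L (?L ^ Suc m * \<eta>)"
      using D1[of "?L ^ Suc m * \<eta>"] by (simp add: mult.assoc)
    also have "\<dots> = (fscale c (?L ^ Suc m * \<eta>) + fscale (of_nat (Suc m) * c) (?L ^ Suc m * \<eta>)) +
        ?L ^ Suc (Suc m) * dform ?L \<eta>"
      unfolding Suc by (simp add: distrib_left mult_fscale_right mult.assoc add.assoc del: of_nat_Suc)
    also have "fscale c (?L ^ Suc m * \<eta>) + fscale (of_nat (Suc m) * c) (?L ^ Suc m * \<eta>) =
        fscale (of_nat (Suc (Suc m)) * c) (?L ^ Suc m * \<eta>)"
      unfolding fscale_add_left[symmetric] by (simp add: algebra_simps)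
    finally show ?case .
  qed (simp add: D1)
  have LK: "?L \<in> K_forms K" by (intro K_forms_Xc K_closed b)
  have LmK: "?L ^ m \<in> K_forms K" for m
    by (induction m) (simp_all add: K_forms_1 K_forms_mult[OF LK])
  have Lm: "bihom a 0 \<eta> \<Longrightarrow> bihom (m + a) 0 (?L ^ m * \<eta>)" for m a \<eta>
    by (induction m) (auto simp: mult.assoc intro: bihom_Xc_mult)
  have nK: "1 / (of_nat (Suc m) * c) \<in> K" for m
    by (intro K_divide K_closed K_of_nat cK)
  show ?thesis using \<omega>
  proof (induction e arbitrary: m \<omega>)
    case 0
    have "dform ?L \<omega> = 0" using dx_bihom_0[OF 0(2)] by (simp add: D)
    then have "dform ?L (fscale (1 / (of_nat (Suc m) * c)) (?L ^ Suc m * \<omega>)) = ?L ^ m * \<omega>"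
      using Dm[of m \<omega>] c0 by (simp add: dform_fscale_right del: power_Suc of_nat_Suc)
    moreover have "bihom (Suc (m + 0)) 0 (fscale (1 / (of_nat (Suc m) * c)) (?L ^ Suc m * \<omega>))"
      using Lm[OF 0(2), of "Suc m"] by (intro bihom_fscale) simp
    moreover have "fscale (1 / (of_nat (Suc m) * c)) (?L ^ Suc m * \<omega>) \<in> K_forms K"
      by (intro K_forms_fscale nK K_forms_mult LmK 0)
    ultimately show ?case by blast
  next
    case (Suc e)
    have "bihom e 0 (dform ?L \<omega>)" unfolding D by (intro bihom_sum bihom_fscale bihom_dx Suc)
    moreover have "dform ?L \<omega> \<in> K_forms K" by (intro K_forms_dform LK Suc)
    ultimately obtain Q where Q: "Q \<in> K_forms K" "bihom (Suc (Suc m + e)) 0 Q"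
      "dform ?L Q = ?L ^ Suc m * dform ?L \<omega>" using Suc.IH[of "dform ?L \<omega>" "Suc m"] by blast
    let ?Q = "fscale (1 / (of_nat (Suc m) * c)) (?L ^ Suc m * \<omega> - Q)"
    have "dform ?L ?Q = ?L ^ m * \<omega>"
      using Dm[of m \<omega>] c0 Q(3) by (simp add: dform_fscale_right dform_diff_right del: power_Suc of_nat_Suc)
    moreover have "bihom (Suc (m + Suc e)) 0 ?Q"
      using Lm[OF Suc(3), of "Suc m"] Q(2) by (intro bihom_fscale bihom_diff) simp_all
    moreover have "?Q \<in> K_forms K"
      by (intro K_forms_fscale nK K_forms_diff K_forms_mult LmK Suc Q)
    ultimately show ?case by blast
  qed
qed

text \<open>Multiplication by \<open>L\<close> is adjoint to \<open>\<partial>_L\<close>, and \<open>s\<close> moves every function by a multiple of \<open>L\<close>.  Hence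
  \<open>W = s P - P\<close> satisfies \<open>\<langle>W, P\<rangle> = \<langle>s W, s P\<rangle> = \<langle>W, s P\<rangle>\<close>, and \<open>W\<close> is orthogonal to itself.\<close>

lemma reflection_fixes_kernel:
  assumes s: "s \<in> G" and aX: "\<And>j. act s (X j) = X j + fscale (a j) (Xc c)"
    and aL: "act s (Xc c) = fscale z (Xc c)" and z: "z \<noteq> 0"
    and p: "dform (Xc c) (of_pol p) = (0 :: 'n form)"
  shows "act s (of_pol p) = (of_pol p :: 'n form)"
proof -
  let ?L = "Xc c :: 'n form"
  let ?l = "\<Sum>i\<in>UNIV. pconst (c i) * pvar i :: 'n mpol"
  have L: "?L = of_pol ?l" by (rule Xc_of_pol)
  let ?s = "psubst (act_var s)"
  have sv: "act_var s i = pvar i + pconst (a i) * ?l" for i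
  proof -
    have "of_pol (act_var s i) = (of_pol (pvar i + pconst (a i) * ?l) :: 'n form)"
      using aX[of i] by (simp add: act_of_pol L of_pol_add of_pol_mult fscale_eq)
    then show ?thesis by (simp only: of_pol_inject)
  qed
  have div: "\<exists>R. ?s q = q + ?l * R" for q
  proof (induction q rule: mpol_induct)
    case (const c)
    then show ?case by (intro exI[of _ 0]) simp
  next
    case (add p q)
    then obtain R R' where "?s p = p + ?l * R" "?s q = q + ?l * R'" by blast
    then have "?s (p + q) = p + q + ?l * (R + R')" by (simp only: psubst_add) (simp add: distrib_left)
    then show ?case by blast
  next
    case (var i q)
    then obtain R where R: "?s q = q + ?l * R" by blast
    have "?s (pvar i * q) = (pvar i + pconst (a i) * ?l) * ?s q" by (simp only: psubst_pvar_mult sv)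
    also have "\<dots> = pvar i * q + ?l * (pvar i * R + pconst (a i) * ?s q)"
      unfolding R by (simp add: distrib_left distrib_right mult.left_commute mult.commute)
    finally show ?case by blast
  qed
  let ?P = "of_pol p :: 'n form"
  have U: "unitary s" using s G_unitary by blast
  have "dform (fscale z ?L) (act s ?P) = 0" using act_dform[OF U, of ?L ?P] p by (simp add: aL)
  then have LsP: "dform ?L (act s ?P) = 0"
    by (auto simp: dform_fscale_left z intro: fscale_cancel)
  define W where "W = act s ?P - ?P"
  have Wp: "W = of_pol (?s p - p)" by (simp add: W_def act_of_pol of_pol_diff)
  obtain R where "?s (?s p - p) = ?s p - p + ?l * R" using div[of "?s p - p"] by blast
  then have "act s W = of_pol (?s p - p + ?l * R)" by (simp only: Wp act_of_pol)
  then have R: "act s W = W + ?L * of_pol R" by (simp only: Wp L of_pol_add of_pol_mult)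
  have "pair W W = pair W (act s ?P - ?P)" by (simp only: flip: W_def)
  then have "pair W W = pair W (act s ?P) - pair W ?P"
    by (simp add: pair_def dform_diff_right lookup_minus)
  also have "pair W ?P = pair (act s W) (act s ?P)" by (rule pair_act[OF U, symmetric])
  also have "\<dots> = pair W (act s ?P)"
    by (simp add: R pair_def dform_add_left lookup_add dform_mult LsP)
  finally have "W = 0" by (intro pair_self_eq_0) simp
  then show ?thesis by (simp add: W_def)
qed

lemma theta_hom_0_of_pol: "bihom a 0 \<omega> \<Longrightarrow> \<exists>p. \<omega> = of_pol p" for \<omega> :: "'n form"
  using bihom_theta_hom theta_hom_bot by blast

lemma vandermondianE:
  assumes "vandermondian K G \<Delta>"
  obtains D where "\<Delta> \<noteq> 0" "\<Delta> \<in> K_forms K" "superharm G \<Delta>" "theta_hom 0 \<Delta>" "bihom D 0 \<Delta>"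
    "\<And>D' \<eta>. D' > D \<Longrightarrow> \<eta> \<in> K_forms K \<Longrightarrow> superharm G \<eta> \<Longrightarrow> bihom D' 0 \<eta> \<Longrightarrow> \<eta> = 0"
proof -
  obtain D where D: "\<Delta> \<noteq> 0" "{\<eta> \<in> SH_deg K G 0. bihom D 0 \<eta>} = {fscale c \<Delta> | c. c \<in> K}"
    "\<forall>D'>D. {\<eta> \<in> SH_deg K G 0. bihom D' 0 \<eta>} = {0}"
    using assms by (auto simp: vandermondian_def)
  have "\<Delta> = fscale 1 \<Delta>" by simp
  then have "\<Delta> \<in> {fscale c \<Delta> | c. c \<in> K}" using K_closed(2) by blast
  then have "\<Delta> \<in> SH_deg K G 0" "bihom D 0 \<Delta>" using D(2) by auto
  moreover have "\<eta> = 0" if "D' > D" "\<eta> \<in> K_forms K" "superharm G \<eta>" "bihom D' 0 \<eta>" for D' \<eta>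
  proof -
    have "\<eta> \<in> {\<eta> \<in> SH_deg K G 0. bihom D' 0 \<eta>}" using that by (simp add: SH_deg_iff bihom_theta_hom)
    then show ?thesis using D(3) that(1) by blast
  qed
  ultimately show ?thesis using that D(1) by (auto simp: SH_deg_iff)
qed

text \<open>Integrate \<open>\<Delta>\<close> in the direction of \<open>L\<close> to \<open>Q\<close>.  Then \<open>Q - s Q\<close> is harmonic, because
  \<open>\<partial>_f Q\<close> is constant along \<open>L\<close> for each invariant \<open>f\<close>; its degree exceeds the top degree of the
  harmonics, so \<open>Q\<close> is fixed by \<open>s\<close>, and \<open>\<Delta> = \<partial>_L Q\<close> transforms like \<open>\<partial>_L\<close>.\<close>

lemma act_vandermondian_refl:
  assumes V: "vandermondian K G \<Delta>" and s: "pseudo_reflection K s" "s \<in> G"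
  shows "act s \<Delta> = fscale (det s) \<Delta>"
proof -
  obtain D where D: "\<Delta> \<in> K_forms K" "superharm G \<Delta>" "bihom D 0 \<Delta>"
    and top: "\<And>D' \<eta>. D' > D \<Longrightarrow> \<eta> \<in> K_forms K \<Longrightarrow> superharm G \<eta> \<Longrightarrow> bihom D' 0 \<eta> \<Longrightarrow> \<eta> = 0"
    using vandermondianE[OF V] by metis
  obtain a b where b: "\<And>i. b i \<in> K" "\<exists>k. b k \<noteq> 0"
    and aX: "\<And>j. act s (X j) = X j + fscale (a j) (Xc (\<lambda>i. cnj (b i)))"
    and aL: "act s (Xc (\<lambda>i. cnj (b i))) = fscale (cnj (det s)) (Xc (\<lambda>i. cnj (b i)))"
    using reflection_facts[OF s] by metis
  let ?L = "Xc (\<lambda>i. cnj (b i)) :: 'n form"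
  have U: "unitary s" using s G_unitary by blast
  have d0: "cnj (det s) \<noteq> 0" using det_nonzero s by simp
  obtain Q where Q: "Q \<in> K_forms K" "bihom (Suc D) 0 Q" "dform ?L Q = \<Delta>"
    using antiderivative[OF b D(1,3), of 0] by auto
  have Lc: "dform ?L (dform \<omega> \<eta>) = dform \<omega> (dform ?L \<eta>)" for \<omega> \<eta>
    by (simp add: Xc_of_pol dform_of_pol_commute)
  define E where "E = Q - act s Q"
  have "superharm G E" unfolding superharm_def
  proof (intro allI impI)
    fix \<omega> :: "'n form" and a' b' assume \<omega>: "bihom a' b' \<omega> \<and> a' + b' > 0 \<and> (\<forall>\<sigma>\<in>G. act \<sigma> \<omega> = \<omega>)"
    have "bihom (Suc D) 0 E" unfolding E_def by (intro bihom_diff bihom_act Q)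
    then obtain e where e: "E = of_pol e" using theta_hom_0_of_pol by blast
    show "dform \<omega> E = 0"
    proof (cases b')
      case (Suc b'')
      then show ?thesis using dform_of_pol_eq_0 \<omega> e by blast
    next
      case 0
      then obtain f where f: "\<omega> = of_pol f" using theta_hom_0_of_pol \<omega> by blast
      have "theta_hom 0 (dform \<omega> Q)" unfolding f
        by (intro theta_hom_dform_of_pol bihom_theta_hom[OF Q(2)])
      then obtain p where p: "dform \<omega> Q = of_pol p" using theta_hom_bot by blast
      have "dform \<omega> \<Delta> = 0" using superharmD[OF D(2)] \<omega> by blast
      then have "dform ?L (of_pol p) = 0" using Lc[of \<omega> Q] p Q(3) by simp
      then have "act s (of_pol p) = (of_pol p :: 'n form)"
        by (rule reflection_fixes_kernel[OF s(2) aX aL d0])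
      moreover have "dform \<omega> (act s Q) = act s (dform \<omega> Q)" using act_dform[OF U] \<omega> s(2) by simp
      ultimately show ?thesis by (simp add: E_def dform_diff_right p)
    qed
  qed
  moreover have "E \<in> K_forms K"
    unfolding E_def by (intro K_forms_diff K_forms_act Q G_entries s)
  moreover have "bihom (Suc D) 0 E" unfolding E_def by (intro bihom_diff bihom_act Q)
  ultimately have "E = 0" using top[of "Suc D"] by simp
  then have "act s Q = Q" by (simp add: E_def)
  then have "act s \<Delta> = dform (act s ?L) Q" using act_dform[OF U, of ?L Q] Q(3) by simp
  then show ?thesis by (simp add: aL dform_fscale_left Q(3))
qed

lemma act_vandermondian:
  "vandermondian K G \<Delta> \<Longrightarrow> \<sigma> \<in> G \<Longrightarrow> act \<sigma> \<Delta> = fscale (det \<sigma>) \<Delta>"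
  by (rule semi_invariant_extend[where ch = "\<lambda>x. x"]) (auto intro: act_vandermondian_refl)

end


section \<open>Dimension and orthogonal bases over a subfield\<close>

definition herm :: "complex ^ 'n \<Rightarrow> complex ^ 'n \<Rightarrow> complex" where
  "herm u v = (\<Sum>i\<in>UNIV. u $ i * cnj (v $ i))"

lemma herm_self: "herm u u = of_real ((norm u)\<^sup>2)"
  by (simp only: herm_def norm_vec_def L2_set_def real_sqrt_pow2 sum_nonneg zero_le_power2
      flip: complex_norm_square of_real_sum)

lemma herm_nonzero: "u \<noteq> 0 \<Longrightarrow> herm u u \<noteq> 0"
  by (simp add: herm_self)

lemma herm_cnj: "cnj (herm u v) = herm v u"
  by (simp add: herm_def mult.commute)

lemma herm_left: "herm (u - v) w = herm u w - herm v w" "herm (c *s u) w = c * herm u w"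
  by (simp_all add: herm_def left_diff_distrib sum_subtractf sum_distrib_left mult.assoc)

lemma herm_sum: "herm (\<Sum>x\<in>A. f x) w = (\<Sum>x\<in>A. herm (f x) w)"
  by (simp add: herm_def sum_distrib_right) (rule sum.swap)

lemma orthogonal_if_herm: "herm u v = 0 \<Longrightarrow> orthogonal u v"
proof -
  have "Re (herm u v) = inner u v"
    by (simp add: herm_def inner_vec_def inner_complex_def)
  then show "herm u v = 0 \<Longrightarrow> orthogonal u v" by (simp add: orthogonal_def)
qed

lemma K_basis_iff:
  "K_basis K (*s) (b :: nat \<Rightarrow> complex ^ 'n) {..<d} W \<longleftrightarrow> b ` {..<d} \<subseteq> W \<and>
     (\<forall>w\<in>W. \<exists>!c. Poly_Mapping.keys c \<subseteq> {..<d} \<and> range (Poly_Mapping.lookup c) \<subseteq> K \<and>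
        w = (\<Sum>i<d. lk c i *s b i))"
proof -
  have "(\<Sum>i\<in>keys c. lk c i *s b i) = (\<Sum>i<d. lk c i *s b i)" if "keys c \<subseteq> {..<d}" for c
    by (rule sum.mono_neutral_left) (use that in \<open>auto simp: in_keys_iff\<close>)
  then have "(keys c \<subseteq> {..<d} \<and> range (lk c) \<subseteq> K \<and> w = (\<Sum>i\<in>keys c. lk c i *s b i)) \<longleftrightarrow>
      (keys c \<subseteq> {..<d} \<and> range (lk c) \<subseteq> K \<and> w = (\<Sum>i<d. lk c i *s b i))" for c w by auto
  then show ?thesis unfolding K_basis_def by presburger
qed

definition pm_of :: "nat \<Rightarrow> (nat \<Rightarrow> complex) \<Rightarrow> nat \<Rightarrow>\<^sub>0 complex" where
  "pm_of d f = (\<Sum>k<d. single k (f k))"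

lemma lookup_pm_of: "lk (pm_of d f) k = (if k < d then f k else 0)"
  by (simp add: pm_of_def lookup_sum lookup_single when_def)

lemma keys_pm_of: "keys (pm_of d f) \<subseteq> {..<d}"
  by (auto simp: in_keys_iff lookup_pm_of split: if_splits)

lemma K_basis_unique:
  assumes "K_basis K (*s) (b :: nat \<Rightarrow> complex ^ 'n) {..<d} W" "0 \<in> K"
    "\<And>k. k < d \<Longrightarrow> f k \<in> K" "\<And>k. k < d \<Longrightarrow> g k \<in> K" "(\<Sum>k<d. f k *s b k) \<in> W"
    "(\<Sum>k<d. f k *s b k) = (\<Sum>k<d. g k *s b k)" "k < d"
  shows "f k = g k"
proof -
  let ?Q = "\<lambda>c. keys c \<subseteq> {..<d} \<and> range (lk c) \<subseteq> K \<and> (\<Sum>k<d. f k *s b k) = (\<Sum>i<d. lk c i *s b i)"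
  have "\<exists>!c. ?Q c" using assms(1,5) unfolding K_basis_iff by blast
  moreover have "?Q (pm_of d f)" using keys_pm_of by (auto simp: lookup_pm_of assms)
  moreover have "?Q (pm_of d g)" using keys_pm_of by (auto simp: lookup_pm_of assms)
  ultimately have "pm_of d f = pm_of d g" by blast
  then show ?thesis using assms(7) by (metis lookup_pm_of)
qed

lemma K_basis_expand:
  assumes "K_basis K (*s) (b :: nat \<Rightarrow> complex ^ 'n) {..<d} W" "w \<in> W"
  shows "\<exists>f. (\<forall>k. f k \<in> K) \<and> w = (\<Sum>k<d. f k *s b k)"
proof -
  obtain c where "range (lk c) \<subseteq> K" "w = (\<Sum>i<d. lk c i *s b i)"
    using assms unfolding K_basis_iff by blast
  then show ?thesis by (intro exI[of _ "lk c"]) auto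
qed

text \<open>The two transition matrices are inverse to each other, and the traces of their two products agree.\<close>

lemma (in conj_closed_subfield) K_basis_length_unique:
  assumes b: "K_basis K (*s) (b :: nat \<Rightarrow> complex ^ 'n) {..<d} W"
    and b': "K_basis K (*s) (b' :: nat \<Rightarrow> complex ^ 'n) {..<d'} W"
  shows "d = d'"
proof -
  have bW: "b j \<in> W" if "j < d" for j using b that by (auto simp: K_basis_def)
  have bW': "b' j \<in> W" if "j < d'" for j using b' that by (auto simp: K_basis_def)
  have "\<forall>j. \<exists>f. j < d \<longrightarrow> (\<forall>k. f k \<in> K) \<and> b j = (\<Sum>k<d'. f k *s b' k)"
    using K_basis_expand[OF b'] bW by blast
  then obtain D where D: "\<And>j k. j < d \<Longrightarrow> D j k \<in> K" "\<And>j. j < d \<Longrightarrow> b j = (\<Sum>k<d'. D j k *s b' k)"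
    by metis
  have "\<forall>j. \<exists>f. j < d' \<longrightarrow> (\<forall>k. f k \<in> K) \<and> b' j = (\<Sum>k<d. f k *s b k)"
    using K_basis_expand[OF b] bW' by blast
  then obtain C where C: "\<And>j k. j < d' \<Longrightarrow> C j k \<in> K" "\<And>j. j < d' \<Longrightarrow> b' j = (\<Sum>k<d. C j k *s b k)"
    by metis
  have diag: "(\<Sum>i<d'. D j i * C i j) = 1" if j: "j < d" 
    and D: "\<And>j k. j < d \<Longrightarrow> D j k \<in> K" "\<And>j. j < d \<Longrightarrow> b j = (\<Sum>k<d'. D j k *s b' k)"
    and C: "\<And>j k. j < d' \<Longrightarrow> C j k \<in> K" "\<And>j. j < d' \<Longrightarrow> b' j = (\<Sum>k<d. C j k *s b k)"
    and b: "K_basis K (*s) b {..<d} W" and bW: "b j \<in> W"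
    for j d d' and b b' :: "nat \<Rightarrow> complex ^ 'n" and C D
  proof -
    have "(\<Sum>k<d. (if k = j then 1 else 0) *s b k) = (\<Sum>k<d. if k = j then b j else 0)"
      by (rule sum.cong) auto
    then have e1: "(\<Sum>k<d. (if k = j then 1 else 0) *s b k) = b j" using j by (simp add: sum.delta)
    have "(\<Sum>k<d. (\<Sum>i<d'. D j i * C i k) *s b k) = (\<Sum>k<d. \<Sum>i<d'. (D j i * C i k) *s b k)"
      by (simp add: vec.scale_sum_left)
    also have "\<dots> = (\<Sum>i<d'. D j i *s (\<Sum>k<d. C i k *s b k))"
      by (subst sum.swap) (simp add: vec.scale_sum_right)
    also have "\<dots> = (\<Sum>i<d'. D j i *s b' i)" by (rule sum.cong) (auto simp: C(2))
    also have "\<dots> = b j" using D(2) j by simp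
    finally have e2: "(\<Sum>k<d. (\<Sum>i<d'. D j i * C i k) *s b k) = b j" .
    have "(if j = j then 1 else 0) = (\<Sum>i<d'. D j i * C i j)"
    proof (rule K_basis_unique[OF b, where k = j and f = "\<lambda>k. if k = j then 1 else 0"
          and g = "\<lambda>k. \<Sum>i<d'. D j i * C i k"])
      show "(\<Sum>i<d'. D j i * C i k) \<in> K" for k
        by (intro K_sum K_closed(4) D(1) C(1)) (use j in auto)
    qed (use K_closed j bW e1 e2 in auto)
    then show ?thesis by simp
  qed
  have "(\<Sum>j<d. \<Sum>i<d'. D j i * C i j) = of_nat d"
    using diag[OF _ D C b bW] by simp
  moreover have "(\<Sum>i<d'. \<Sum>j<d. C i j * D j i) = of_nat d'"
    using diag[OF _ C D b' bW'] by simp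
  moreover have "(\<Sum>j<d. \<Sum>i<d'. D j i * C i j) = (\<Sum>i<d'. \<Sum>j<d. C i j * D j i)"
    by (subst sum.swap) (simp add: mult.commute)
  ultimately show ?thesis by (metis of_nat_eq_iff)
qed

lemma (in conj_closed_subfield) K_dim_eqI:
  assumes "K_basis K (*s) (b :: nat \<Rightarrow> complex ^ 'n) {..<d} W"
  shows "K_dim K (*s) W = d"
  unfolding K_dim_def
  by (rule the_equality) (use assms K_basis_length_unique in blast)+

lemma (in conj_closed_subfield) K_dim_zero: "K_dim K (*s) {0 :: complex ^ 'n} = 0"
proof -
  have "K_basis K (*s) (\<lambda>_. 0 :: complex ^ 'n) {..<0::nat} {0}"
    using K_closed(1) unfolding K_basis_iff by (auto intro!: ex1I[of _ 0])
  then show ?thesis by (rule K_dim_eqI)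
qed

text \<open>An orthogonal system in a \<open>K\<close>-subspace that is maximal is a basis; the real inner product of
  \<open>complex ^ 'n\<close> bounds its size.\<close>

lemma (in conj_closed_subfield) orthogonal_list:
  fixes W :: "(complex ^ 'n) set"
  assumes WK: "W \<subseteq> K_vecs K"
    and add: "\<And>u v. u \<in> W \<Longrightarrow> v \<in> W \<Longrightarrow> u - v \<in> W" and sc: "\<And>c v. c \<in> K \<Longrightarrow> v \<in> W \<Longrightarrow> c *s v \<in> W"
    and 0: "0 \<in> W"
  shows "\<exists>us. length us = K_dim K (*s) W \<and> set us \<subseteq> W \<and> 0 \<notin> set us \<and> sorted_wrt (\<lambda>u v. herm u v = 0) us"
proof -
  let ?P = "\<lambda>S. S \<subseteq> W \<and> 0 \<notin> S \<and> (\<forall>u\<in>S. \<forall>v\<in>S. u \<noteq> v \<longrightarrow> herm u v = 0)"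
  have bound: "finite S \<and> card S \<le> DIM(complex ^ 'n)" if "?P S" for S
  proof -
    have "pairwise orthogonal S" using that by (auto simp: pairwise_def intro: orthogonal_if_herm)
    then have "independent S" using that by (intro pairwise_orthogonal_independent) auto
    then show ?thesis by (rule independent_bound)
  qed
  define m where "m = (GREATEST m. \<exists>S. ?P S \<and> card S = m)"
  have ex: "\<exists>S. ?P S \<and> card S = 0" by (intro exI[of _ "{}"]) auto
  have bd: "\<And>y. \<exists>S. ?P S \<and> card S = y \<Longrightarrow> y \<le> DIM(complex ^ 'n)" using bound by blast
  obtain S where S: "?P S" "card S = m"
    using GreatestI_nat[of "\<lambda>m. \<exists>S. ?P S \<and> card S = m", OF ex bd] unfolding m_def by blast
  have max: "card S' \<le> m" if "?P S'" for S'
    unfolding m_def by (rule Greatest_le_nat[where b = "DIM(complex ^ 'n)"]) (use that bd in blast)+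
  have fS: "finite S" using bound[OF S(1)] by blast
  have nz: "herm u u \<noteq> 0" if "u \<in> S" for u using S(1) that herm_nonzero by metis
  have hK: "herm u v \<in> K" if "u \<in> W" "v \<in> W" for u v
    using WK that unfolding herm_def K_vecs_def by (intro K_sum K_closed) auto
  have hsum: "herm (\<Sum>u\<in>S. c u *s u) v = c v * herm v v" if "v \<in> S" for c v
  proof -
    have "herm (\<Sum>u\<in>S. c u *s u) v = (\<Sum>u\<in>S. if u = v then c v * herm v v else 0)"
      unfolding herm_sum by (rule sum.cong) (use S(1) that in \<open>auto simp: herm_left\<close>)
    then show ?thesis using fS that by (simp add: sum.delta)
  qed
  have span: "v = (\<Sum>u\<in>S. (herm v u / herm u u) *s u)" if v: "v \<in> W" for v
  proof (rule ccontr)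
    assume ne: "\<not> ?thesis"
    define w where "w = v - (\<Sum>u\<in>S. (herm v u / herm u u) *s u)"
    have sumW: "(\<Sum>x\<in>A. g x) \<in> W" if "finite A" "\<And>x. x \<in> A \<Longrightarrow> g x \<in> W" for A and g :: "complex ^ 'n \<Rightarrow> complex ^ 'n"
      using that
    proof (induction A rule: finite_induct)
      case (insert x F)
      have "g x - (0 - (\<Sum>x\<in>F. g x)) \<in> W" using insert 0 by (intro add) auto
      then show ?case using insert by simp
    qed (use 0 in simp)
    have "w \<in> W" unfolding w_def
      by (intro add v sumW fS sc K_divide hK) (use S(1) in auto)
    moreover have "w \<noteq> 0" using ne by (simp add: w_def)
    moreover have orth: "herm w u = 0" if "u \<in> S" for u
      using hsum[OF that] nz[OF that] by (simp add: w_def herm_left)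
    moreover have "herm u w = 0" if "u \<in> S" for u
      using herm_cnj[of w u] orth[OF that] by simp
    ultimately have "?P (insert w S)" using S(1) by auto
    moreover have "w \<notin> S" using orth nz by blast
    ultimately show False using max[of "insert w S"] fS S(2) by simp
  qed
  obtain us where us: "set us = S" "distinct us" using finite_distinct_list[OF fS] by blast
  have len: "length us = m" using us S(2) by (metis distinct_card)
  have re: "(\<Sum>k<m. c (us ! k) *s us ! k) = (\<Sum>u\<in>S. c u *s u)" for c
    using sum.reindex_bij_betw[OF bij_betw_nth[OF us(2) refl us(1)[symmetric]], of "\<lambda>u. c u *s u"]
    by (simp add: len atLeast0LessThan)
  have "K_basis K (*s) (\<lambda>k. us ! k) {..<m} W"
    unfolding K_basis_iff
  proof (intro conjI ballI)
    show "(!) us ` {..<m} \<subseteq> W" using S(1) us(1) len by (auto dest: nth_mem)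
    fix v assume v: "v \<in> W"
    let ?f = "\<lambda>k. herm v (us ! k) / herm (us ! k) (us ! k)"
    show "\<exists>!c. keys c \<subseteq> {..<m} \<and> range (lk c) \<subseteq> K \<and> v = (\<Sum>i<m. lk c i *s us ! i)"
    proof (rule ex1I[of _ "pm_of m ?f"])
      have "v = (\<Sum>k<m. ?f k *s us ! k)" using span[OF v] re[of "\<lambda>u. herm v u / herm u u"] by simp
      moreover have "range (lk (pm_of m ?f)) \<subseteq> K"
        using v S(1) us(1) len by (auto simp: lookup_pm_of intro!: K_divide hK K_closed dest: nth_mem)
      ultimately show "keys (pm_of m ?f) \<subseteq> {..<m} \<and> range (lk (pm_of m ?f)) \<subseteq> K \<and> v = (\<Sum>i<m. lk (pm_of m ?f) i *s us ! i)"
        using keys_pm_of by (simp add: lookup_pm_of)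
    next
      fix c assume c: "keys c \<subseteq> {..<m} \<and> range (lk c) \<subseteq> K \<and> v = (\<Sum>i<m. lk c i *s us ! i)"
      show "c = pm_of m ?f"
      proof (rule poly_mapping_eqI)
        fix k
        show "lk c k = lk (pm_of m ?f) k"
        proof (cases "k < m")
          case True
          then have k: "us ! k \<in> S" using us(1) len by (metis nth_mem)
          have "herm v (us ! k) = (\<Sum>i<m. lk c i * herm (us ! i) (us ! k))"
            using c by (simp add: herm_sum herm_left)
          also have "\<dots> = (\<Sum>i<m. if i = k then lk c k * herm (us ! k) (us ! k) else 0)"
          proof (rule sum.cong, goal_cases)
            case (2 i)
            then have "us ! i \<in> S" "i \<noteq> k \<Longrightarrow> us ! i \<noteq> us ! k"
              using us len True by (auto simp: nth_eq_iff_index_eq)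
            then show ?case using S(1) k by auto
          qed simp
          also have "\<dots> = lk c k * herm (us ! k) (us ! k)" using True by (simp add: sum.delta)
          finally show ?thesis using True nz[OF k] by (simp add: lookup_pm_of)
        next
          case False
          then have "k \<notin> keys c" using c by auto
          then show ?thesis using False by (simp add: lookup_pm_of in_keys_iff)
        qed
      qed
    qed
  qed
  then have "K_dim K (*s) W = m" by (rule K_dim_eqI)
  moreover have "sorted_wrt (\<lambda>u v. herm u v = 0) us"
    unfolding sorted_wrt_iff_nth_less using S(1) us by (metis nth_mem order_less_trans nth_eq_iff_index_eq less_irrefl_nat)
  ultimately show ?thesis using S(1) us len by metis
qed

context refl_group
begin

lemma fixed_space_orthogonal:
  "\<exists>us. length us = K_dim K (*s) (fixed_space K G) \<and> set us \<subseteq> fixed_space K G \<and> 0 \<notin> set us \<and>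
    sorted_wrt (\<lambda>u v. herm u v = 0) us"
proof (rule orthogonal_list)
  show "c *s v \<in> fixed_space K G" if "c \<in> K" "v \<in> fixed_space K G" for c v
    using that by (auto simp: fixed_space_def K_vecs_def vector_scalar_commute intro: K_closed)
qed (auto simp: fixed_space_def K_vecs_def matrix_vector_mult_diff_distrib intro: K_closed K_diff)

end


section \<open>Nonvanishing of the top exterior derivative\<close>

lemma sum_apply: "(\<Sum>i\<in>A. F i) x = (\<Sum>i\<in>A. F i x)" for F :: "'i \<Rightarrow> 'a \<Rightarrow> 'b::comm_monoid_add"
  by (induction A rule: infinite_finite_induct) auto

context refl_group
begin

lemma norm_det: "\<sigma> \<in> G \<Longrightarrow> det \<sigma> * cnj (det \<sigma>) = 1"
proof -
  assume s: "\<sigma> \<in> G"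
  let ?t = "theta UNIV :: 'n form"
  have "pair (fscale (cnj (det \<sigma>)) ?t) (fscale (cnj (det \<sigma>)) ?t) = pair ?t ?t"
    using pair_act[OF G_unitary[OF s], of ?t ?t] by (simp add: act_theta_UNIV[OF s])
  then have "det \<sigma> * cnj (det \<sigma>) * pair ?t ?t = pair ?t ?t"
    by (simp add: pair_def dform_fscale_left dform_fscale_right mult.commute[of "cnj (det \<sigma>)"])
  moreover have "?t \<noteq> 0"
  proof
    assume "?t = 0"
    then have "coef ?t UNIV = coef 0 UNIV" by simp
    then show False by (simp add: coef_theta)
  qed
  then have "pair ?t ?t \<noteq> 0" using pair_self_eq_0 by blast
  ultimately show ?thesis by simp
qed

lemma equivariant_op_all:
  assumes T: "T \<in> equivariant_ops K G" "ext_op a T" and \<sigma>: "\<sigma> \<in> G"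
  shows "T (act \<sigma> \<eta>) = act \<sigma> (T \<eta>)"
proof (rule form_closure[of \<eta>])
  fix I :: "'n set" and \<alpha>
  have "of_pol (single \<alpha> 1) * theta I \<in> K_forms K"
    by (intro K_forms_mult K_forms_of_pol K_pols_single K_closed(2) K_forms_theta)
  then have "T (act \<sigma> (of_pol (single \<alpha> 1) * theta I)) = act \<sigma> (T (of_pol (single \<alpha> 1) * theta I))"
    using T(1) \<sigma> unfolding equivariant_ops_def by blast
  then show "T (act \<sigma> (fscale (lk (coef \<eta> I) \<alpha>) (of_pol (single \<alpha> 1) * theta I))) =
      act \<sigma> (T (fscale (lk (coef \<eta> I) \<alpha>) (of_pol (single \<alpha> 1) * theta I)))"
    by (simp add: act_fscale ext_op_linear[OF T(2)])
qed (simp_all add: act_add ext_op_linear[OF T(2)] ext_op_0[OF T(2)])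

end

locale ext_derivs = refl_group K G for K and G :: "'n::{finite,linorder} cmat set" +
  fixes f :: "nat \<Rightarrow> 'n mpol" and d :: "nat \<Rightarrow> 'n form \<Rightarrow> 'n form" and \<Delta> :: "'n form"
  assumes d: "generalized_exterior_derivatives K G f d" and V: "vandermondian K G \<Delta>"
begin

lemma d_props:
  assumes "i \<in> {1..CARD('n)}"
  obtains a where "ext_op a (d i)" "a > 0 \<longleftrightarrow> i \<le> refl_rank K G" "d i \<in> equivariant_ops K G"
  using assms d unfolding generalized_exterior_derivatives_def by (metis ext_op_if_op_bihom)

lemma d_K_forms:
  assumes "i \<in> {1..CARD('n)}" "\<eta> \<in> K_forms K" shows "d i \<eta> \<in> K_forms K"
proof -
  have "d i \<in> equivariant_ops K G" using d_props[OF assms(1)] by blast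
  then obtain \<omega> where "\<omega> \<in> K_forms K" "d i = symbol_op \<omega>" unfolding equivariant_ops_def by blast
  then show ?thesis using K_forms_symbol_op assms(2) by simp
qed

lemma refl_rank_le: "refl_rank K G \<le> CARD('n)"
  by (simp add: refl_rank_def)

lemma foldr_d_theta_hom:
  "set xs \<subseteq> {1..CARD('n)} \<Longrightarrow> theta_hom (length xs) (foldr d xs \<Delta>)"
proof (induction xs)
  case Nil
  then show ?case using vandermondianE[OF V] by auto
next
  case (Cons x xs)
  then have "x \<in> {1..CARD('n)}" by simp
  then obtain a where "ext_op a (d x)" by (rule d_props)
  then show ?case using ext_op_theta_hom Cons by simp
qed

lemma foldr_d_K_forms: "set xs \<subseteq> {1..CARD('n)} \<Longrightarrow> foldr d xs \<Delta> \<in> K_forms K"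
proof (induction xs)
  case Nil
  then show ?case using vandermondianE[OF V] by auto
qed (simp add: d_K_forms)

lemma foldr_d_superharm: "set xs \<subseteq> {1..refl_rank K G} \<Longrightarrow> superharm G (foldr d xs \<Delta>)"
proof (induction xs)
  case Nil
  then show ?case using vandermondianE[OF V] by auto
next
  case (Cons x xs)
  then have x: "x \<in> {1..CARD('n)}" "x \<le> refl_rank K G" using refl_rank_le by auto
  obtain a where a: "ext_op a (d x)" "a > 0 \<longleftrightarrow> x \<le> refl_rank K G" "d x \<in> equivariant_ops K G"
    using d_props[OF x(1)] by blast
  have "superharm G (d x (foldr d xs \<Delta>))"
  proof (rule superharm_ext_op[OF a(1)])
    show "d x (act \<sigma> \<xi>) = act \<sigma> (d x \<xi>)" if "\<sigma> \<in> G" for \<sigma> \<xi>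
      by (rule equivariant_op_all[OF a(3,1) that])
  qed (use a x Cons G_unitary in auto)
  then show ?case by simp
qed

lemma foldr_d_det:
  assumes "\<sigma> \<in> G"
  shows "set xs \<subseteq> {1..CARD('n)} \<Longrightarrow> act \<sigma> (foldr d xs \<Delta>) = fscale (det \<sigma>) (foldr d xs \<Delta>)"
proof (induction xs)
  case Nil
  then show ?case using act_vandermondian[OF V assms] by simp
next
  case (Cons x xs)
  then have x: "x \<in> {1..CARD('n)}" by simp
  then obtain a where a: "ext_op a (d x)" "d x \<in> equivariant_ops K G" by (rule d_props)
  then show ?case using Cons
    by (simp add: ext_op_linear(2)[OF a(1)] flip: equivariant_op_all[OF a(2,1) assms])
qed

lemma foldr_d_commute:
  assumes "y \<in> {1..CARD('n)}"
  shows "set xs \<subseteq> {1..CARD('n)} \<Longrightarrow> foldr d xs (d y \<eta>) = fscale ((- 1) ^ length xs) (d y (foldr d xs \<eta>))"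
proof (induction xs)
  case (Cons x xs)
  obtain a where a: "ext_op a (d y)" using d_props[OF assms] by blast
  have "x \<in> {1..CARD('n)}" using Cons by simp
  then obtain a' where a': "ext_op a' (d x)" by (rule d_props)
  show ?case using Cons
    by (simp add: ext_op_linear(2)[OF a'] ext_op_anticommute[OF a' a] fscale_uminus fscale_uminus_left)
qed simp

lemma foldr_d_append_0:
  assumes "set xs \<subseteq> {1..CARD('n)}" "set ys \<subseteq> {1..CARD('n)}" "foldr d xs \<Delta> = 0"
  shows "foldr d (xs @ ys) \<Delta> = 0"
  using assms(2)
proof (induction ys)
  case (Cons y ys)
  then have "y \<in> {1..CARD('n)}" by simp
  then obtain a where a: "ext_op a (d y)" by (rule d_props)
  have "foldr d xs (d y (foldr d ys \<Delta>)) = fscale ((- 1) ^ length xs) (d y (foldr d xs (foldr d ys \<Delta>)))"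
    using foldr_d_commute[OF \<open>y \<in> _\<close> assms(1)] by blast
  then show ?case using Cons ext_op_0[OF a] by simp
qed (simp add: assms)

text \<open>If \<open>g\<close> spans the character \<open>det\<^sup>-\<^sup>1\<close>, then \<open>\<theta>_1 \<cdots> \<theta>_n \<partial>_g\<close> is equivariant and thus a
  combination of the basis operators; of these, only those with \<open>I = {1..n}\<close> reach the top
  \<open>\<theta>\<close>-degree.  If \<open>d_1 \<cdots> d_r \<Delta>\<close> were zero, they would all annihilate \<open>\<Delta>\<close>.\<close>

lemma foldr_d_nonzero:
  assumes g: "g \<in> K_pols K" "\<And>\<sigma>. \<sigma> \<in> G \<Longrightarrow> act \<sigma> (of_pol g) = fscale (cnj (det \<sigma>)) (of_pol g)"
    and ne: "dform (of_pol g) \<Delta> \<noteq> 0"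
  shows "foldr d [1..<refl_rank K G + 1] \<Delta> \<noteq> 0"
proof
  assume z: "foldr d [1..<refl_rank K G + 1] \<Delta> = 0"
  have "[1..<CARD('n) + 1] = [1..<refl_rank K G + 1] @ [refl_rank K G + 1..<CARD('n) + 1]"
  proof -
    have "CARD('n) + 1 = refl_rank K G + 1 + (CARD('n) - refl_rank K G)" using refl_rank_le by simp
    then show ?thesis using upt_add_eq_append[of 1 "refl_rank K G + 1" "CARD('n) - refl_rank K G"]
      by (metis le_add2)
  qed
  moreover have "foldr d ([1..<refl_rank K G + 1] @ [refl_rank K G + 1..<CARD('n) + 1]) \<Delta> = 0"
    by (rule foldr_d_append_0[OF _ _ z]) (use refl_rank_le in auto)
  ultimately have z: "foldr d [1..<CARD('n) + 1] \<Delta> = 0" by (simp only:)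
  define T where "T = (\<lambda>\<eta>. theta UNIV * dform (of_pol g) \<eta>)"
  define \<omega> where "\<omega> = of_pol (pcnj g) * (theta UNIV :: 'n form)"
  have "T = symbol_op \<omega>"
  proof
    fix \<eta>
    have "symbol_op \<omega> \<eta> = (\<Sum>I\<in>(UNIV :: 'n set set). if I = UNIV then theta UNIV * dform (of_pol g) \<eta> else 0)"
      unfolding symbol_op_eq by (rule sum.cong) (auto simp: \<omega>_def coef_theta)
    then show "T \<eta> = symbol_op \<omega> \<eta>" by (simp add: T_def sum.delta)
  qed
  moreover have "\<omega> \<in> K_forms K" unfolding \<omega>_def
    by (intro K_forms_mult K_forms_of_pol K_pols_pcnj K_forms_theta g)
  moreover have "T (act \<sigma> \<eta>) = act \<sigma> (T \<eta>)" if "\<sigma> \<in> G" for \<sigma> \<eta>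
    using norm_det[OF that]
    by (simp add: T_def act_mult act_theta_UNIV[OF that] act_dform[OF G_unitary[OF that]] g(2)[OF that]
        dform_fscale_left mult_fscale_left mult_fscale_right mult.commute)
  ultimately have TE: "T \<in> equivariant_ops K G" unfolding equivariant_ops_def by blast
  have B: "K_basis K (\<lambda>c T \<eta>. fscale c (T \<eta>)) (basis_op f d)
      {(\<alpha>, I). keys \<alpha> \<subseteq> {1..CARD('n)} \<and> I \<subseteq> {1..CARD('n)}} (equivariant_ops K G)"
    using d unfolding generalized_exterior_derivatives_def by (rule conjunct2)
  obtain c where cc: "keys c \<subseteq> {(\<alpha>, I). keys \<alpha> \<subseteq> {1..CARD('n)} \<and> I \<subseteq> {1..CARD('n)}} \<and>
      range (lk c) \<subseteq> K \<and> T = (\<Sum>i\<in>keys c. (\<lambda>\<eta>. fscale (lk c i) (basis_op f d i \<eta>)))"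
    using ex1_implies_ex[OF bspec[OF conjunct2[OF B[unfolded K_basis_def]] TE]] by (elim exE) (rule that)
  note c = conjunct1[OF cc] and Tc = conjunct2[OF conjunct2[OF cc]]
  have "T \<Delta> = (\<Sum>i\<in>keys c. fscale (lk c i) (basis_op f d i \<Delta>))"
    by (simp add: Tc sum_apply)
  moreover have "coef (basis_op f d i \<Delta>) UNIV = 0" if "i \<in> keys c" for i
  proof -
    obtain \<alpha> I where i: "i = (\<alpha>, I)" by (cases i)
    then have I: "I \<subseteq> {1..CARD('n)}" using c that by auto
    then have fI: "finite I" using finite_subset by blast
    let ?F = "foldr (\<lambda>i. dform (of_pol (f i)) ^^ lk \<alpha> i) [1..<CARD('n) + 1]"
    have b: "basis_op f d i \<Delta> = ?F (foldr d (sorted_list_of_set I) \<Delta>)" by (simp add: basis_op_def i)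
    show ?thesis
    proof (cases "I = {1..CARD('n)}")
      case True
      have "{1..CARD('n)} = set [1..<CARD('n) + 1]" by auto
      then have "sorted_list_of_set {1..CARD('n)} = [1..<CARD('n) + 1]"
        using sorted_list_of_set.idem_if_sorted_distinct[of "[1..<CARD('n) + 1]"] by (metis distinct_upt sorted_upt)
      then have "foldr d (sorted_list_of_set I) \<Delta> = 0" using z True by simp
      moreover have "(dform (of_pol p) ^^ k) 0 = (0 :: 'n form)" for p k by (induction k) auto
      then have "foldr (\<lambda>i. dform (of_pol (f i)) ^^ lk \<alpha> i) xs 0 = (0 :: 'n form)" for xs
        by (induction xs) auto
      ultimately show ?thesis by (simp add: b)
    next
      case False
      have "theta_hom (length (sorted_list_of_set I)) (foldr d (sorted_list_of_set I) \<Delta>)"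
        by (rule foldr_d_theta_hom) (use I fI in auto)
      then have 1: "theta_hom (card I) (foldr d (sorted_list_of_set I) \<Delta>)" by simp
      have p: "theta_hom k \<eta> \<Longrightarrow> theta_hom k ((dform (of_pol p) ^^ l) \<eta>)" for p k l and \<eta> :: "'n form"
        by (induction l) (auto intro: theta_hom_dform_of_pol)
      have "theta_hom k \<eta> \<Longrightarrow> theta_hom k (foldr (\<lambda>i. dform (of_pol (f i)) ^^ lk \<alpha> i) xs \<eta>)" for xs k and \<eta> :: "'n form"
        by (induction xs) (auto intro: p)
      then have "theta_hom (card I) (basis_op f d i \<Delta>)" unfolding b using 1 by blast
      moreover have "card I < card {1..CARD('n)}" by (rule psubset_card_mono) (use False I in auto)
      ultimately show ?thesis unfolding theta_hom_def by fastforce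
    qed
  qed
  ultimately have "coef (T \<Delta>) UNIV = 0" by simp
  moreover have "theta_hom 0 (dform (of_pol g) \<Delta>)"
    using vandermondianE[OF V] theta_hom_dform_of_pol by metis
  then obtain p where p: "dform (of_pol g) \<Delta> = of_pol p" using theta_hom_bot by blast
  then have "coef (T \<Delta>) UNIV = p" by (simp add: T_def coef_mult_of_pol coef_theta)
  ultimately show False using ne p by simp
qed

end


section \<open>Real groups\<close>

lemma adj_mult: "adj (A ** B) = adj B ** adj A"
  by (simp add: adj_def matrix_matrix_mult_def vec_eq_iff mult.commute)

lemma adj_adj [simp]: "adj (adj A) = A"
  by (simp add: adj_def vec_eq_iff)

lemma unitary_adj: "unitary A \<Longrightarrow> unitary (adj A)"
  by (simp add: unitary_def)

lemma unitary_mult: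
  assumes "unitary A" "unitary B" shows "unitary (A ** B)"
proof -
  have "A ** B ** (adj B ** adj A) = A ** (B ** adj B) ** adj A" by (simp add: matrix_mul_assoc)
  moreover have "adj B ** adj A ** (A ** B) = adj B ** (adj A ** A) ** B" by (simp add: matrix_mul_assoc)
  ultimately show ?thesis using assms by (simp add: unitary_def adj_mult)
qed

lemma unitary_cancel_columns:
  fixes A :: "'n::{finite,linorder} \<Rightarrow> 'n form"
  assumes "unitary U" "\<And>l. (\<Sum>i\<in>UNIV. fscale (cnj (U $ l $ i)) (A i)) = 0"
  shows "A j = 0"
proof -
  have "(\<Sum>l\<in>UNIV. fscale (U $ l $ j) (\<Sum>i\<in>UNIV. fscale (cnj (U $ l $ i)) (A i))) =
      (\<Sum>i\<in>UNIV. fscale (\<Sum>l\<in>UNIV. U $ l $ j * cnj (U $ l $ i)) (A i))"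
    by (simp add: fscale_sum fscale_sum_left) (rule sum.swap)
  also have "\<dots> = (\<Sum>i\<in>UNIV. if i = j then A j else 0)"
    unfolding unitary_columns[OF assms(1)] by (rule sum.cong) auto
  also have "\<dots> = A j" by (simp add: sum.delta)
  finally show ?thesis by (simp add: assms(2))
qed

lemma unitary_cancel_rows:
  fixes A :: "'n::{finite,linorder} \<Rightarrow> 'n form"
  assumes "unitary U" "\<And>j. (\<Sum>k\<in>UNIV. fscale (cnj (U $ k $ j)) (A k)) = 0"
  shows "A l = 0"
proof -
  have "(\<Sum>j\<in>UNIV. fscale (U $ l $ j) (\<Sum>k\<in>UNIV. fscale (cnj (U $ k $ j)) (A k))) =
      (\<Sum>k\<in>UNIV. fscale (\<Sum>j\<in>UNIV. U $ l $ j * cnj (U $ k $ j)) (A k))"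
    by (simp add: fscale_sum fscale_sum_left) (rule sum.swap)
  also have "\<dots> = (\<Sum>k\<in>UNIV. if k = l then A l else 0)"
    unfolding unitary_rows[OF assms(1)] by (rule sum.cong) auto
  also have "\<dots> = A l" by (simp add: sum.delta)
  finally show ?thesis by (simp add: assms(2))
qed

text \<open>The form \<open>\<Sum>_k y_k dy_k\<close>, half the differential of the quadratic form in the coordinates
  \<open>y = U x\<close> in which the group is real.\<close>

definition quad_form :: "'n cmat \<Rightarrow> 'n::{finite,linorder} form" where
  "quad_form U = (\<Sum>k\<in>UNIV. Xc (\<lambda>i. U $ k $ i) * Thc (\<lambda>i. U $ k $ i))"

lemma bihom_quad_form: "bihom 1 1 (quad_form U)"
  unfolding quad_form_def using bihom_Xc_mult[OF bihom_Thc] by (intro bihom_sum) simp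

text \<open>In the coordinates \<open>y\<close> the group consists of real unitary, hence orthogonal, matrices.\<close>

lemma act_quad_form:
  assumes U: "unitary U" and s: "unitary \<sigma>" and R: "\<And>i j. (U ** \<sigma> ** adj U) $ i $ j \<in> \<real>"
  shows "act \<sigma> (quad_form U) = quad_form U"
proof -
  define R where "R = U ** \<sigma> ** adj U"
  have uR: "unitary R" unfolding R_def by (intro unitary_mult U s unitary_adj)
  have "adj R ** U = U ** adj \<sigma> ** (adj U ** U)" by (simp add: R_def adj_mult matrix_mul_assoc)
  then have "adj R ** U = U ** adj \<sigma>" using U by (simp add: unitary_def)
  then have "(\<Sum>j\<in>UNIV. cnj (R $ j $ k) * U $ j $ l) = (\<Sum>i\<in>UNIV. U $ k $ i * cnj (\<sigma> $ l $ i))" for k l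
    by (simp add: vec_eq_iff matrix_matrix_mult_def adj_def)
  moreover have cR: "cnj (R $ j $ k) = R $ j $ k" for j k
    using R[of j k] by (simp add: R_def Reals_cnj_iff)
  ultimately have e: "(\<lambda>l. \<Sum>i\<in>UNIV. cnj (\<sigma> $ l $ i) * U $ k $ i) = (\<lambda>l. \<Sum>j\<in>UNIV. R $ j $ k * U $ j $ l)" for k
    by (simp add: mult.commute)
  have lin: "Xc (\<lambda>l. \<Sum>j\<in>UNIV. r j * U $ j $ l) = (\<Sum>j\<in>UNIV. fscale (r j) (Xc (\<lambda>l. U $ j $ l)))"
    "Thc (\<lambda>l. \<Sum>j\<in>UNIV. r j * U $ j $ l) = (\<Sum>j\<in>UNIV. fscale (r j) (Thc (\<lambda>l. U $ j $ l)))" for r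
    unfolding Xc_def Thc_def fscale_sum fscale_sum_left fscale_fscale by (rule sum.swap)+
  let ?Y = "\<lambda>j. Xc (\<lambda>l. U $ j $ l)" and ?T = "\<lambda>j. Thc (\<lambda>l. U $ j $ l)"
  have "act \<sigma> (quad_form U) = (\<Sum>k\<in>UNIV. \<Sum>j\<in>UNIV. \<Sum>j'\<in>UNIV. fscale (R $ j $ k * R $ j' $ k) (?Y j * ?T j'))"
    unfolding quad_form_def act_sum act_mult act_Xc act_Thc e lin
    by (simp add: sum_product mult_fscale_left mult_fscale_right mult.commute)
  also have "\<dots> = (\<Sum>j\<in>UNIV. \<Sum>j'\<in>UNIV. \<Sum>k\<in>UNIV. fscale (R $ j $ k * R $ j' $ k) (?Y j * ?T j'))"
    by (subst sum.swap) (rule sum.cong[OF refl], rule sum.swap)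
  also have "\<dots> = (\<Sum>j\<in>UNIV. \<Sum>j'\<in>UNIV. fscale (\<Sum>k\<in>UNIV. R $ j $ k * cnj (R $ j' $ k)) (?Y j * ?T j'))"
    by (simp add: fscale_sum_left cR)
  also have "\<dots> = (\<Sum>j\<in>UNIV. \<Sum>j'\<in>UNIV. if j' = j then ?Y j * ?T j else 0)"
    unfolding unitary_rows[OF uR] by (intro sum.cong refl) auto
  also have "\<dots> = quad_form U" by (simp add: sum.delta quad_form_def)
  finally show ?thesis .
qed

text \<open>Conjugation of the coefficients has two effects: the covector of a fixed vector of \<open>G\<close> is invariant,
  and differentiation by \<open>covec u\<close> is the contraction with \<open>u\<close>.\<close>

abbreviation covec :: "(complex, 'n) vec \<Rightarrow> 'n::{finite,linorder} form" where
  "covec u \<equiv> Thc (\<lambda>i. cnj (u $ i))"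

abbreviation wedge :: "(complex, 'n) vec list \<Rightarrow> 'n::{finite,linorder} form \<Rightarrow> 'n form" where
  "wedge us \<eta> \<equiv> foldr (\<lambda>u \<xi>. covec u * \<xi>) us \<eta>"

lemma dform_covec_mult: "dform (covec w) (covec u * \<xi>) = fscale (herm w u) \<xi> - covec u * dform (covec w) \<xi>"
proof -
  have D: "dform (covec w) \<eta> = (\<Sum>i\<in>UNIV. fscale (w $ i) (dtheta i \<eta>))" for \<eta>
    using dform_Thc[of "\<lambda>i. cnj (w $ i)" 1 \<eta>] by simp
  show ?thesis
    by (simp add: D dtheta_Thc fscale_diff sum_subtractf herm_def fscale_sum_left sum_distrib_left mult_fscale_right)
qed

lemma dform_Thc_mult:
  "dform \<omega> (Thc c * \<eta>) = Thc c * dform (grade_inv \<omega>) \<eta> + dform (dform (Thc c) \<omega>) \<eta>"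
proof -
  have D: "dform (Thc c) \<omega> = (\<Sum>i\<in>UNIV. fscale (cnj (c i)) (dtheta i \<omega>))"
    using dform_Thc[of c 1 \<omega>] by simp
  show ?thesis
    by (simp add: D Thc_mult dform_sum_right dform_sum_left dform_fscale_right dform_fscale_left dform_Th_mult
        fscale_add sum.distrib)
qed

lemma wedge_linear:
  "wedge us (\<xi> - \<eta>) = wedge us \<xi> - wedge us \<eta>" "wedge us (fscale c \<eta>) = fscale c (wedge us \<eta>)"
  by (induction us) (simp_all add: right_diff_distrib mult_fscale_right)

lemma wedge_killed:
  assumes "\<forall>u\<in>set us. herm w u = 0" "dform (covec w) \<eta> = 0"
  shows "dform (covec w) (wedge us \<eta>) = 0"
  using assms by (induction us) (simp_all add: dform_covec_mult)

text \<open>On forms that it annihilates, contraction with \<open>u\<close> undoes multiplication by \<open>covec u\<close>; by orthogonality it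
  ignores the other covectors.\<close>

lemma wedge_injective:
  assumes "sorted_wrt (\<lambda>u v. herm u v = 0) us" "0 \<notin> set us" "\<forall>u\<in>set us. dform (covec u) \<eta> = 0"
    "wedge us \<eta> = 0"
  shows "\<eta> = 0"
  using assms
proof (induction us)
  case (Cons u us)
  have "dform (covec u) (covec u * wedge us \<eta>) = 0" using Cons.prems(4) by simp
  moreover have "dform (covec u) (wedge us \<eta>) = 0"
    by (rule wedge_killed) (use Cons.prems in auto)
  ultimately have "fscale (herm u u) (wedge us \<eta>) = 0" by (simp add: dform_covec_mult)
  then have "wedge us \<eta> = 0" by (rule fscale_cancel) (use Cons.prems herm_nonzero in auto)
  then show ?case using Cons by simp
qed simp

lemma wedge_theta_hom: "theta_hom b \<eta> \<Longrightarrow> theta_hom (b + length us) (wedge us \<eta>)"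
  by (induction us) (simp_all add: theta_hom_Thc_mult)

lemma dx_0_imp_const:
  assumes "\<And>i. dx i (of_pol p * theta UNIV) = (0 :: 'n::{finite,linorder} form)"
  shows "\<exists>c. p = pconst c"
proof -
  have d: "pderiv_x i p = 0" for i
  proof -
    have "coef (dx i (of_pol p * theta UNIV :: 'n form)) UNIV = coef 0 UNIV" using assms by simp
    then show ?thesis by (simp add: coef_theta)
  qed
  have "lk p \<alpha> = lk (pconst (lk p 0)) \<alpha>" for \<alpha>
  proof (cases "\<alpha> = 0")
    case False
    then obtain i where i: "lk \<alpha> i > 0" by (metis gr0I lookup_zero poly_mapping_eqI)
    have "lk (pderiv_x i p) (\<alpha> - single i 1) = 0" by (simp add: d)
    then have "lk p (\<alpha> - single i 1 + single i 1) = 0" unfolding lookup_pderiv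
      by (metis mult_eq_0_iff of_nat_eq_0_iff add_is_0 one_neq_zero)
    then have "lk p \<alpha> = 0" using exponent_split[OF i] by (simp add: add.commute)
    then show ?thesis using False by (simp add: pconst_def lookup_single)
  qed (simp add: pconst_def)
  then show ?thesis by (intro exI poly_mapping_eqI)
qed

context refl_group
begin

lemma covec_invariant:
  assumes "w \<in> fixed_space K G" "\<sigma> \<in> G" shows "act \<sigma> (covec w) = covec w"
proof -
  have "(\<sigma> *v w) $ k = w $ k" for k using assms by (auto simp: fixed_space_def)
  then have "(\<Sum>i\<in>UNIV. cnj (\<sigma> $ k $ i) * cnj (w $ i)) = cnj (w $ k)" for k
    by (simp add: matrix_vector_mult_def flip: complex_cnj_mult cnj_sum)
  then show ?thesis by (simp add: act_Thc)
qed

text \<open>Wedging with the covectors of the fixed space moves a super harmonic form \<open>\<eta>\<close> of complementary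
  \<open>\<theta>\<close>-degree into the top degree without leaving the kernel of \<open>\<partial>_\<omega>\<close>, where \<open>\<omega> = \<Sum>_k y_k dy_k\<close>.  The part
  of this kernel in the top \<open>\<theta>\<close>-degree consists of the constant multiples of \<open>\<theta>_1 \<cdots> \<theta>_n\<close>.\<close>

lemma wedge_superharm_const:
  assumes real: "unitary U" "\<And>\<sigma> i j. \<sigma> \<in> G \<Longrightarrow> (U ** \<sigma> ** adj U) $ i $ j \<in> \<real>"
    and \<eta>: "superharm G \<eta>" "theta_hom b \<eta>" and us: "set us \<subseteq> fixed_space K G"
    and top: "b + length us = CARD('n)"
  shows "\<exists>c. wedge us \<eta> = fscale c (theta UNIV)"
proof -
  let ?\<omega> = "quad_form U :: 'n form"
  have inv: "act \<sigma> ?\<omega> = ?\<omega>" if "\<sigma> \<in> G" for \<sigma>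
    by (rule act_quad_form[OF real(1) G_unitary[OF that]]) (use real(2) that in auto)
  have gi: "grade_inv ?\<omega> = - ?\<omega>"
    using bihom_grade_inv[OF bihom_quad_form, of U] by (simp add: fscale_minus_1)
  have inv_k: "act \<sigma> (dform (covec w) ?\<omega>) = dform (covec w) ?\<omega>" if "w \<in> fixed_space K G" "\<sigma> \<in> G" for w \<sigma>
    using that by (simp add: act_dform[OF G_unitary] covec_invariant inv)
  have bk: "bihom 1 0 (dform (covec w) ?\<omega>)" for w
    using dform_Thc[of "\<lambda>i. cnj (w $ i)" 1 ?\<omega>] bihom_quad_form[of U]
    by (auto intro!: bihom_sum bihom_fscale bihom_dtheta)
  have E: "dform ?\<omega> \<eta> = 0" by (rule superharmD[OF \<eta>(1) bihom_quad_form]) (auto simp: inv)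
  have k: "dform (dform (covec w) ?\<omega>) (wedge us \<eta>) = 0" if w: "w \<in> fixed_space K G" for w us
  proof -
    obtain p where p: "dform (covec w) ?\<omega> = of_pol p" using theta_hom_0_of_pol bk by blast
    have c: "dform (of_pol p) (Thc c * \<xi>) = Thc c * dform (of_pol p) \<xi>" for c and \<xi> :: "'n form"
      by (simp add: Thc_mult dform_sum_right dform_fscale_right dform_of_pol_Th)
    have "dform (of_pol p) \<eta> = 0"
      using superharmD[OF \<eta>(1) bk[of w]] inv_k[OF w] p by simp
    then show ?thesis unfolding p by (induction us) (simp_all add: c)
  qed
  have E': "dform ?\<omega> (wedge us \<eta>) = 0"
    using us by (induction us) (simp_all add: E dform_Thc_mult k gi dform_uminus_left)
  define \<xi> where "\<xi> = wedge us \<eta>"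
  have th: "theta_hom CARD('n) \<xi>" using wedge_theta_hom[OF \<eta>(2), of us] top by (simp add: \<xi>_def)
  \<comment> \<open>As \<open>\<theta>_j \<xi> = 0\<close> for degree reasons, the commutator with \<open>\<theta>_j\<close> turns \<open>\<partial>_\<omega> \<xi> = 0\<close> into equations
    for first derivatives; their coefficient matrix is invertible.\<close>
  have "dform (dtheta j ?\<omega>) \<xi> = 0" for j
  proof -
    have "theta_hom (Suc CARD('n)) (Th j * \<xi>)" by (rule theta_hom_Th_mult[OF th])
    then have "Th j * \<xi> = 0" by (rule theta_hom_too_large) simp
    then have "dform ?\<omega> (Th j * \<xi>) = 0" by simp
    then show ?thesis using E' by (simp add: dform_Th_mult gi dform_uminus_left \<xi>_def)
  qed
  moreover have "dtheta j ?\<omega> = (\<Sum>k\<in>UNIV. fscale (U $ k $ j) (Xc (\<lambda>i. U $ k $ i)))" for j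
    using dtheta_Thc[of j _ 1]
    by (simp add: quad_form_def dtheta_sum dtheta_Xc mult_fscale_right)
  ultimately have "(\<Sum>k\<in>UNIV. fscale (cnj (U $ k $ j)) (dform (Xc (\<lambda>i. U $ k $ i)) \<xi>)) = 0" for j
    by (simp add: dform_sum_left dform_fscale_left)
  then have "dform (Xc (\<lambda>i. U $ l $ i)) \<xi> = 0" for l by (rule unitary_cancel_rows[OF real(1)])
  then have "(\<Sum>i\<in>UNIV. fscale (cnj (U $ l $ i)) (dx i \<xi>)) = 0" for l
    using dform_Xc[of "\<lambda>i. U $ l $ i" 1 \<xi>] by simp
  then have "dx i \<xi> = 0" for i by (rule unitary_cancel_columns[OF real(1)])
  then obtain c where "coef \<xi> UNIV = pconst c"
    using dx_0_imp_const theta_hom_top[OF th] by metis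
  then have "\<xi> = fscale c (theta UNIV)" using theta_hom_top[OF th] by (simp add: fscale_eq)
  then show ?thesis unfolding \<xi>_def by blast
qed

text \<open>By the previous lemma, wedging with the covectors of an orthogonal basis of the fixed space maps the
  super harmonics of \<open>\<theta>\<close>-degree \<open>r\<close> to a line.  The map is injective, because invariant covectors
  annihilate super harmonics.\<close>

lemma real_superharm_line:
  assumes "real_group G" and \<eta>: "\<eta> \<in> SH_deg K G (refl_rank K G)" and v: "v \<in> SH_deg K G (refl_rank K G)" "v \<noteq> 0"
  shows "\<exists>c\<in>K. \<eta> = fscale c v"
proof -
  obtain U where U: "unitary U" "\<And>\<sigma> i j. \<sigma> \<in> G \<Longrightarrow> (U ** \<sigma> ** adj U) $ i $ j \<in> \<real>"
    using assms(1) unfolding real_group_def by blast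
  obtain us where us: "length us = K_dim K (*s) (fixed_space K G)" "set us \<subseteq> fixed_space K G" "0 \<notin> set us"
    "sorted_wrt (\<lambda>u v. herm u v = 0) us" using fixed_space_orthogonal by blast
  let ?r = "refl_rank K G"
  have kill: "dform (covec u) \<xi> = 0" if "\<xi> \<in> SH_deg K G ?r" "u \<in> set us" for u \<xi>
    using that us(2) superharmD[OF _ bihom_Thc, of G \<xi>] covec_invariant by (auto simp: SH_deg_iff)
  have "wedge us v \<noteq> 0" using wedge_injective[OF us(4,3)] kill[OF v(1)] v(2) by blast
  moreover have "theta_hom (?r + length us) (wedge us v)"
    using v by (auto intro: wedge_theta_hom simp: SH_deg_iff)
  ultimately have "?r + length us \<le> CARD('n)" using theta_hom_too_large not_le by blast
  then have top: "?r + length us = CARD('n)" using us(1) by (simp add: refl_rank_def)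
  obtain a where a: "wedge us v = fscale a (theta UNIV)"
    using wedge_superharm_const[OF U _ _ us(2) top] v by (auto simp: SH_deg_iff)
  obtain b where b: "wedge us \<eta> = fscale b (theta UNIV)"
    using wedge_superharm_const[OF U _ _ us(2) top] \<eta> by (auto simp: SH_deg_iff)
  have a0: "a \<noteq> 0" using a \<open>wedge us v \<noteq> 0\<close> by auto
  have "\<eta> - fscale (b / a) v = 0"
  proof (rule wedge_injective[OF us(4,3)])
    show "wedge us (\<eta> - fscale (b / a) v) = 0" using a0 by (simp only: wedge_linear a b) simp
    show "\<forall>u\<in>set us. dform (covec u) (\<eta> - fscale (b / a) v) = 0"
      using kill \<eta> v(1) by (simp add: dform_diff_right dform_fscale_right)
  qed
  then have e: "\<eta> = fscale (b / a) v" by simp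
  obtain I where "coef v I \<noteq> 0" using v(2) by (metis form_eqI coef_0)
  then obtain \<alpha> where \<alpha>: "lk (coef v I) \<alpha> \<noteq> 0" using keys_nonempty by (metis in_keys_iff)
  have "lk (coef \<eta> I) \<alpha> = b / a * lk (coef v I) \<alpha>" unfolding e by simp
  then have "b / a = lk (coef \<eta> I) \<alpha> / lk (coef v I) \<alpha>" using \<alpha> by simp
  moreover have "lk (coef \<eta> I) \<alpha> / lk (coef v I) \<alpha> \<in> K"
    using \<eta> v(1) by (intro K_divide) (auto simp: SH_deg_iff K_forms_iff K_pols_iff)
  ultimately show ?thesis using e by metis
qed

text \<open>Conjugation by \<open>U\<close> does not change the determinant, and makes the matrix real.\<close>

lemma real_det:
  assumes "real_group G" "\<sigma> \<in> G" shows "cnj (det \<sigma>) = det \<sigma>"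
proof -
  obtain U where U: "unitary U" "\<And>i j. (U ** \<sigma> ** adj U) $ i $ j \<in> \<real>"
    using assms unfolding real_group_def by blast
  have "det (U ** \<sigma> ** adj U) = det (adj U) * det U * det \<sigma>" by (simp add: det_mul mult_ac)
  also have "\<dots> = det \<sigma>" by (simp add: det_adj_mult[OF U(1)])
  finally have "det \<sigma> = det (U ** \<sigma> ** adj U)" by simp
  also have "\<dots> \<in> \<real>" unfolding det_def by (intro sum_in_Reals Reals_mult Reals_of_int prod_in_Reals U(2))
  finally show ?thesis by (simp add: Reals_cnj_iff)
qed

end

section \<open>Super harmonics generated by one semi-invariant form\<close>

context ext_derivs
begin

abbreviation "topv \<equiv> foldr d [1..<refl_rank K G + 1] \<Delta>"

lemma topv_SH: "topv \<in> SH_deg K G (refl_rank K G)"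
proof -
  define xs where "xs = [1..<refl_rank K G + 1]"
  have s: "set xs \<subseteq> {1..refl_rank K G}" "set xs \<subseteq> {1..CARD('n)}" "length xs = refl_rank K G"
    using refl_rank_le by (auto simp: xs_def)
  show ?thesis unfolding xs_def[symmetric] SH_deg_iff
    using foldr_d_K_forms[OF s(2)] foldr_d_superharm[OF s(1)] foldr_d_theta_hom[OF s(2)] s(3) by simp
qed

lemma SH_deg_dform: "g \<in> K_pols K \<Longrightarrow> \<eta> \<in> SH_deg K G k \<Longrightarrow> dform (of_pol g) \<eta> \<in> SH_deg K G k"
  by (simp add: SH_deg_iff superharm_dform_of_pol theta_hom_dform_of_pol K_forms_dform K_forms_of_pol)

lemma SH_deg_sum:
  assumes "finite F" "\<And>v. v \<in> F \<Longrightarrow> c v \<in> K \<and> v \<in> SH_deg K G k"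
  shows "(\<Sum>v\<in>F. fscale (c v) v) \<in> SH_deg K G k"
  using assms
  by (induction F rule: finite_induct)
    (auto simp: SH_deg_iff K_forms_0 superharm_0 K_forms_fscale superharm_fscale theta_hom_fscale
      intro!: K_forms_add superharm_add theta_hom_add)

text \<open>The three sets form a cycle of inclusions: \<open>gen\<close> puts the super harmonics into the last set, products of
  the \<open>d_i\<close> applied to \<open>\<Delta>\<close> are semi-invariant super harmonics, and super harmonics are closed under
  derivatives and combinations over \<open>K\<close>.\<close>

lemma generated:
  assumes gen: "\<And>\<eta>. \<eta> \<in> SH_deg K G (refl_rank K G) \<Longrightarrow> \<exists>g\<in>K_pols K. \<eta> = dform (of_pol g) topv"
  defines "r \<equiv> refl_rank K G"
  shows "SH_deg K G r = diff_span K (det_part G (SH_deg K G r)) \<and>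
    diff_span K (det_part G (SH_deg K G r)) =
      {dform (of_pol g) (foldr d is \<Delta>) | g is. g \<in> K_pols K \<and> length is = r \<and> set is \<subseteq> {1..r}}"
proof -
  let ?S = "SH_deg K G r"
  let ?D = "diff_span K (det_part G ?S)"
  let ?T = "{dform (of_pol g) (foldr d is \<Delta>) | g is. g \<in> K_pols K \<and> length is = r \<and> set is \<subseteq> {1..r}}"
  have "?S \<subseteq> ?T"
  proof
    fix \<eta> assume "\<eta> \<in> ?S"
    then obtain g where "g \<in> K_pols K" "\<eta> = dform (of_pol g) topv" using gen by (auto simp: r_def)
    moreover have "length [1..<r + 1] = r" "set [1..<r + 1] \<subseteq> {1..r}" by auto
    ultimately show "\<eta> \<in> ?T" unfolding r_def by blast
  qed
  moreover have "?T \<subseteq> ?D"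
  proof
    fix \<eta> assume "\<eta> \<in> ?T"
    then obtain g js where g: "g \<in> K_pols K" and js: "length js = r" "set js \<subseteq> {1..r}"
      and e: "\<eta> = dform (of_pol g) (foldr d js \<Delta>)" by blast
    have s: "set js \<subseteq> {1..refl_rank K G}" "set js \<subseteq> {1..CARD('n)}" using js refl_rank_le by (auto simp: r_def)
    have "foldr d js \<Delta> \<in> det_part G ?S"
      using foldr_d_K_forms[OF s(2)] foldr_d_superharm[OF s(1)] foldr_d_theta_hom[OF s(2)] foldr_d_det[OF _ s(2)] js(1)
      by (auto simp: det_part_def SH_deg_iff)
    then have "\<eta> \<in> {dform (of_pol g) \<eta> | g \<eta>. g \<in> K_pols K \<and> \<eta> \<in> det_part G ?S}"
      unfolding e using g by blast
    then show "\<eta> \<in> ?D" using K_closed(2)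
      unfolding diff_span_def K_span_def by (intro CollectI exI[of _ "{\<eta>}"] exI[of _ "\<lambda>_. 1"]) auto
  qed
  moreover have "?D \<subseteq> ?S"
  proof
    fix \<eta> assume "\<eta> \<in> ?D"
    then obtain F c where F: "finite F" "F \<subseteq> {dform (of_pol g) \<eta> | g \<eta>. g \<in> K_pols K \<and> \<eta> \<in> det_part G ?S}" "c ` F \<subseteq> K"
      and e: "\<eta> = (\<Sum>v\<in>F. fscale (c v) v)"
      unfolding diff_span_def K_span_def by blast
    show "\<eta> \<in> ?S" unfolding e
      by (rule SH_deg_sum[OF F(1)]) (use F SH_deg_dform in \<open>auto simp: det_part_def\<close>)
  qed
  ultimately show ?thesis by blast
qed

text \<open>Since \<open>det\<close> is real, \<open>\<Delta>\<close> itself spans \<open>det\<^sup>-\<^sup>1\<close>, and \<open>\<partial>_\<Delta> \<Delta>\<close> is the square length of \<open>\<Delta>\<close>.\<close>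

lemma real_case:
  assumes "real_group G" "\<eta> \<in> SH_deg K G (refl_rank K G)"
  shows "\<exists>g\<in>K_pols K. \<eta> = dform (of_pol g) topv"
proof -
  obtain D where \<Delta>: "\<Delta> \<noteq> 0" "\<Delta> \<in> K_forms K" "theta_hom 0 \<Delta>"
    using vandermondianE[OF V] by metis
  define \<delta> where "\<delta> = coef \<Delta> {}"
  have D\<delta>: "\<Delta> = of_pol \<delta>" unfolding \<delta>_def by (rule theta_hom_bot[OF \<Delta>(3)])
  have "topv \<noteq> 0"
  proof (rule foldr_d_nonzero)
    show "\<delta> \<in> K_pols K" using \<Delta>(2) by (simp add: \<delta>_def K_forms_iff)
    show "act \<sigma> (of_pol \<delta>) = fscale (cnj (det \<sigma>)) (of_pol \<delta>)" if "\<sigma> \<in> G" for \<sigma>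
      using act_vandermondian[OF V that] real_det[OF assms(1) that] by (simp flip: D\<delta>)
    show "dform (of_pol \<delta>) \<Delta> \<noteq> 0"
    proof
      assume "dform (of_pol \<delta>) \<Delta> = 0"
      then have "pair \<Delta> \<Delta> = 0" by (simp add: pair_def flip: D\<delta>)
      then show False using pair_self_eq_0 \<Delta>(1) by blast
    qed
  qed
  then obtain c where c: "c \<in> K" "\<eta> = fscale c topv"
    using real_superharm_line[OF assms topv_SH] by blast
  have "\<eta> = dform (of_pol (pconst (cnj c))) topv"
    using c(2) dform_fscale_left[of "cnj c" 1 topv] by (simp add: fscale_eq[of "cnj c" 1])
  then show ?thesis using K_pols_pconst K_closed(7)[OF c(1)] by blast
qed

end


section \<open>The groups \<open>G(m,1,n)\<close> with \<open>m \<ge> 2\<close>\<close>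

lemma G_mpn_monomial:
  assumes "(\<sigma> :: 'n::finite cmat) \<in> G_mpn m 1"
  shows "\<exists>\<pi> z. bij \<pi> \<and> (\<forall>i j. \<sigma> $ i $ j = (if i = \<pi> j then z j else 0)) \<and> (\<forall>j. z j ^ m = 1)"
proof -
  have rows: "\<exists>!j. \<sigma> $ i $ j \<noteq> 0" and cols: "\<exists>!i. \<sigma> $ i $ j \<noteq> 0"
    and root: "\<sigma> $ i $ j \<noteq> 0 \<Longrightarrow> (\<sigma> $ i $ j) ^ m = 1" for i j
    using assms by (auto simp: G_mpn_def)
  define \<pi> where "\<pi> j = (THE i. \<sigma> $ i $ j \<noteq> 0)" for j
  have p: "\<sigma> $ \<pi> j $ j \<noteq> 0" for j unfolding \<pi>_def by (rule theI'[OF cols])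
  have "i = \<pi> j" if "\<sigma> $ i $ j \<noteq> 0" for i j using cols[of j] p[of j] that by blast
  then have e: "\<sigma> $ i $ j = (if i = \<pi> j then \<sigma> $ \<pi> j $ j else 0)" for i j by auto
  have "inj \<pi>" using rows p by (metis injI)
  then have "bij \<pi>" by (simp add: finite_UNIV_inj_surj bij_def)
  then show ?thesis
    using e root[OF p] by (intro exI[of _ \<pi>] exI[of _ "\<lambda>j. \<sigma> $ \<pi> j $ j"]) blast
qed

lemma real_group_G_1: "real_group (G_mpn 1 1 :: 'n::finite cmat set)"
proof -
  have a: "adj (mat 1 :: 'n cmat) = mat 1" by (auto simp: adj_def mat_def vec_eq_iff)
  then have u: "unitary (mat 1 :: 'n cmat)" by (simp add: unitary_def)
  have "A $ i $ j \<in> \<real>" if "A \<in> G_mpn 1 1" for A :: "'n cmat" and i j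
  proof (cases "A $ i $ j = 0")
    case False
    then have "(A $ i $ j) ^ 1 = 1" using that unfolding G_mpn_def by blast
    then show ?thesis by simp
  qed simp
  then show ?thesis unfolding real_group_def using u a by (intro exI[of _ "mat 1"]) simp
qed

lemma primitive_root:
  assumes "m \<ge> 1" shows "\<exists>\<zeta> :: complex. \<forall>k. \<zeta> ^ k = 1 \<longleftrightarrow> m dvd k"
proof -
  have "exp (2 * of_real pi * \<i> / of_nat m) ^ k = exp (2 * of_real pi * \<i> * of_nat k / of_nat m)" for k
    by (simp add: exp_of_nat_mult[symmetric] mult_ac)
  then show ?thesis using complex_root_unity_eq_1[OF assms]
    by (intro exI[of _ "exp (2 * of_real pi * \<i> / of_nat m)"]) simp
qed

definition diag_one :: "'n \<Rightarrow> complex \<Rightarrow> 'n::finite cmat" where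
  "diag_one j z = (\<chi> i k. if i = k then (if i = j then z else 1) else 0)"

lemma diag_one_in_G_mpn:
  assumes "z ^ m = 1" "m \<ge> 1" shows "diag_one j z \<in> G_mpn m 1"
proof -
  have z: "z \<noteq> 0" using assms by (auto simp: power_0_left)
  have n: "diag_one j z $ i $ k \<noteq> 0 \<longleftrightarrow> i = k" for i k using z by (simp add: diag_one_def)
  have p: "(diag_one j z $ i $ k) ^ m = 1" if "diag_one j z $ i $ k \<noteq> 0" for i k
    using that assms by (auto simp: diag_one_def split: if_splits)
  have "(\<Prod>(i, k) | diag_one j z $ i $ k \<noteq> 0. diag_one j z $ i $ k) ^ (m div 1) = 1"
    unfolding prod_power_distrib by (rule prod.neutral) (use p in auto)
  then show ?thesis unfolding G_mpn_def using p by (auto simp: n)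
qed

lemma det_diag_one: "det (diag_one j z) = z"
proof -
  have "det (diag_one j z) = (\<Prod>i\<in>UNIV. if i = j then z else 1)"
    by (subst det_diagonal) (auto simp: diag_one_def intro: prod.cong)
  then show ?thesis by (simp add: prod.delta)
qed

lemma psubst_pvar_id: "psubst pvar p = (p :: 'i::finite mpol)"
  by (induction p rule: mpol_induct) (simp_all add: psubst_add psubst_pvar_mult)

lemma prod_pvar: "(\<Prod>i\<in>UNIV. pvar i ^ lk \<alpha> i) = single (\<alpha> :: 'i::finite \<Rightarrow>\<^sub>0 nat) 1"
  using psubst_single[of pvar \<alpha> 1] by (simp add: psubst_pvar_id)

lemma pconst_power: "pconst c ^ k = pconst (c ^ k)"
  by (induction k) (simp_all add: pconst_mult)

lemma pconst_prod: "(\<Prod>i\<in>A. pconst (c i)) = pconst (\<Prod>i\<in>A. c i)"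
  by (induction A rule: infinite_finite_induct) (simp_all add: pconst_mult)

lemma act_diag_one_of_pol: "lk (psubst (act_var (diag_one j z)) p) \<alpha> = cnj z ^ lk \<alpha> j * lk p \<alpha>"
proof (induction p rule: mpol_single_induct)
  case (single \<beta> c)
  have v: "act_var (diag_one j z) i = pconst (if i = j then cnj z else 1) * pvar i" for i
  proof -
    have "act_var (diag_one j z) i = (\<Sum>k\<in>UNIV. if k = i then pconst (if i = j then cnj z else 1) * pvar i else 0)"
      by (rule sum.cong) (auto simp: diag_one_def)
    then show ?thesis by (simp add: sum.delta)
  qed
  have "(\<Prod>i\<in>UNIV. (if i = j then cnj z else 1) ^ lk \<beta> i) = (\<Prod>i\<in>UNIV. if i = j then cnj z ^ lk \<beta> j else 1)"
    by (rule prod.cong) auto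
  then have pr: "(\<Prod>i\<in>UNIV. (if i = j then cnj z else 1) ^ lk \<beta> i) = cnj z ^ lk \<beta> j" by (simp add: prod.delta)
  have "psubst (act_var (diag_one j z)) (single \<beta> c) = pconst c * (pconst (cnj z ^ lk \<beta> j) * single \<beta> 1)"
    unfolding psubst_single v power_mult_distrib prod.distrib pconst_power pconst_prod prod_pvar pr ..
  then show ?case by (auto simp: pconst_mult_single lookup_single when_def)
qed (simp_all add: psubst_add lookup_add distrib_left)

lemma dx_power_0:
  assumes "(dx j ^^ k) \<eta> = (0 :: 'n::{finite,linorder} form)"
  shows "lk (coef \<eta> I) (\<beta> + single j k) = 0"
  using assms
proof (induction k arbitrary: \<eta>)
  case (Suc k)
  have "(dx j ^^ k) (dx j \<eta>) = 0" using Suc(2) by (simp add: funpow_swap1)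
  then have "lk (coef (dx j \<eta>) I) (\<beta> + single j k) = 0" by (rule Suc.IH)
  then have "lk (coef \<eta> I) (\<beta> + single j k + single j 1) = 0"
    unfolding coef_dx lookup_pderiv by (metis mult_eq_0_iff of_nat_eq_0_iff add_is_0 one_neq_zero)
  moreover have "\<beta> + single j k + single j 1 = \<beta> + single j (Suc k)"
    by (simp add: add.assoc flip: single_add)
  ultimately show ?case by metis
qed simp

lemma dform_X_power: "dform (X j ^ k) \<eta> = (dx j ^^ k) (\<eta> :: 'n::{finite,linorder} form)"
  by (induction k arbitrary: \<eta>) (simp_all add: dform_X funpow_swap1)

lemma X_power: "X j ^ k = of_pol (single (single j k) 1)"
  by (induction k) (simp_all add: pvar_mult_single flip: of_pol_mult single_add)

locale monomial_derivs = ext_derivs K G f d \<Delta>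
  for K and G :: "'n::{finite,linorder} cmat set" and f d \<Delta> +
  fixes m :: nat
  assumes G_eq: "G = G_mpn m 1" and m: "m \<ge> 2"
begin

lemma G_root:
  "\<exists>\<zeta>. (\<forall>k. \<zeta> ^ k = 1 \<longleftrightarrow> m dvd k) \<and> (\<forall>j. diag_one j \<zeta> \<in> G) \<and> \<zeta> * cnj \<zeta> = 1"
proof -
  obtain \<zeta> :: complex where z: "\<And>k. \<zeta> ^ k = 1 \<longleftrightarrow> m dvd k" using primitive_root[of m] m by auto
  then have "\<zeta> ^ m = 1" by simp
  then have G: "diag_one j \<zeta> \<in> G" for j unfolding G_eq by (intro diag_one_in_G_mpn) (use m in auto)
  have "\<zeta> * cnj \<zeta> = 1" using norm_det[OF G] by (simp add: det_diag_one)
  then show ?thesis using z G by blast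
qed

lemma refl_rank_monomial: "refl_rank K G = CARD('n)"
proof -
  obtain \<zeta> where z: "\<And>k. \<zeta> ^ k = 1 \<longleftrightarrow> m dvd k" "\<And>j. diag_one j \<zeta> \<in> G" "\<zeta> * cnj \<zeta> = 1"
    using G_root by blast
  have "\<zeta> \<noteq> 1" using z(1)[of 1] m by auto
  have "v = 0" if "v \<in> fixed_space K G" for v
  proof -
    have "v $ j = 0" for j
    proof -
      have "(diag_one j \<zeta> *v v) $ j = (\<Sum>k\<in>UNIV. diag_one j \<zeta> $ j $ k * v $ k)"
        by (simp add: matrix_vector_mult_def)
      also have "\<dots> = (\<Sum>k\<in>UNIV. if k = j then \<zeta> * v $ j else 0)"
        by (rule sum.cong) (auto simp: diag_one_def)
      finally have "(diag_one j \<zeta> *v v) $ j = \<zeta> * v $ j" by (simp add: sum.delta)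
      moreover have "diag_one j \<zeta> *v v = v" using that z(2) by (simp add: fixed_space_def)
      ultimately have "\<zeta> * v $ j = v $ j" by simp
      then show ?thesis using \<open>\<zeta> \<noteq> 1\<close> by simp
    qed
    then show ?thesis by (simp add: vec_eq_iff)
  qed
  then have "fixed_space K G = {0}"
    using K_closed(1) by (auto simp: fixed_space_def K_vecs_def)
  then show ?thesis by (simp add: refl_rank_def K_dim_zero)
qed

text \<open>The exponent of \<open>(x_1 \<cdots> x_n)\<^sup>m\<^sup>-\<^sup>2\<close>.\<close>

definition \<mu> :: "'n \<Rightarrow>\<^sub>0 nat" where "\<mu> = (\<Sum>j\<in>UNIV. single j (m - 2))"

lemma lookup_\<mu>: "lk \<mu> j = m - 2"
  by (simp add: \<mu>_def lookup_sum lookup_single when_def)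

lemma act_monomial:
  assumes "\<sigma> \<in> G"
  shows "\<exists>\<pi> z. bij \<pi> \<and> (\<forall>j. act \<sigma> (X j) = fscale (cnj (z j)) (X (\<pi> j))) \<and>
    (\<forall>j. act \<sigma> (Th j) = fscale (cnj (z j)) (Th (\<pi> j))) \<and> (\<forall>j. z j ^ m = 1) \<and>
    (\<forall>j. z j * cnj (z j) = 1) \<and> (\<forall>i j. \<sigma> $ i $ j = (if i = \<pi> j then z j else 0))"
proof -
  obtain \<pi> z where p: "bij \<pi>" "\<And>i j. \<sigma> $ i $ j = (if i = \<pi> j then z j else 0)" "\<And>j. z j ^ m = 1"
    using G_mpn_monomial assms unfolding G_eq by blast
  have "(\<Sum>i\<in>UNIV. \<sigma> $ i $ j * cnj (\<sigma> $ i $ j)) = (\<Sum>i\<in>UNIV. if i = \<pi> j then z j * cnj (z j) else 0)" for j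
    by (rule sum.cong) (auto simp: p(2))
  then have "z j * cnj (z j) = 1" for j
    using unitary_columns[OF G_unitary[OF assms], of j j] by (simp add: sum.delta)
  moreover have "act \<sigma> (X j) = (\<Sum>i\<in>UNIV. if i = \<pi> j then fscale (cnj (z j)) (X (\<pi> j)) else 0)" for j
    unfolding act_X_single Xc_def by (rule sum.cong) (auto simp: p(2))
  then have "act \<sigma> (X j) = fscale (cnj (z j)) (X (\<pi> j))" for j by (simp add: sum.delta)
  moreover have "act \<sigma> (Th j) = (\<Sum>i\<in>UNIV. if i = \<pi> j then fscale (cnj (z j)) (Th (\<pi> j)) else 0)" for j
    unfolding act_Th_single Thc_def by (rule sum.cong) (auto simp: p(2))
  then have "act \<sigma> (Th j) = fscale (cnj (z j)) (Th (\<pi> j))" for j by (simp add: sum.delta)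
  ultimately show ?thesis using p by (intro exI[of _ \<pi>] exI[of _ z]) blast
qed

text \<open>In the top \<open>\<theta>\<close>-degree, the invariant form \<open>\<Sum>_j x_j\<^sup>m\<^sup>-\<^sup>1 dx_j\<close> imposes that the derivatives of order
  \<open>m - 1\<close> in each coordinate vanish.\<close>

lemma superharm_exponents:
  assumes \<eta>: "superharm G \<eta>" "theta_hom CARD('n) \<eta>" and a: "lk (coef \<eta> I) \<alpha> \<noteq> 0"
  shows "lk \<alpha> j \<le> m - 2"
proof -
  define \<omega> where "\<omega> = (\<Sum>j\<in>UNIV. X j ^ (m - 1) * (Th j :: 'n form))"
  have b: "bihom (m - 1) 1 \<omega>" unfolding \<omega>_def
  proof (intro bihom_sum)
    fix j :: 'n
    have 1: "bihom (m - 1) 0 (X j ^ (m - 1) :: 'n form)"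
      using bihom_monomial[of "single j (m - 1)" "{}" 1] by (simp add: X_power)
    show "bihom (m - 1) 1 (X j ^ (m - 1) * (Th j :: 'n form))"
      using bihom_of_pol_mult[OF 1[unfolded X_power] bihom_Thc[of "\<lambda>k. if k = j then 1 else 0"]]
      by (simp add: X_power Thc_unit)
  qed
  have inv: "act \<sigma> \<omega> = \<omega>" if \<sigma>: "\<sigma> \<in> G" for \<sigma>
  proof -
    obtain \<pi> z where p: "bij \<pi>" "\<And>j. act \<sigma> (X j) = fscale (cnj (z j)) (X (\<pi> j))"
      "\<And>j. act \<sigma> (Th j) = fscale (cnj (z j)) (Th (\<pi> j))" "\<And>j. z j ^ m = 1"
      using act_monomial[OF \<sigma>] by blast
    have pw: "fscale c \<omega> ^ k = fscale (c ^ k) (\<omega> ^ k)" for c k and \<omega> :: "'n form"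
      by (induction k) (simp_all add: mult_fscale_left mult_fscale_right mult.commute)
    have ap: "act \<sigma> (\<omega> ^ k) = act \<sigma> \<omega> ^ k" for k and \<omega> :: "'n form"
      by (induction k) (simp_all add: act_mult)
    have one: "cnj (z j) ^ (m - 1) * cnj (z j) = 1" for j
    proof -
      have "cnj (z j) ^ (m - 1) * cnj (z j) = cnj (z j ^ m)"
        using m by (cases m) (simp_all add: mult.commute)
      then show ?thesis by (simp add: p(4))
    qed
    have "act \<sigma> \<omega> = (\<Sum>j\<in>UNIV. X (\<pi> j) ^ (m - 1) * Th (\<pi> j))"
      by (simp add: \<omega>_def act_sum act_mult ap p(2,3) pw mult_fscale_left mult_fscale_right one[unfolded One_nat_def]
          mult.commute[of "cnj _"])
    also have "\<dots> = \<omega>" unfolding \<omega>_def using p(1) by (rule sum.reindex_bij_betw)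
    finally show ?thesis .
  qed
  have z: "dform \<omega> \<eta> = 0" by (rule superharmD[OF \<eta>(1) b]) (auto simp: inv)
  \<comment> \<open>As \<open>\<theta>_j \<eta> = 0\<close> for degree reasons, the commutator with \<open>\<theta>_j\<close> isolates one summand of \<open>\<omega>\<close>.\<close>
  have "theta_hom (Suc CARD('n)) (Th j * \<eta>)" by (rule theta_hom_Th_mult[OF \<eta>(2)])
  then have "Th j * \<eta> = 0" by (rule theta_hom_too_large) simp
  then have "dform \<omega> (Th j * \<eta>) = 0" by simp
  then have "dform (dtheta j \<omega>) \<eta> = 0"
    using z bihom_grade_inv[OF b] by (simp add: dform_Th_mult dform_uminus_left fscale_minus_1)
  moreover have "dtheta j \<omega> = X j ^ (m - 1)"
  proof -
    have "dtheta j (X i ^ (m - 1) * Th i) = (if i = j then X j ^ (m - 1) else 0 :: 'n form)" for i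
      using dtheta_Th[of j i 1] by (simp add: X_power dtheta_of_pol)
    then show ?thesis by (simp add: \<omega>_def dtheta_sum sum.delta)
  qed
  ultimately have "(dx j ^^ (m - 1)) \<eta> = 0" by (simp add: dform_X_power)
  then have v: "lk (coef \<eta> I) (\<beta> + single j (m - 1)) = 0" for \<beta> by (rule dx_power_0)
  show ?thesis
  proof (rule ccontr)
    assume "\<not> ?thesis"
    then have "m - 1 \<le> lk \<alpha> j" by simp
    then have "\<alpha> = (\<alpha> - single j (m - 1)) + single j (m - 1)"
      by (intro poly_mapping_eqI) (auto simp: lookup_add lookup_minus lookup_single when_def)
    then show False using v a by metis
  qed
qed

text \<open>The exponents are at most \<open>m - 2\<close>, and semi-invariance under the diagonal reflections makes them
  congruent to \<open>-2\<close> modulo \<open>m\<close>.\<close>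

lemma topv_eq: "\<exists>c\<in>K. topv = of_pol (single \<mu> c) * theta UNIV"
proof -
  obtain \<zeta> where z: "\<And>k. \<zeta> ^ k = 1 \<longleftrightarrow> m dvd k" "\<And>j. diag_one j \<zeta> \<in> G" "\<zeta> * cnj \<zeta> = 1"
    using G_root by blast
  define h where "h = coef topv UNIV"
  have v: "topv \<in> K_forms K" "superharm G topv" "theta_hom CARD('n) topv"
    using topv_SH by (auto simp: SH_deg_iff refl_rank_monomial)
  have e: "topv = of_pol h * theta UNIV" unfolding h_def by (rule theta_hom_top[OF v(3)])
  have "\<alpha> = \<mu>" if a: "lk h \<alpha> \<noteq> 0" for \<alpha>
  proof (rule poly_mapping_eqI)
    fix j
    have le: "lk \<alpha> j \<le> m - 2" using superharm_exponents[OF v(2,3)] a unfolding h_def by blast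
    have "set [1..<refl_rank K G + 1] \<subseteq> {1..CARD('n)}" using refl_rank_le by auto
    then have "act (diag_one j \<zeta>) topv = fscale \<zeta> topv"
      using foldr_d_det[OF z(2)[of j]] by (simp only: det_diag_one)
    then have "act (diag_one j \<zeta>) (of_pol h * theta UNIV) = fscale \<zeta> (of_pol h * theta UNIV :: 'n form)"
      by (simp only: e)
    then have "fscale (cnj \<zeta>) (of_pol (psubst (act_var (diag_one j \<zeta>)) h) * theta UNIV) =
        fscale \<zeta> (of_pol h * theta UNIV :: 'n form)"
      by (simp only: act_of_pol_mult act_theta_UNIV[OF z(2)] det_diag_one mult_fscale_right)
    then have "coef (fscale (cnj \<zeta>) (of_pol (psubst (act_var (diag_one j \<zeta>)) h) * theta UNIV)) UNIV =
        coef (fscale \<zeta> (of_pol h * theta UNIV :: 'n form)) UNIV" by (simp only:)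
    then have "pconst (cnj \<zeta>) * psubst (act_var (diag_one j \<zeta>)) h = pconst \<zeta> * h"
      by (simp only: coef_fscale coef_of_pol_mult coef_theta) simp
    then have "lk (pconst (cnj \<zeta>) * psubst (act_var (diag_one j \<zeta>)) h) \<alpha> = lk (pconst \<zeta> * h) \<alpha>" by simp
    then have "cnj \<zeta> ^ Suc (lk \<alpha> j) = \<zeta>" using a by (simp add: act_diag_one_of_pol)
    then have "\<zeta> ^ Suc (lk \<alpha> j) * cnj \<zeta> ^ Suc (lk \<alpha> j) = \<zeta> ^ Suc (Suc (lk \<alpha> j))" by simp
    then have "\<zeta> ^ Suc (Suc (lk \<alpha> j)) = 1" using z(3) by (simp only: flip: power_mult_distrib) simp
    then have "m dvd Suc (Suc (lk \<alpha> j))" using z(1) by blast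
    then have "m \<le> Suc (Suc (lk \<alpha> j))" by (rule dvd_imp_le) simp
    then show "lk \<alpha> j = lk \<mu> j" using le m by (simp add: lookup_\<mu>)
  qed
  then have "h = single \<mu> (lk h \<mu>)" by (intro poly_mapping_eqI) (auto simp: lookup_single when_def)
  moreover have "lk h \<mu> \<in> K" using v(1) by (simp add: h_def K_forms_iff K_pols_iff)
  ultimately show ?thesis using e by metis
qed

text \<open>Each column of \<open>\<sigma>\<close> has one non-zero entry \<open>z\<close>; it contributes \<open>cnj z ^ (m - 2) = z\<^sup>2\<close> to the left-hand side.\<close>

lemma act_monomial_\<mu>:
  assumes "\<sigma> \<in> G"
  shows "act \<sigma> (of_pol (single \<mu> 1)) = fscale (det \<sigma> ^ 2) (of_pol (single \<mu> 1))"
proof -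
  obtain \<pi> z where p: "bij \<pi>" "\<And>j. act \<sigma> (X j) = fscale (cnj (z j)) (X (\<pi> j))"
    "\<And>j. z j ^ m = 1" "\<And>j. z j * cnj (z j) = 1" "\<And>i j. \<sigma> $ i $ j = (if i = \<pi> j then z j else 0)"
    using act_monomial[OF assms] by blast
  have av: "act_var \<sigma> j = pconst (cnj (z j)) * pvar (\<pi> j)" for j
  proof -
    have "(of_pol (act_var \<sigma> j) :: 'n form) = of_pol (pconst (cnj (z j)) * pvar (\<pi> j))"
      using p(2)[of j] by (simp add: act_of_pol fscale_eq of_pol_mult)
    then show ?thesis by (simp only: of_pol_inject)
  qed
  have sq: "cnj (z j) ^ (m - 2) = z j ^ 2" for j
  proof -
    have "cnj (z j) ^ (m - 2) * cnj (z j) ^ 2 = cnj (z j) ^ (m - 2 + 2)" by (simp only: power_add)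
    also have "m - 2 + 2 = m" using m by simp
    also have "cnj (z j) ^ m = 1" by (simp add: p(3) flip: complex_cnj_power)
    finally have "cnj (z j) ^ (m - 2) * (cnj (z j) ^ 2 * z j ^ 2) = z j ^ 2"
      by (simp only: mult_1 flip: mult.assoc)
    moreover have "cnj (z j) ^ 2 * z j ^ 2 = 1"
      using p(4)[of j] by (simp add: mult.commute flip: power_mult_distrib)
    ultimately show ?thesis by simp
  qed
  have "psubst (act_var \<sigma>) (single \<mu> 1) = pconst (\<Prod>j\<in>UNIV. z j ^ 2) * (\<Prod>j\<in>UNIV. pvar (\<pi> j) ^ (m - 2))"
    unfolding psubst_single av power_mult_distrib prod.distrib pconst_power pconst_prod lookup_\<mu> sq by simp
  also have "(\<Prod>j\<in>UNIV. pvar (\<pi> j) ^ (m - 2)) = (\<Prod>j\<in>UNIV. pvar j ^ (m - 2))"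
    using p(1) by (rule prod.reindex_bij_betw)
  also have "\<dots> = single \<mu> 1" using prod_pvar[of \<mu>] by (simp add: lookup_\<mu>)
  finally have "act \<sigma> (of_pol (single \<mu> 1)) = fscale (\<Prod>j\<in>UNIV. z j ^ 2) (of_pol (single \<mu> 1) :: 'n form)"
    by (simp add: act_of_pol of_pol_mult fscale_eq)
  moreover have "(\<Prod>j\<in>UNIV. z j ^ 2) = det \<sigma> ^ 2"
  proof -
    have e: "(transpose \<sigma> ** \<sigma>) $ j $ k = (if j = k then z j ^ 2 else 0)" for j k
    proof -
      have "(transpose \<sigma> ** \<sigma>) $ j $ k = (\<Sum>i\<in>UNIV. \<sigma> $ i $ j * \<sigma> $ i $ k)"
        by (simp add: matrix_matrix_mult_def transpose_def)
      also have "\<dots> = (\<Sum>i\<in>UNIV. if i = \<pi> j then (if j = k then z j ^ 2 else 0) else 0)"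
        by (rule sum.cong) (use bij_is_inj[OF p(1)] in \<open>auto simp: p(5) power2_eq_square dest: injD\<close>)
      finally show ?thesis by (simp add: sum.delta)
    qed
    have "det (transpose \<sigma> ** \<sigma>) = (\<Prod>j\<in>UNIV. z j ^ 2)"
      by (subst det_diagonal) (simp_all add: e)
    then show ?thesis by (simp add: det_mul power2_eq_square)
  qed
  ultimately show ?thesis by simp
qed

text \<open>Semi-invariance under the diagonal reflections shows that \<open>\<Delta>\<close> is divisible by
  \<open>(x_1 \<cdots> x_n)\<^sup>m\<^sup>-\<^sup>2\<close>.  The divisor spans \<open>det\<^sup>2\<close>, so the quotient \<open>g\<close> spans \<open>det\<^sup>-\<^sup>1\<close>, and \<open>\<partial>_g \<Delta> \<noteq> 0\<close>
  because a further derivative of it is \<open>\<partial>_\<Delta> \<Delta>\<close>.\<close>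

lemma topv_nonzero: "topv \<noteq> 0"
proof -
  obtain \<zeta> where z: "\<And>k. \<zeta> ^ k = 1 \<longleftrightarrow> m dvd k" "\<And>j. diag_one j \<zeta> \<in> G" "\<zeta> * cnj \<zeta> = 1"
    using G_root by blast
  have \<Delta>: "\<Delta> \<noteq> 0" "\<Delta> \<in> K_forms K" "theta_hom 0 \<Delta>" using vandermondianE[OF V] by metis+
  define \<delta> where "\<delta> = coef \<Delta> {}"
  have D\<delta>: "\<Delta> = of_pol \<delta>" unfolding \<delta>_def by (rule theta_hom_bot[OF \<Delta>(3)])
  have \<delta>K: "\<delta> \<in> K_pols K" using \<Delta>(2) by (simp add: \<delta>_def K_forms_iff)
  have split: "\<mu> + (\<alpha> - \<mu>) = \<alpha>" if a: "lk \<delta> \<alpha> \<noteq> 0" for \<alpha>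
  proof (rule poly_mapping_eqI)
    fix j
    have "act (diag_one j \<zeta>) \<Delta> = fscale \<zeta> \<Delta>"
      using act_vandermondian[OF V z(2)] by (simp add: det_diag_one)
    then have "coef (act (diag_one j \<zeta>) \<Delta>) {} = coef (fscale \<zeta> \<Delta>) {}" by simp
    then have "psubst (act_var (diag_one j \<zeta>)) \<delta> = pconst \<zeta> * \<delta>"
      by (simp add: D\<delta> act_of_pol coef_of_pol)
    then have "lk (psubst (act_var (diag_one j \<zeta>)) \<delta>) \<alpha> = lk (pconst \<zeta> * \<delta>) \<alpha>" by simp
    then have "cnj \<zeta> ^ lk \<alpha> j = \<zeta>" using a by (simp add: act_diag_one_of_pol)
    then have "\<zeta> ^ lk \<alpha> j * cnj \<zeta> ^ lk \<alpha> j = \<zeta> ^ Suc (lk \<alpha> j)" by simp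
    then have "\<zeta> ^ Suc (lk \<alpha> j) = 1" using z(3) by (simp only: flip: power_mult_distrib) simp
    then have "m dvd Suc (lk \<alpha> j)" using z(1) by blast
    then have "m \<le> Suc (lk \<alpha> j)" by (rule dvd_imp_le) simp
    then show "lk (\<mu> + (\<alpha> - \<mu>)) j = lk \<alpha> j" by (simp add: lookup_add lookup_minus lookup_\<mu>)
  qed
  define g where "g = (\<Sum>\<alpha>\<in>keys \<delta>. single (\<alpha> - \<mu>) (lk \<delta> \<alpha>))"
  have gK: "g \<in> K_pols K" unfolding g_def
    using \<delta>K by (intro K_pols_sum K_pols_single) (auto simp: K_pols_iff)
  have "single \<mu> 1 * g = (\<Sum>\<alpha>\<in>keys \<delta>. single \<alpha> (lk \<delta> \<alpha>))"
    unfolding g_def sum_distrib_left by (rule sum.cong) (auto simp: mult_single split in_keys_iff)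
  then have \<delta>g: "\<delta> = single \<mu> 1 * g" by (simp flip: poly_mapping_expand)
  let ?P = "of_pol (single \<mu> 1) :: 'n form" and ?g = "of_pol g :: 'n form"
  have \<Delta>g: "\<Delta> = ?P * ?g" by (simp add: D\<delta> \<delta>g of_pol_mult)
  have act_g: "act \<sigma> ?g = fscale (cnj (det \<sigma>)) ?g" if \<sigma>: "\<sigma> \<in> G" for \<sigma>
  proof -
    let ?q = "psubst (act_var \<sigma>) g"
    have "fscale (det \<sigma> ^ 2) ?P * act \<sigma> ?g = fscale (det \<sigma>) (?P * ?g)"
      using act_vandermondian[OF V \<sigma>] by (simp add: \<Delta>g act_mult act_monomial_\<mu>[OF \<sigma>])
    then have "(of_pol (pconst (det \<sigma> ^ 2) * (single \<mu> 1 * ?q)) :: 'n form) = of_pol (pconst (det \<sigma>) * (single \<mu> 1 * g))"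
      by (simp only: act_of_pol fscale_eq of_pol_mult mult.assoc)
    then have "pconst (det \<sigma> ^ 2) * (single \<mu> 1 * ?q) = pconst (det \<sigma>) * (single \<mu> 1 * g)"
      by (simp only: of_pol_inject)
    then have "single \<mu> 1 * (pconst (det \<sigma> ^ 2) * ?q - pconst (det \<sigma>) * g) = 0"
      by (simp only: right_diff_distrib mult.left_commute[of "single \<mu> 1"]) simp
    moreover have "single \<mu> (1 :: complex) \<noteq> 0" by (metis lookup_single_eq lookup_zero zero_neq_one)
    ultimately have q: "pconst (det \<sigma> ^ 2) * ?q = pconst (det \<sigma>) * g" by simp
    have c: "cnj (det \<sigma>) ^ 2 * det \<sigma> ^ 2 = 1" "cnj (det \<sigma>) ^ 2 * det \<sigma> = cnj (det \<sigma>)"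
      using norm_det[OF \<sigma>] by (simp_all add: power2_eq_square mult_ac)
    have "pconst (cnj (det \<sigma>) ^ 2) * (pconst (det \<sigma> ^ 2) * ?q) = pconst (cnj (det \<sigma>) ^ 2) * (pconst (det \<sigma>) * g)"
      by (simp only: q)
    then have "?q = pconst (cnj (det \<sigma>)) * g"
      by (simp only: c pconst_simps mult_1 flip: mult.assoc pconst_mult)
    then show ?thesis by (simp add: act_of_pol fscale_eq of_pol_mult)
  qed
  show ?thesis
  proof (rule foldr_d_nonzero[OF gK act_g])
    show "dform ?g \<Delta> \<noteq> 0"
    proof
      assume "dform ?g \<Delta> = 0"
      then have "dform (?g * ?P) \<Delta> = 0" by (simp add: dform_mult)
      then have "pair \<Delta> \<Delta> = 0" using of_pol_central[of ?g "single \<mu> 1"] by (simp add: pair_def \<Delta>g)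
      then show False using pair_self_eq_0 \<Delta>(1) by blast
    qed
  qed
qed

text \<open>By a descent in the exponent, each divisor of \<open>(x_1 \<cdots> x_n)\<^sup>m\<^sup>-\<^sup>2\<close> is up to a scalar a derivative of it.\<close>

lemma monomial_case:
  assumes "\<eta> \<in> SH_deg K G (refl_rank K G)"
  shows "\<exists>g\<in>K_pols K. \<eta> = dform (of_pol g) topv"
proof -
  let ?t = "theta UNIV :: 'n form"
  obtain c where c: "c \<in> K" "topv = of_pol (single \<mu> c) * ?t" using topv_eq by blast
  have c0: "c \<noteq> 0" using topv_nonzero c by auto
  let ?R = "\<lambda>\<xi>. \<exists>g\<in>K_pols K. \<xi> = dform (of_pol g) topv"
  have sc: "?R (fscale a \<xi>)" if a: "a \<in> K" and \<xi>: "?R \<xi>" for a \<xi>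
  proof -
    obtain g where g: "g \<in> K_pols K" "\<xi> = dform (of_pol g) topv" using \<xi> by blast
    have "fscale a \<xi> = dform (of_pol (pconst (cnj a) * g)) topv"
      unfolding g(2) using dform_fscale_left[of "cnj a" "of_pol g" topv] by (simp add: fscale_eq[of "cnj a"] of_pol_mult)
    then show ?thesis using K_pols_mult[OF K_pols_pconst[OF K_closed(7)[OF a]] g(1)] by blast
  qed
  have mono: "?R (of_pol (single \<alpha> 1) * ?t)" if "\<alpha> + \<beta> = \<mu>" for \<alpha> \<beta>
    using that
  proof (induction \<beta> arbitrary: \<alpha> rule: exponent_induct)
    case zero
    have "?R topv" using K_pols_1 by (intro bexI[of _ 1]) simp_all
    then have "?R (fscale (inverse c) topv)" using sc K_closed(6)[OF c(1)] by blast
    moreover have "fscale (inverse c) topv = of_pol (single \<mu> 1) * ?t"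
      unfolding c(2) using c0 by (simp add: fscale_eq pconst_mult_single flip: mult.assoc of_pol_mult)
    ultimately show ?case using zero by simp
  next
    case (step i \<beta>)
    have "?R (of_pol (single (single i 1 + \<alpha>) 1) * ?t)"
      by (rule step.IH) (use step.prems in \<open>simp add: ac_simps\<close>)
    then obtain g where g: "g \<in> K_pols K" "of_pol (single (single i 1 + \<alpha>) 1) * ?t = dform (of_pol g) topv" by blast
    have dt: "dx i ?t = 0"
      by (rule form_eqI) (metis coef_0 coef_dx coef_theta pconst_simps(2) pderiv_0 pderiv_pconst)
    have dp: "dx i (of_pol p * ?t) = of_pol (pderiv_x i p) * ?t" for p
      by (rule form_eqI) (auto simp: coef_theta pderiv_pconst)
    have "dform (of_pol (g * pvar i)) topv = dx i (dform (of_pol g) topv)"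
      using dform_X[of i 1] by (simp add: of_pol_mult dform_mult)
    also have "\<dots> = of_pol (single \<alpha> (of_nat (Suc (lk \<alpha> i)))) * ?t"
      unfolding g(2)[symmetric] by (simp add: dp pderiv_single lookup_add)
    finally have "?R (of_pol (single \<alpha> (of_nat (Suc (lk \<alpha> i)))) * ?t)"
      using K_pols_mult[OF g(1) K_pols_pvar] by metis
    then have "?R (fscale (inverse (of_nat (Suc (lk \<alpha> i)))) (of_pol (single \<alpha> (of_nat (Suc (lk \<alpha> i)))) * ?t))"
      using sc K_closed(6)[OF K_of_nat] by blast
    moreover have "fscale (inverse (of_nat (Suc (lk \<alpha> i)))) (of_pol (single \<alpha> (of_nat (Suc (lk \<alpha> i)))) * ?t) =
        of_pol (single \<alpha> 1) * ?t"
      by (simp add: fscale_eq pconst_mult_single del: of_nat_Suc flip: mult.assoc of_pol_mult)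
    ultimately show ?case by simp
  qed
  have \<eta>: "\<eta> \<in> K_forms K" "superharm G \<eta>" "theta_hom CARD('n) \<eta>"
    using assms by (auto simp: SH_deg_iff refl_rank_monomial)
  show ?thesis
  proof (rule form_closure[of \<eta>])
    fix I \<alpha> assume a: "\<alpha> \<in> keys (coef \<eta> I)"
    then have "coef \<eta> I \<noteq> 0" by auto
    then have "card I = CARD('n)" using \<eta>(3) by (simp add: theta_hom_def)
    then have I: "I = UNIV" by (metis card_subset_eq finite subset_UNIV)
    have le: "lk \<alpha> j \<le> m - 2" for j
      using superharm_exponents[OF \<eta>(2,3)] a by (simp add: in_keys_iff)
    have "\<alpha> + (\<mu> - \<alpha>) = \<mu>"
      by (intro poly_mapping_eqI) (simp only: lookup_add lookup_minus lookup_\<mu> le_add_diff_inverse[OF le])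
    then have "?R (of_pol (single \<alpha> 1) * ?t)" by (rule mono)
    moreover have "lk (coef \<eta> I) \<alpha> \<in> K" using \<eta>(1) by (simp add: K_forms_iff K_pols_iff)
    ultimately show "?R (fscale (lk (coef \<eta> I) \<alpha>) (of_pol (single \<alpha> 1) * theta I))" unfolding I by (intro sc)
  next
    show "?R 0" using K_pols_0 by (intro bexI[of _ 0]) simp_all
  next
    fix \<xi> \<xi>' assume "?R \<xi>" "?R \<xi>'"
    then obtain g g' where "g \<in> K_pols K" "g' \<in> K_pols K" "\<xi> = dform (of_pol g) topv" "\<xi>' = dform (of_pol g') topv" by blast
    then show "?R (\<xi> + \<xi>')"
      using K_pols_add by (intro bexI[of _ "g + g'"]) (simp_all add: of_pol_add dform_add_left)
  qed
qed

end


section \<open>Super harmonics whose \<open>\<theta>\<close>-degree is the rank\<close>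

theorem theorem1p7:
  fixes K :: "complex set"
    and G :: "('n::{finite,linorder}) cmat set"
    and f :: "nat \<Rightarrow> 'n mpol"
    and d :: "nat \<Rightarrow> 'n form \<Rightarrow> 'n form"
    and \<Delta> :: "'n form"
    and r :: nat
  assumes "conj_subfield K"
    and "pseudo_reflection_group K G"
    and "r = refl_rank K G"
    and "(\<exists>m\<ge>1. G = G_mpn m 1) \<or> real_group G"
    and "basic_invariants K G f"
    and "generalized_exterior_derivatives K G f d"
    and "vandermondian K G \<Delta>"
  shows "SH_deg K G r = diff_span K (det_part G (SH_deg K G r)) \<and>
    diff_span K (det_part G (SH_deg K G r)) =
      {dform (of_pol g) (foldr d is \<Delta>) | g is.
         g \<in> K_pols K \<and> length is = r \<and> set is \<subseteq> {1..r}}"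
proof -
  interpret ext_derivs K G f d \<Delta>
    by unfold_locales (use assms in auto)
  have "\<exists>g\<in>K_pols K. \<eta> = dform (of_pol g) topv" if \<eta>: "\<eta> \<in> SH_deg K G (refl_rank K G)" for \<eta>
  proof (cases "real_group G")
    case True
    then show ?thesis using real_case \<eta> by blast
  next
    case False
    then obtain m where m: "m \<ge> 1" "G = G_mpn m 1" using assms(4) by blast
    then have "m \<noteq> 1" using False real_group_G_1 by auto
    then interpret monomial_derivs K G f d \<Delta> m
      by unfold_locales (use m in auto)
    show ?thesis by (rule monomial_case[OF \<eta>])
  qed
  then show ?thesis unfolding assms(3) by (rule generated)
qed

end
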